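(* Let $\lambda\in kG$ have constant term equal to $1$, and for $\alpha\in k$ consider the $H_\lambda$-module $\Delta_\alpha=H_\lambda/(H_\lambda(x-\alpha)+H_\lambda(g-1))$. For $\alpha\neq0$, the simple quotients of $\Delta_\alpha$ are $p^2$-dimensional over $k$. When $\alpha=0$ there are two cases: (i) If $\lambda$ is a zero-divisor in $kG$, then for each $\beta\in k$ the element $y-\beta$ generates a maximal submodule of $\Delta_0$, and so the simple modules obtained from $\Delta_0$ are $1$-dimensional. (ii) If $\lambda$ is invertible in $kG$, then for each $\beta\in k$ the element $Y-\beta:=y^p-y\frac{\delta^p(g)}{\delta(g)}-\beta$ generates a maximal submodule of $\Delta_0$, and so the simple modules obtained from $\Delta_0$ are $p$-dimensional.
   Context: Let $p$ be an odd prime, $k$ an algebraically closed field of characteristic $p$, and $G=\langle g\rangle$ the cyclic group of order $p$ generated by $g=\begin{pmatrix}1&1\\0&1\end{pmatrix}\in \mathrm{SL}(2,p)$. $G$ acts on the free algebra $k\langle x,y\rangle$ by algebra automorphisms with $g\cdot x=x$, $g\cdot y=x+y$, and $k\langle x,y\rangle\rtimes G$ is the smash product (so $gf=(g\cdot f)g$). For $\lambda\in kG$ set $H_\lambda=(k\langle x,y\rangle\rtimes G)/(xy-yx-\lambda)$. The constant term of $\lambda=\sum c_ig^i$ is $c_0$. Modules are left modules. $\delta$ is the derivation of $R=k[x]\otimes kG$ with $\delta(x)=\lambda$, $\delta(g)=xg$, and $\delta^p(g)/\delta(g)$ is the element $r\in R$ with $r\,\delta(g)=\delta^p(g)$. "An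 element generates a submodule of $\Delta_0$" refers to its image in $\Delta_0$. *)

theory Defs
  imports
    "HOL-Library.Poly_Mapping"
    "HOL-Algebra.QuotRing"
    "HOL-Algebra.Elementary_Groups"
    "Jordan_Normal_Form.VS_Connect"
begin

datatype letter = LX | LY

datatype monom2 = Word "letter list"

instantiation monom2 :: monoid_add
begin

definition zero_monom2 :: monom2 where
  "0 = Word []"

fun plus_monom2 :: "monom2 \<Rightarrow> monom2 \<Rightarrow> monom2" where
  "Word u + Word v = Word (u @ v)"

instance
proof
  fix a b c :: monom2
  show "a + b + c = a + (b + c)" by (cases a; cases b; cases c) simp
  show "0 + a = a" "a + 0 = a" by (cases a; simp add: zero_monom2_def)+
qed

end

text \<open>
  The monoid of words is written additively because the product of \<^typ>\<open>'a \<Rightarrow>\<^sub>0 'b\<close> is convolution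
  along the addition of the index type; here that addition is concatenation, so the product is
  the noncommutative product of the free algebra.
\<close>

type_synonym 'k free_alg = "monom2 \<Rightarrow>\<^sub>0 'k"

definition free_const :: "'k \<Rightarrow> ('k::field) free_alg" where
  "free_const c = Poly_Mapping.single 0 c"

definition free_var :: "letter \<Rightarrow> ('k::field) free_alg" where
  "free_var l = Poly_Mapping.single (Word [l]) 1"

fun subst_word :: "(letter \<Rightarrow> 'k free_alg) \<Rightarrow> monom2 \<Rightarrow> ('k::field) free_alg" where
  "subst_word s (Word u) = prod_list (map s u)"

definition free_subst :: "(letter \<Rightarrow> 'k free_alg) \<Rightarrow> 'k free_alg \<Rightarrow> ('k::field) free_alg" where
  "free_subst s f = (\<Sum>w\<in>Poly_Mapping.keys f. free_const (Poly_Mapping.lookup f w) * subst_word s w)"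

definition g_act :: "'k free_alg \<Rightarrow> ('k::field) free_alg" where
  "g_act = free_subst (\<lambda>l. case l of LX \<Rightarrow> free_var LX | LY \<Rightarrow> free_var LX + free_var LY)"

text \<open>
  For a finite group \<open>G\<close> acting on a ring \<open>A\<close>, the function \<open>f\<close> stands for the sum of the
  \<open>f a \<cdot> a\<close> over \<open>a \<in> G\<close>, with coefficients on the left. The product below is the one
  determined by \<open>a u = (act a u) a\<close>.
\<close>

definition smash_product ::
  "('g, 'm) monoid_scheme \<Rightarrow> ('g \<Rightarrow> 'a \<Rightarrow> 'a) \<Rightarrow> ('g \<Rightarrow> 'a::ring_1) ring" where
  "smash_product G act =
    \<lparr> carrier = {f. \<forall>h. h \<notin> carrier G \<longrightarrow> f h = 0},
      mult = (\<lambda>f f' h. if h \<in> carrier G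
                then \<Sum>a\<in>carrier G. f a * act a (f' (inv\<^bsub>G\<^esub> a \<otimes>\<^bsub>G\<^esub> h)) else 0),
      one = (\<lambda>h. if h = \<one>\<^bsub>G\<^esub> then 1 else 0),
      zero = (\<lambda>_. 0),
      add = (\<lambda>f f' h. f h + f' h) \<rparr>"

definition smash_single :: "'g \<Rightarrow> 'a::ring_1 \<Rightarrow> 'g \<Rightarrow> 'a" where
  "smash_single h u = (\<lambda>h'. if h' = h then u else 0)"

text \<open>
  The cyclic group generated by the matrix \<open>g\<close> is represented as \<open>\<int>/p\<close>, with \<open>i \<in> {0..<p}\<close>
  standing for \<open>g ^ i\<close>. An element \<open>\<Sum> c\<^sub>i g\<^sup>i\<close> of \<open>kG\<close> is thus the function \<open>lam\<close> with \<open>lam i = c\<^sub>i\<close>,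
  and its constant term is \<open>lam 0\<close>. The element \<open>g ^ i\<close> acts on the free algebra by iterating \<open>g_act\<close>;
  this is a group action when \<open>p\<close> is the characteristic of \<open>k\<close>.
\<close>

definition group_alg :: "nat \<Rightarrow> (int \<Rightarrow> 'k::field) ring" where
  "group_alg p = smash_product (integer_mod_group p) (\<lambda>_. id)"

definition free_smash :: "nat \<Rightarrow> (int \<Rightarrow> ('k::field) free_alg) ring" where
  "free_smash p = smash_product (integer_mod_group p) (\<lambda>i. g_act ^^ nat i)"

definition zero_divisor :: "('a, 'm) ring_scheme \<Rightarrow> 'a \<Rightarrow> bool" where
  "zero_divisor R a \<longleftrightarrow>
     (\<exists>b\<in>carrier R. b \<noteq> \<zero>\<^bsub>R\<^esub> \<and> (a \<otimes>\<^bsub>R\<^esub> b = \<zero>\<^bsub>R\<^esub> \<or> b \<otimes>\<^bsub>R\<^esub> a = \<zero>\<^bsub>R\<^esub>))"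

definition xg_ring :: "nat \<Rightarrow> (int \<Rightarrow> ('k::field) poly) ring" where
  "xg_ring p = smash_product (integer_mod_group p) (\<lambda>_. id)"

definition R_x :: "int \<Rightarrow> ('k::field) poly" where
  "R_x = smash_single 0 [:0, 1:]"

definition R_g :: "int \<Rightarrow> ('k::field) poly" where
  "R_g = smash_single 1 1"

definition R_of_group_alg :: "(int \<Rightarrow> 'k) \<Rightarrow> int \<Rightarrow> ('k::field) poly" where
  "R_of_group_alg lam = (\<lambda>i. [:lam i:])"

text \<open>
  With \<open>p\<close> an odd prime equal to the characteristic of \<open>k\<close>, both descriptions below are proper: the
  derivation respects \<open>g ^ p = 1\<close> because \<open>p = 0\<close> in \<open>k\<close>, and it is determined by its values on \<open>x\<close> and
  \<open>g\<close>; it exchanges even and odd degrees in \<open>x\<close>, so \<open>\<delta> ^ p\<close> applied to \<open>g\<close> is a multiple of \<open>\<delta>(g) = x g\<close>,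
  which is not a zero divisor. The condition \<open>\<rightarrow>\<^sub>E\<close> fixes the values outside the carrier.
\<close>

definition k_derivation :: "nat \<Rightarrow> ((int \<Rightarrow> 'k poly) \<Rightarrow> (int \<Rightarrow> ('k::field) poly)) \<Rightarrow> bool" where
  "k_derivation p d \<longleftrightarrow>
     d \<in> carrier (xg_ring p) \<rightarrow>\<^sub>E carrier (xg_ring p) \<and>
     (\<forall>a\<in>carrier (xg_ring p). \<forall>b\<in>carrier (xg_ring p).
        d (a \<oplus>\<^bsub>xg_ring p\<^esub> b) = d a \<oplus>\<^bsub>xg_ring p\<^esub> d b \<and>
        d (a \<otimes>\<^bsub>xg_ring p\<^esub> b) =
          (a \<otimes>\<^bsub>xg_ring p\<^esub> d b) \<oplus>\<^bsub>xg_ring p\<^esub> (d a \<otimes>\<^bsub>xg_ring p\<^esub> b)) \<and>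
     (\<forall>c. d (smash_single 0 [:c:]) = \<zero>\<^bsub>xg_ring p\<^esub>)"

definition delta :: "nat \<Rightarrow> (int \<Rightarrow> 'k) \<Rightarrow> (int \<Rightarrow> 'k poly) \<Rightarrow> (int \<Rightarrow> ('k::field) poly)" where
  "delta p lam = (THE d. k_derivation p d \<and> d R_x = R_of_group_alg lam \<and>
                      d R_g = R_x \<otimes>\<^bsub>xg_ring p\<^esub> R_g)"

definition delta_ratio :: "nat \<Rightarrow> (int \<Rightarrow> 'k) \<Rightarrow> int \<Rightarrow> ('k::field) poly" where
  "delta_ratio p lam = (THE r. r \<in> carrier (xg_ring p) \<and>
                        r \<otimes>\<^bsub>xg_ring p\<^esub> delta p lam R_g = (delta p lam ^^ p) R_g)"

definition S_x :: "int \<Rightarrow> ('k::field) free_alg" where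
  "S_x = smash_single 0 (free_var LX)"

definition S_y :: "int \<Rightarrow> ('k::field) free_alg" where
  "S_y = smash_single 0 (free_var LY)"

definition S_g :: "int \<Rightarrow> ('k::field) free_alg" where
  "S_g = smash_single 1 1"

definition S_const :: "'k \<Rightarrow> int \<Rightarrow> ('k::field) free_alg" where
  "S_const c = smash_single 0 (free_const c)"

text \<open>The natural map from \<open>R\<close>, which evaluates each coefficient \<open>r i \<in> k[x]\<close> at the generator \<open>x\<close>.\<close>

definition S_of_R :: "(int \<Rightarrow> 'k poly) \<Rightarrow> int \<Rightarrow> ('k::field) free_alg" where
  "S_of_R r = (\<lambda>i. \<Sum>j\<le>Polynomial.degree (r i).
                 free_const (Polynomial.coeff (r i) j) * free_var LX ^ j)"

definition H_ideal :: "nat \<Rightarrow> (int \<Rightarrow> 'k) \<Rightarrow> (int \<Rightarrow> ('k::field) free_alg) set" where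
  "H_ideal p lam = Idl\<^bsub>free_smash p\<^esub>
     {(S_x \<otimes>\<^bsub>free_smash p\<^esub> S_y \<ominus>\<^bsub>free_smash p\<^esub> S_y \<otimes>\<^bsub>free_smash p\<^esub> S_x)
        \<ominus>\<^bsub>free_smash p\<^esub> S_of_R (R_of_group_alg lam)}"

definition H_alg :: "nat \<Rightarrow> (int \<Rightarrow> 'k) \<Rightarrow> (int \<Rightarrow> ('k::field) free_alg) set ring" where
  "H_alg p lam = free_smash p Quot H_ideal p lam"

definition H_class ::
  "nat \<Rightarrow> (int \<Rightarrow> 'k) \<Rightarrow> (int \<Rightarrow> 'k free_alg) \<Rightarrow> (int \<Rightarrow> ('k::field) free_alg) set" where
  "H_class p lam s = H_ideal p lam +>\<^bsub>free_smash p\<^esub> s"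

text \<open>
  The predicate \<^const>\<open>Module.submodule\<close> does not require the ring to be commutative, so it
  serves for left modules. The record \<^typ>\<open>('a, 'b) module\<close> extends rings; its fields \<open>mult\<close>
  and \<open>one\<close> play no role in module theory and hold dummy values below, except in
  \<open>left_regular\<close>.
\<close>

definition left_regular :: "('a, 'm) ring_scheme \<Rightarrow> ('a, 'a) module" where
  "left_regular R =
    \<lparr> carrier = carrier R, mult = mult R, one = \<one>\<^bsub>R\<^esub>, zero = \<zero>\<^bsub>R\<^esub>, add = add R, smult = mult R \<rparr>"

definition quotient_module :: "('a, 'b, 'm) module_scheme \<Rightarrow> 'b set \<Rightarrow> ('a, 'b set) module" where
  "quotient_module M N =
    \<lparr> carrier = a_rcosets\<^bsub>M\<^esub> N, mult = (\<lambda>_ _. N), one = N, zero = N, add = set_add M,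
      smult = (\<lambda>a X. \<Union>x\<in>X. N +>\<^bsub>M\<^esub> (a \<odot>\<^bsub>M\<^esub> x)) \<rparr>"

definition generated_submodule ::
  "('a, 'n) ring_scheme \<Rightarrow> ('a, 'b, 'm) module_scheme \<Rightarrow> 'b set \<Rightarrow> 'b set" where
  "generated_submodule R M S = \<Inter>{N. Module.submodule N R M \<and> S \<subseteq> N}"

definition maximal_submodule ::
  "('a, 'n) ring_scheme \<Rightarrow> ('a, 'b, 'm) module_scheme \<Rightarrow> 'b set \<Rightarrow> bool" where
  "maximal_submodule R M N \<longleftrightarrow>
     Module.submodule N R M \<and> N \<noteq> carrier M \<and>
     (\<forall>N'. Module.submodule N' R M \<and> N \<subseteq> N' \<longrightarrow> N' = N \<or> N' = carrier M)"

definition simple_module ::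
  "('a, 'n) ring_scheme \<Rightarrow> ('a, 'b, 'm) module_scheme \<Rightarrow> bool" where
  "simple_module R M \<longleftrightarrow>
     carrier M \<noteq> {\<zero>\<^bsub>M\<^esub>} \<and>
     (\<forall>N. Module.submodule N R M \<longrightarrow> N = {\<zero>\<^bsub>M\<^esub>} \<or> N = carrier M)"

definition restrict_scalars :: "('c \<Rightarrow> 'a) \<Rightarrow> ('a, 'b, 'm) module_scheme \<Rightarrow> ('c, 'b) module" where
  "restrict_scalars \<phi> M =
    \<lparr> carrier = carrier M, mult = mult M, one = \<one>\<^bsub>M\<^esub>, zero = \<zero>\<^bsub>M\<^esub>, add = add M,
      smult = (\<lambda>c x. \<phi> c \<odot>\<^bsub>M\<^esub> x) \<rparr>"

definition H_module_has_dim ::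
  "nat \<Rightarrow> (int \<Rightarrow> 'k) \<Rightarrow> ((int \<Rightarrow> ('k::field) free_alg) set, 'b) module \<Rightarrow> nat \<Rightarrow> bool" where
  "H_module_has_dim p lam M n \<longleftrightarrow>
     (let V = restrict_scalars (\<lambda>c. H_class p lam (S_const c)) M
      in vectorspace.fin_dim class_ring V \<and> vectorspace.dim class_ring V = n)"

definition Delta_ideal ::
  "nat \<Rightarrow> (int \<Rightarrow> 'k) \<Rightarrow> 'k \<Rightarrow> (int \<Rightarrow> ('k::field) free_alg) set set" where
  "Delta_ideal p lam \<alpha> =
     {(a \<otimes>\<^bsub>H_alg p lam\<^esub> H_class p lam (S_x \<ominus>\<^bsub>free_smash p\<^esub> S_const \<alpha>)) \<oplus>\<^bsub>H_alg p lam\<^esub>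
      (b \<otimes>\<^bsub>H_alg p lam\<^esub> H_class p lam (S_g \<ominus>\<^bsub>free_smash p\<^esub> \<one>\<^bsub>free_smash p\<^esub>)) |
      a b. a \<in> carrier (H_alg p lam) \<and> b \<in> carrier (H_alg p lam)}"

definition Delta_module ::
  "nat \<Rightarrow> (int \<Rightarrow> 'k) \<Rightarrow> 'k \<Rightarrow>
   ((int \<Rightarrow> ('k::field) free_alg) set, (int \<Rightarrow> 'k free_alg) set set) module" where
  "Delta_module p lam \<alpha> = quotient_module (left_regular (H_alg p lam)) (Delta_ideal p lam \<alpha>)"

definition Delta_image ::
  "nat \<Rightarrow> (int \<Rightarrow> 'k) \<Rightarrow> 'k \<Rightarrow> (int \<Rightarrow> ('k::field) free_alg) \<Rightarrow>
   (int \<Rightarrow> 'k free_alg) set set" where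
  "Delta_image p lam \<alpha> s =
     Delta_ideal p lam \<alpha> +>\<^bsub>left_regular (H_alg p lam)\<^esub> H_class p lam s"

definition simple_quotients_have_dim ::
  "nat \<Rightarrow> (int \<Rightarrow> 'k) \<Rightarrow> ((int \<Rightarrow> ('k::field) free_alg) set, 'b) module \<Rightarrow> nat \<Rightarrow> bool" where
  "simple_quotients_have_dim p lam M n \<longleftrightarrow>
     (\<forall>N. Module.submodule N (H_alg p lam) M \<and> simple_module (H_alg p lam) (quotient_module M N)
        \<longrightarrow> H_module_has_dim p lam (quotient_module M N) n)"

definition S_Y :: "nat \<Rightarrow> (int \<Rightarrow> 'k) \<Rightarrow> int \<Rightarrow> ('k::field) free_alg" where
  "S_Y p lam = (S_y [^]\<^bsub>free_smash p\<^esub> p)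
     \<ominus>\<^bsub>free_smash p\<^esub> (S_y \<otimes>\<^bsub>free_smash p\<^esub> S_of_R (delta_ratio p lam))"

end

theory Submission
  imports Defs
begin

text \<open>
  Since \<open>H\<close> is the Ore extension of \<open>R = k[x] \<otimes> kG\<close> with \<open>r y = y r + \<delta>(r)\<close>, the module
  \<open>\<Delta>\<^sub>\<alpha>\<close> is \<open>k[y]\<close>, on which \<open>r \<in> R\<close> acts by \<open>r(y q) = y(r q) + \<delta>(r) q\<close> and \<open>r 1 = \<chi>(r)\<close>; here \<open>\<chi>\<close>
  sends \<open>x\<close> to \<open>\<alpha>\<close> and \<open>g\<close> to 1. Its submodules are the ideals \<open>(f)\<close> with \<open>f\<close> singular, which means
  \<open>r f = \<chi>(r) f\<close> for all \<open>r\<close>. Suppose that \<open>Y\<close> is singular of degree \<open>d > 0\<close> and that no nonconstant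
  singular polynomial has smaller degree. Then every \<open>Y - \<beta>\<close> generates a maximal submodule.
  If \<open>k[y]/(f)\<close> is simple and \<open>z\<close> is a root of \<open>f\<close>, the proper submodule \<open>(f, Y - Y(z))\<close> equals \<open>(f)\<close>,
  so \<open>deg f = d\<close>.

  To find \<open>d\<close>, note that in characteristic \<open>p\<close> multiplication by \<open>y^p\<close> and \<open>y^(p^2)\<close> obeys the same rule
  with \<open>\<delta>^p\<close> and \<open>\<delta>^(p^2)\<close> in place of \<open>\<delta>\<close>. The top coefficients of \<open>r f - \<chi>(r) f\<close> show that \<open>p\<close> divides the
  degree of a singular \<open>f\<close> as soon as \<open>\<chi>(\<delta> x)\<close> or \<open>\<chi>(\<delta> g) = \<alpha>\<close> is nonzero, and that \<open>p^2\<close> does if also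
  the determinant \<open>\<chi>(\<delta> g) \<chi>(\<delta>^p x) - \<chi>(\<delta> x) \<chi>(\<delta>^p g)\<close> is nonzero. That determinant
  is \<open>- \<alpha>^p\<close>: the element \<open>T = x \<delta>^p(x) - \<lambda> \<delta>^p(g) g^(-1)\<close> is killed by \<open>\<delta>\<close>, and
  the constant term 1 of \<open>\<lambda>\<close> forces \<open>T = - x^p\<close>.
\<close>

section \<open>The action on polynomials\<close>

text \<open>No normal form theorem for \<open>H\<close> is used. The operators on k[y] define an
  action of the free smash product in which the relator acts as 0 and x - \<alpha> and g - 1 kill 1;
  hence \<Delta> is at least as large as k[y]. That the powers of y span it is an induction on the
  degree. The computations take place in k[g][x], a domain in which g can be cancelled, and are
  carried over to R to identify \<delta>. For \<alpha> = 0 the value \<chi>(\<delta> g) is 0 and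
  \<chi>(\<delta> x) is the augmentation of \<lambda>. Since (1 - g)^p = 0, the augmentation
  vanishes when \<lambda> is a zero divisor; then y itself is singular and d = 1. For a unit it is
  nonzero, so p divides the degrees, and the image of Y is singular of degree p. For \<alpha>
  \<noteq> 0 the nonzero determinant makes the pairs of values of \<chi> \<delta> and \<chi>
  \<delta>^p at x and g a basis of k^2. Expanding the pair of \<chi> \<delta>^(p^2) in this basis
  yields a singular combination of y^(p^2), y^p and y.\<close>

text \<open>The Euler operator g d/dg, which multiplies g^i by i. On k[g] the derivation \<delta> is
  x times this operator.\<close>

definition theta :: "'k::field poly \<Rightarrow> 'k poly" where
  "theta c = pCons 0 (pderiv c)"

lemma theta_0 [simp]: "theta 0 = 0"
  and theta_add: "theta (c + d) = theta c + theta d"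
  and theta_mult: "theta (c * d) = c * theta d + theta c * d"
  by (simp_all add: theta_def pderiv_add pderiv_mult)

lemma coeff_theta: "coeff (theta c) i = of_nat i * coeff c i"
  by (cases i) (simp_all add: theta_def coeff_pderiv)

lemma theta_const [simp]: "theta [:c:] = 0"
  by (simp add: theta_def)

lemma map_poly_theta_add: "map_poly theta (f + h) = map_poly theta f + map_poly theta h"
  by (rule poly_eqI) (simp add: coeff_map_poly theta_add)

lemma map_poly_theta_smult:
  "map_poly theta (Polynomial.smult c f) = Polynomial.smult (theta c) f + Polynomial.smult c (map_poly theta f)"
  by (rule poly_eqI) (simp add: coeff_map_poly theta_mult)

lemma map_poly_theta_mult:
  "map_poly theta (f * h) = f * map_poly theta h + map_poly theta f * h"
  by (induction f)
     (simp_all add: map_poly_theta_add map_poly_theta_smult map_poly_pCons algebra_simps)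

section \<open>Ideals of k[y] and binomial coefficients modulo p\<close>

lemma ideal_principal:
  fixes I :: "'k::field poly set"
  assumes "0 \<in> I" and add: "\<And>q r. q \<in> I \<Longrightarrow> r \<in> I \<Longrightarrow> q + r \<in> I"
    and mult: "\<And>q h. q \<in> I \<Longrightarrow> h * q \<in> I"
  obtains f where "I = {q. f dvd q}"
proof (cases "I = {0}")
  case True
  then show thesis using that[of 0] by auto
next
  case False
  with \<open>0 \<in> I\<close> have "\<exists>q. q \<in> I \<and> q \<noteq> 0" by auto
  then obtain f where f: "f \<in> I" "f \<noteq> 0" and min: "\<And>q. q \<in> I \<Longrightarrow> q \<noteq> 0 \<Longrightarrow> degree f \<le> degree q"
    using ex_has_least_nat[of "\<lambda>q. q \<in> I \<and> q \<noteq> 0" _ degree] by metis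
  have "f dvd q" if "q \<in> I" for q
  proof -
    have "q mod f = q + (- (q div f)) * f"
      using minus_div_mult_eq_mod[of q f] by (simp add: algebra_simps)
    then have "q mod f \<in> I" using that f add mult by metis
    then have "q mod f = 0"
      using min[of "q mod f"] degree_mod_less[OF f(2), of q] by linarith
    then show ?thesis by (simp add: dvd_eq_mod_eq_0)
  qed
  moreover have "q \<in> I" if "f dvd q" for q
    using that mult[OF f(1)] by (metis dvdE mult.commute)
  ultimately have "I = {q. f dvd q}" by blast
  then show thesis by (rule that)
qed

lemma dvd_choose_if_dvd:
  fixes p n i :: nat
  assumes "prime p" "p dvd n" "0 < i" "i < p"
  shows "p dvd (n choose i)"
proof -
  have "i * (n choose i) = n * ((n - 1) choose (i - 1))"
    using assms(3) by (rule times_binomial_minus1_eq)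
  then have "p dvd i * (n choose i)" using assms(2) by simp
  moreover have "\<not> p dvd i" using assms by (auto dest: dvd_imp_le)
  ultimately show ?thesis using assms(1) prime_dvd_mult_iff by blast
qed

text \<open>By Lucas the binomial coefficient is n/p modulo p. Concretely, for n = p m it equals m
  times (n-1 choose p-1), and (p-1)! times the latter is the product of the integers strictly
  between p(m-1) and p m, none of which p divides.\<close>

lemma not_dvd_choose_prime:
  fixes p n :: nat
  assumes "prime p" "p dvd n" "\<not> p\<^sup>2 dvd n"
  shows "\<not> p dvd (n choose p)"
proof
  assume A: "p dvd (n choose p)"
  obtain m where m: "n = p * m" using assms(2) by auto
  have pm: "\<not> p dvd m" using assms(3) m by (auto simp: power2_eq_square)
  have p0: "p > 1" using assms(1) prime_gt_1_nat by blast
  have m0: "m > 0" using pm by (cases m) auto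
  have "p * (n choose p) = n * ((n - 1) choose (p - 1))"
    using p0 by (intro times_binomial_minus1_eq) simp
  then have "n choose p = m * ((n - 1) choose (p - 1))" using m p0 by (simp add: mult.assoc)
  then have "p dvd ((n - 1) choose (p - 1))" using A pm assms(1) prime_dvd_mult_iff by metis
  moreover have "fact (p - 1) * ((n - 1) choose (p - 1)) * fact (n - p) = (fact (n - 1) :: nat)"
  proof -
    have "p \<le> n" using m m0 by simp
    then have "p - 1 \<le> n - 1" "n - 1 - (p - 1) = n - p" using p0 by auto
    then show ?thesis
      using binomial_fact_lemma[of "p - 1" "n - 1"] by (simp only: mult_ac)
  qed
  moreover have "fact (n - 1) = (\<Prod>{n - p + 1..n - 1}) * (fact (n - p) :: nat)"
  proof -
    have "{1..n - 1} = {1..n - p} \<union> {n - p + 1..n - 1}" using p0 m m0 by auto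
    moreover have "{1..n - p} \<inter> {n - p + 1..n - 1} = {}" by auto
    ultimately show ?thesis
      by (simp add: fact_prod prod.union_disjoint mult.commute)
  qed
  ultimately have "fact (p - 1) * ((n - 1) choose (p - 1)) * fact (n - p)
      = (\<Prod>{n - p + 1..n - 1}) * (fact (n - p) :: nat)" by simp
  then have "fact (p - 1) * ((n - 1) choose (p - 1)) = \<Prod>{n - p + 1..n - 1}" by simp
  with \<open>p dvd ((n - 1) choose (p - 1))\<close> have "p dvd (\<Prod>{n - p + 1..n - 1})"
    by (metis dvd_mult)
  then obtain j where j: "j \<in> {n - p + 1..n - 1}" "p dvd j"
    using assms(1) prime_dvd_prod_iff[of "{n - p + 1..n - 1}" p "\<lambda>x. x"] by auto
  obtain l where l: "j = p * l" using j(2) by auto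
  have "n - p = p * (m - 1)" using m by (simp add: diff_mult_distrib2)
  then have "p * (m - 1) < p * l" using j(1) l by (simp only: atLeastAtMost_iff) linarith
  moreover have "n > 0" using m m0 p0 by simp
  then have "p * l < p * m" using j(1) l m by (simp only: atLeastAtMost_iff) linarith
  ultimately have "m - 1 < l" "l < m" by simp_all
  then show False by simp
qed

text \<open>Pascal's rule for an arbitrary family t, shared by the expansion of \<open>act\<close>
  on powers and the Leibniz formula for powers of \<open>D\<close>.\<close>

lemma pascal_sum:
  fixes t :: "nat \<Rightarrow> nat \<Rightarrow> 'a::comm_semiring_1"
  shows "(\<Sum>i\<le>n. of_nat (n choose i) * t i (Suc n - i)) + (\<Sum>i\<le>n. of_nat (n choose i) * t (Suc i) (n - i))
    = (\<Sum>i\<le>Suc n. of_nat (Suc n choose i) * t i (Suc n - i))"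
proof -
  have "(\<Sum>i\<le>n. of_nat (n choose i) * t i (Suc n - i)) = (\<Sum>i\<le>Suc n. of_nat (n choose i) * t i (Suc n - i))"
    by (simp add: binomial_eq_0)
  also have "\<dots> = t 0 (Suc n) + (\<Sum>i\<le>n. of_nat (n choose Suc i) * t (Suc i) (n - i))"
    by (subst sum.atMost_Suc_shift) simp
  finally show ?thesis
    by (subst sum.atMost_Suc_shift) (simp add: distrib_right sum.distrib add_ac)
qed

text \<open>
  A polynomial in \<open>x\<close> (outer variable) over \<open>k[g]\<close> stands for an element of \<open>R\<close>; \<open>L\<close> is \<open>\<lambda>\<close>. The
  relation \<open>g^p = 1\<close> is not imposed, but \<open>D\<close> kills \<open>g^p\<close> in characteristic \<open>p\<close>, so \<open>g^p\<close> acts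
  trivially on \<open>k[y]\<close>.
\<close>

locale poly_action =
  fixes L :: "'k::field poly" and \<alpha> :: 'k
begin

text \<open>The derivation L d/dx + x g d/dg of k[g][x]; \<open>pCons 0\<close> is multiplication by
  x.\<close>

definition D :: "'k poly poly \<Rightarrow> 'k poly poly" where
  "D f = Polynomial.smult L (pderiv f) + pCons 0 (map_poly theta f)"

definition chi :: "'k poly poly \<Rightarrow> 'k" where
  "chi f = poly (poly f [:\<alpha>:]) 1"

abbreviation xx :: "'k poly poly" where "xx \<equiv> [:0, 1:]"
abbreviation gg :: "'k poly poly" where "gg \<equiv> [:[:0, 1:]:]"
abbreviation yy :: "'k poly" where "yy \<equiv> [:0, 1:]"

lemma D_add: "D (f + h) = D f + D h"
  by (simp add: D_def pderiv_add smult_add_right map_poly_theta_add)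

lemma D_0 [simp]: "D 0 = 0"
  by (simp add: D_def)

lemma D_mult: "D (f * h) = f * D h + D f * h"
  by (simp add: D_def pderiv_mult map_poly_theta_mult smult_add_right algebra_simps)

lemma D_coeff_const: "D [:c:] = [:0, theta c:]"
  by (simp add: D_def map_poly_pCons)

lemma D_const [simp]: "D [:[:c:]:] = 0"
  by (simp add: D_coeff_const)

lemma D_one [simp]: "D 1 = 0"
  using D_const[of 1] by (simp add: one_pCons)

lemma D_xx: "D xx = [:L:]"
  by (simp add: D_def map_poly_pCons pderiv_pCons theta_def one_pCons)

lemma D_gg: "D gg = xx * gg"
  by (simp add: D_def theta_def map_poly_pCons pderiv_pCons)

lemma coeff_D:
  "coeff (D f) m = of_nat (Suc m) * (L * coeff f (Suc m)) + (if m = 0 then 0 else theta (coeff f (m - 1)))"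
  by (cases m) (simp_all add: D_def coeff_pderiv coeff_map_poly algebra_simps)

lemma chi_simps [simp]:
  "chi 0 = 0" "chi 1 = 1" "chi (f + h) = chi f + chi h" "chi (f - h) = chi f - chi h"
  "chi (f * h) = chi f * chi h"
  "chi [:[:c:]:] = c" "chi xx = \<alpha>" "chi gg = 1" "chi [:d:] = poly d 1"
  by (simp_all add: chi_def)

text \<open>Horner recursion on q = c + y h. The fold produces a function of r because the value at
  r involves both r and \<open>D r\<close> acting on h.\<close>

definition act :: "'k poly poly \<Rightarrow> 'k poly \<Rightarrow> 'k poly" where
  "act r q = fold_coeffs (\<lambda>c h r. [:chi r * c:] + pCons 0 (h r) + h (D r)) q (\<lambda>_. 0) r"

lemma act_0 [simp]: "act r 0 = 0"
  by (simp add: act_def)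

lemma act_pCons: "act r (pCons c q) = [:chi r * c:] + pCons 0 (act r q) + act (D r) q"
proof (cases "q = 0")
  case True
  then show ?thesis by (cases "c = 0") (simp_all add: act_def)
next
  case False
  then show ?thesis by (simp add: act_def)
qed

lemma act_add_left: "act (r + s) q = act r q + act s q"
  by (induction q arbitrary: r s) (simp_all add: act_pCons D_add algebra_simps)

lemma act_add_right: "act r (q + q') = act r q + act r q'"
  by (induction q q' arbitrary: r rule: poly_induct2) (simp_all add: act_pCons algebra_simps)

lemma act_smult: "act r (Polynomial.smult c q) = Polynomial.smult c (act r q)"
  by (induction q arbitrary: r) (simp_all add: act_pCons smult_add_right algebra_simps)

lemma act_minus: "act r (- q) = - act r q"
  using act_smult[of r "-1" q] by simp

lemma act_diff: "act r (q - q') = act r q - act r q'"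
  using act_add_right[of r q "- q'"] by (simp add: act_minus)

lemma act_0_left [simp]: "act 0 q = 0"
  by (induction q) (simp_all add: act_pCons)

lemma act_const_left [simp]: "act [:[:c:]:] q = Polynomial.smult c q"
  by (induction q) (simp_all add: act_pCons)

lemma act_1_left [simp]: "act 1 q = q"
  using act_const_left[of 1 q] by (simp add: one_pCons)

text \<open>The Leibniz rule for \<open>D\<close> and the multiplicativity of \<open>chi\<close>
  turn the recursion into a module structure.\<close>

lemma act_mult: "act (r * s) q = act r (act s q)"
  by (induction q arbitrary: r s)
     (simp_all add: act_pCons act_add_right act_add_left D_mult add_ac mult.assoc)

lemma act_sum_left: "act (sum f A) q = (\<Sum>i\<in>A. act (f i) q)"
  by (induction A rule: infinite_finite_induct) (simp_all add: act_add_left)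

lemma act_sum_right: "act r (sum f A) = (\<Sum>i\<in>A. act r (f i))"
  by (induction A rule: infinite_finite_induct) (simp_all add: act_add_right)

lemma act_power: "act (r ^ n) q = (act r ^^ n) q"
  by (induction n) (simp_all add: act_mult)

lemma act_const: "act r [:c:] = [:chi r * c:]"
  by (simp add: act_pCons)

lemma act_1_right [simp]: "act r 1 = [:chi r:]"
  using act_const[of r 1] by (simp add: one_pCons)

lemma act_yy: "act r (yy * q) = yy * act r q + act (D r) q"
  by (simp add: act_pCons)

text \<open>Stated for any multiplier z and operator E obeying the commutation rule, so that it
  serves y with \<open>D\<close> as well as y^p with the p-th power of \<open>D\<close>.\<close>

lemma act_binomial:
  assumes Z: "\<And>r q. act r (z * q) = z * act r q + act (E r) q"
  shows "act r (z ^ n * q) = (\<Sum>i\<le>n. of_nat (n choose i) * z ^ (n - i) * act ((E ^^ i) r) q)"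
proof (induction n arbitrary: r)
  case (Suc n)
  define t where "t i m = z ^ m * act ((E ^^ i) r) q" for i m
  have 1: "act r (z ^ n * q) = (\<Sum>i\<le>n. of_nat (n choose i) * t i (n - i))"
    unfolding t_def by (simp add: Suc mult.assoc)
  have 2: "act (E r) (z ^ n * q) = (\<Sum>i\<le>n. of_nat (n choose i) * t (Suc i) (n - i))"
    unfolding t_def by (simp add: Suc mult.assoc funpow_Suc_right del: funpow.simps)
  have z: "z * (of_nat m * t i j) = of_nat m * t i (Suc j)" for i j m
    by (simp add: t_def algebra_simps)
  have "act r (z ^ Suc n * q) = z * act r (z ^ n * q) + act (E r) (z ^ n * q)"
    using Z[of r "z ^ n * q"] by (simp add: mult.assoc)
  also have "\<dots> = (\<Sum>i\<le>n. of_nat (n choose i) * t i (Suc n - i))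
      + (\<Sum>i\<le>n. of_nat (n choose i) * t (Suc i) (n - i))"
    unfolding 1 2 by (simp add: sum_distrib_left z Suc_diff_le)
  also note pascal_sum
  finally show ?case by (simp add: t_def mult.assoc)
qed simp

text \<open>Expand r y^n into the terms (n choose i) y^(n-i) \<delta>^i(r) and let them act on 1,
  where \<open>act\<close> reduces to \<open>chi\<close>. Thus \<open>act r\<close> is triangular
  with \<open>chi r\<close> on the diagonal.\<close>

lemma coeff_act:
  assumes "degree f \<le> N"
  shows "coeff (act r f) m = (\<Sum>n\<in>{m..N}. of_nat (n choose m) * chi ((D ^^ (n - m)) r) * coeff f n)"
proof -
  have mon: "act r (monom 1 n) = (\<Sum>i\<le>n. monom (of_nat (n choose i) * chi ((D ^^ i) r)) (n - i))" for n
  proof -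
    show ?thesis
      using act_binomial[OF act_yy, of r n 1]
      by (simp add: monom_altdef of_nat_poly mult.commute)
  qed
  have "f = (\<Sum>n\<le>N. Polynomial.smult (coeff f n) (monom 1 n))"
    using poly_as_sum_of_monoms'[OF assms] by (simp add: smult_monom)
  then have "act r f = (\<Sum>n\<le>N. Polynomial.smult (coeff f n) (act r (monom 1 n)))"
    by (metis (mono_tags, lifting) act_smult act_sum_right sum.cong)
  then have "coeff (act r f) m = (\<Sum>n\<le>N. coeff f n * coeff (act r (monom 1 n)) m)"
    by (simp add: coeff_sum)
  also have "\<dots> = (\<Sum>n\<le>N. if n \<in> {m..N} then of_nat (n choose m) * chi ((D ^^ (n - m)) r) * coeff f n else 0)"
  proof (rule sum.cong[OF refl])
    fix n assume "n \<in> {..N}"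
    have "coeff (act r (monom 1 n)) m
        = (\<Sum>i\<le>n. if n - i = m then of_nat (n choose i) * chi ((D ^^ i) r) else 0)"
      by (simp add: mon coeff_sum)
    also have "\<dots> = (\<Sum>i\<le>n. if i = n - m \<and> m \<le> n then of_nat (n choose (n - m)) * chi ((D ^^ (n - m)) r) else 0)"
      by (rule sum.cong) auto
    also have "\<dots> = (if m \<le> n then of_nat (n choose m) * chi ((D ^^ (n - m)) r) else 0)"
      by (auto simp: binomial_symmetric[symmetric])
    finally show "coeff f n * coeff (act r (monom 1 n)) m =
        (if n \<in> {m..N} then of_nat (n choose m) * chi ((D ^^ (n - m)) r) * coeff f n else 0)"
      using \<open>n \<in> {..N}\<close> by simp
  qed
  also have "\<dots> = (\<Sum>n\<in>{m..N}. of_nat (n choose m) * chi ((D ^^ (n - m)) r) * coeff f n)"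
    by (subst sum.inter_restrict[symmetric]) (auto intro: sum.cong)
  finally show ?thesis .
qed

lemma degree_act_le: "degree (act r f) \<le> degree f"
  by (rule degree_le) (simp add: coeff_act[OF order_refl])

definition sing :: "'k poly \<Rightarrow> bool" where
  "sing f \<longleftrightarrow> (\<forall>r. act r f = Polynomial.smult (chi r) f)"

text \<open>The r that act on f by \<open>chi r\<close> form a subalgebra, and x and g generate
  k[g][x].\<close>

lemma singI:
  assumes x: "act xx f = Polynomial.smult \<alpha> f" and g: "act gg f = f"
  shows "sing f"
proof -
  define Q where "Q r \<longleftrightarrow> act r f = Polynomial.smult (chi r) f" for r
  have add: "Q (r + s)" if "Q r" "Q s" for r s
    using that by (simp add: Q_def act_add_left smult_add_left)
  have mult: "Q (r * s)" if "Q r" "Q s" for r s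
    using that by (simp add: Q_def act_mult act_smult mult.commute)
  have c: "Q [:[:c:]:]" for c by (simp add: Q_def)
  have inner: "Q [:d:]" for d
  proof (induction d)
    case (pCons c d)
    have "[:pCons c d:] = [:[:c:]:] + gg * [:d:]" by simp
    then show ?case using add mult c pCons g by (metis Q_def chi_simps(8) smult_1_left)
  qed (simp add: Q_def)
  have "Q r" for r
  proof (induction r)
    case (pCons d r)
    have "pCons d r = [:d:] + xx * r" by simp
    then show ?case using add mult inner pCons x by (metis Q_def chi_simps(7))
  qed (simp add: Q_def)
  then show ?thesis by (simp add: sing_def Q_def)
qed

text \<open>R acts on a singular f as it acts on 1, so multiplication by f commutes with the
  action.\<close>

lemma sing_mult: "sing f \<Longrightarrow> act r (h * f) = act r h * f"
proof (induction h arbitrary: r)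
  case (pCons c h)
  have "act r (pCons c h * f) = act r (Polynomial.smult c f + yy * (h * f))" by simp
  also have "\<dots> = Polynomial.smult c (act r f) + yy * act r (h * f) + act (D r) (h * f)"
    unfolding act_add_right act_yy act_smult by simp
  also have "\<dots> = act r (pCons c h) * f"
    using pCons by (simp add: act_pCons sing_def algebra_simps)
  finally show ?case .
qed simp

lemma sing_diff_const: "sing f \<Longrightarrow> sing (f - [:c:])"
  by (simp add: sing_def act_diff act_const smult_diff_right)

text \<open>By triangularity \<open>act r f\<close> and \<open>chi r\<close> times f agree in the
  top coefficient. Their difference is a multiple of f of smaller degree, hence 0.\<close>

lemma sing_generator:
  assumes "f dvd act xx f" "f dvd act gg f"
  shows "sing f"
proof (cases "f = 0")
  case False
  have "act r f = Polynomial.smult (chi r) f" if "f dvd act r f" for r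
  proof (rule ccontr)
    assume "act r f \<noteq> Polynomial.smult (chi r) f"
    then have nz: "act r f - Polynomial.smult (chi r) f \<noteq> 0" by simp
    have "coeff (act r f - Polynomial.smult (chi r) f) i = 0" if "degree f \<le> i" for i
      using that by (cases "i = degree f") (auto simp: coeff_act[OF order_refl] coeff_eq_0)
    then have "degree (act r f - Polynomial.smult (chi r) f) < degree f"
      using nz leading_coeff_0_iff not_le by blast
    moreover have "f dvd act r f - Polynomial.smult (chi r) f" using that by (simp add: dvd_smult)
    ultimately show False using nz dvd_imp_degree_le leD by blast
  qed
  then show ?thesis using assms by (metis singI chi_simps(7,8) smult_1_left)
qed (simp add: sing_def)

text \<open>Compare the coefficients of y^m in the equation for a singular f; the diagonal term n =
  m cancels. All restrictions on degrees come from these relations.\<close>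

lemma sing_coeff:
  assumes "sing f" "degree f \<le> N"
  shows "(\<Sum>n\<in>{m<..N}. of_nat (n choose m) * chi ((D ^^ (n - m)) r) * coeff f n) = 0"
proof (cases "m \<le> N")
  case True
  have "coeff (act r f) m = chi r * coeff f m" using assms(1) by (simp add: sing_def)
  moreover have "{m..N} = insert m {m<..N}" using True by auto
  ultimately show ?thesis using coeff_act[OF assms(2), of r m] by simp
qed simp

end

section \<open>Singular polynomials in characteristic p\<close>

lemma of_nat_poly_eq_0_iff: "of_nat n = (0 :: 'a::comm_semiring_1 poly) \<longleftrightarrow> of_nat n = (0 :: 'a)"
  by (simp add: of_nat_poly)

text \<open>Cramer's rule with denominators cleared: t is the determinant of the rows (ap, bp) and
  (a1, b1), and c, d are the coefficients with which these rows cancel (a2, b2).\<close>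

lemma cramer_zero:
  fixes t :: "'a::comm_ring_1"
  assumes c: "t * c = a1 * b2 - b1 * a2" and d: "t * d = bp * a2 - ap * b2" and t: "t = b1 * ap - a1 * bp"
  shows "t * (a2 + c * ap + d * a1) = 0" "t * (b2 + c * bp + d * b1) = 0"
proof -
  have "t * (a2 + c * ap + d * a1) = t * a2 + (t * c) * ap + (t * d) * a1"
    by (simp add: algebra_simps)
  then show "t * (a2 + c * ap + d * a1) = 0" unfolding c d by (simp add: t algebra_simps)
  have "t * (b2 + c * bp + d * b1) = t * b2 + (t * c) * bp + (t * d) * b1"
    by (simp add: algebra_simps)
  then show "t * (b2 + c * bp + d * b1) = 0" unfolding c d by (simp add: t algebra_simps)
qed

text \<open>\<open>L\<close> is the representative of \<lambda> with exponents below p. The only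
  exponent divisible by p that occurs in it is 0, with coefficient 1; \<open>T_eq\<close> rests on
  this.\<close>

locale poly_action_char = poly_action L \<alpha> for L :: "'k::field poly" and \<alpha> :: 'k +
  fixes p :: nat
  assumes prime_p: "prime p" and odd_p: "odd p" and char_p: "CHAR('k) = p"
    and L_0: "coeff L 0 = 1" and L_deg: "degree L < p"
begin

lemma of_nat_eq_0_iff: "of_nat n = (0 :: 'k) \<longleftrightarrow> p dvd n"
  using of_nat_eq_0_iff_char_dvd[where ?'a = 'k] char_p by simp

lemma p_gt_2: "p > 2"
  using prime_p odd_p prime_gt_1_nat[of p] by (cases "p = 2") auto

text \<open>Modulo p only the terms i = 0 and i = p of the binomial expansion survive. The
  conclusion has the shape of the hypothesis, so the step can be iterated to reach y^(p^2).\<close>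

lemma act_frobenius:
  assumes "\<And>r q. act r (z * q) = z * act r q + act (E r) q"
  shows "act r (z ^ p * q) = z ^ p * act r q + act ((E ^^ p) r) q"
proof -
  have z: "of_nat (p choose i) = (0 :: 'k poly)" if "i \<noteq> 0" "i \<noteq> p" "i \<le> p" for i
    using dvd_choose_if_dvd[OF prime_p dvd_refl, of i] that
    by (simp add: of_nat_poly_eq_0_iff of_nat_eq_0_iff)
  have "act r (z ^ p * q) = (\<Sum>i\<le>p. of_nat (p choose i) * z ^ (p - i) * act ((E ^^ i) r) q)"
    by (rule act_binomial[OF assms])
  also have "\<dots> = (\<Sum>i\<in>{0, p}. of_nat (p choose i) * z ^ (p - i) * act ((E ^^ i) r) q)"
    by (rule sum.mono_neutral_right) (use z in auto)
  also have "\<dots> = z ^ p * act r q + act ((E ^^ p) r) q"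
    using p_gt_2 by simp
  finally show ?thesis .
qed

lemma act_yy_p: "act r (yy ^ p * q) = yy ^ p * act r q + act ((D ^^ p) r) q"
  by (rule act_frobenius) (rule act_yy)

lemma act_yy_p2: "act r (yy ^ (p * p) * q) = yy ^ (p * p) * act r q + act ((D ^^ (p * p)) r) q"
  using act_frobenius[of "yy ^ p" "D ^^ p", OF act_yy_p] by (simp add: power_mult funpow_mult)

text \<open>In the Leibniz formula the inner binomial coefficients vanish modulo p, so the p-th
  power of a derivation is again one.\<close>

lemma D_p_mult: "(D ^^ p) (f * h) = f * (D ^^ p) h + (D ^^ p) f * h"
proof -
  have "(D ^^ n) (f * h) = (\<Sum>i\<le>n. of_nat (n choose i) * ((D ^^ (n - i)) f * (D ^^ i) h))" for n
  proof (induction n)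
    case (Suc n)
    define t where "t i j = (D ^^ j) f * (D ^^ i) h" for i j
    have D_sum: "D (sum u A) = (\<Sum>i\<in>A. D (u i))" for u and A :: "nat set"
      by (induction A rule: infinite_finite_induct) (simp_all add: D_add)
    have D_nat: "D (of_nat m * u) = of_nat m * D u" for m u
      by (induction m) (simp_all add: D_add algebra_simps)
    have D_t: "D (t i j) = t (Suc i) j + t i (Suc j)" for i j
      by (simp add: t_def D_mult)
    have "(D ^^ Suc n) (f * h) = (\<Sum>i\<le>n. of_nat (n choose i) * t i (Suc n - i))
        + (\<Sum>i\<le>n. of_nat (n choose i) * t (Suc i) (n - i))"
      by (simp add: Suc D_sum D_nat D_t flip: t_def) (simp add: sum.distrib algebra_simps Suc_diff_le)
    also note pascal_sum
    finally show ?case by (simp add: t_def)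
  qed simp
  note this[of p]
  moreover have "of_nat (p choose i) = (0 :: 'k poly poly)" if "i \<noteq> 0" "i \<noteq> p" "i \<le> p" for i
    using dvd_choose_if_dvd[OF prime_p dvd_refl, of i] that
    by (simp add: of_nat_poly_eq_0_iff of_nat_eq_0_iff)
  then have "(\<Sum>i\<le>p. of_nat (p choose i) * ((D ^^ (p - i)) f * (D ^^ i) h))
      = (\<Sum>i\<in>{0, p}. of_nat (p choose i) * ((D ^^ (p - i)) f * (D ^^ i) h))"
    by (intro sum.mono_neutral_right) auto
  ultimately show ?thesis using p_gt_2 by (simp add: add.commute)
qed

lemma D_funpow_add: "(D ^^ n) (f + h) = (D ^^ n) f + (D ^^ n) h"
  by (induction n) (simp_all add: D_add)

lemma D_pow_0 [simp]: "(D ^^ n) 0 = 0"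
  by (induction n) simp_all

lemma D_p_const [simp]: "(D ^^ p) [:[:c:]:] = 0"
  using p_gt_2 by (cases p) (simp_all add: funpow_Suc_right del: funpow.simps)

section \<open>The determinant of \<delta> and \<delta>^p\<close>

text \<open>The factor in \<delta>^n(g) = P_n g, found by recursion since g has no inverse in
  k[g][x]. Dividing \<open>P p\<close> by x gives the ratio that occurs in Y.\<close>

primrec P :: "nat \<Rightarrow> 'k poly poly" where
  "P 0 = 1"
| "P (Suc n) = D (P n) + xx * P n"

lemma D_pow_gg: "(D ^^ n) gg = P n * gg"
proof (induction n)
  case (Suc n)
  have "(D ^^ Suc n) gg = P n * (xx * gg) + D (P n) * gg"
    by (simp only: funpow.simps o_apply Suc D_mult D_gg)
  also have "\<dots> = P (Suc n) * gg"
    by (simp only: P.simps algebra_simps)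
  finally show ?case .
qed (simp only: P.simps funpow.simps id_apply mult_1)

text \<open>Evaluate \<delta>^(p+1)(g) both as \<delta>(P_p g) and as \<delta>^p(x g), where
  \<delta>^p is a derivation, and cancel g.\<close>

lemma D_P: "D (P p) = (D ^^ p) xx"
proof -
  have "D (P p) * gg + P p * (xx * gg) = D (P p * gg)"
    by (simp only: D_mult D_gg) (simp only: add.commute)
  also have "\<dots> = D ((D ^^ p) gg)" by (simp add: D_pow_gg)
  also have "\<dots> = (D ^^ p) (xx * gg)" by (simp add: funpow_swap1 D_gg)
  also have "\<dots> = xx * (P p * gg) + (D ^^ p) xx * gg"
    by (simp only: D_p_mult D_pow_gg)
  finally have "D (P p) * gg = (D ^^ p) xx * gg" by (simp only: mult_ac) simp
  moreover have "gg \<noteq> 0" by simp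
  ultimately show ?thesis using mult_cancel_right by blast
qed

text \<open>On k[g] the derivation \<delta>^p is determined by its value P_p g at g, so it is P_p
  times the Euler operator.\<close>

lemma D_p_coeff_const: "(D ^^ p) [:c:] = [:theta c:] * P p"
proof (induction c)
  case (pCons a c)
  have "[:pCons a c:] = [:[:a:]:] + gg * [:c:]" by simp
  then have "(D ^^ p) [:pCons a c:] = gg * ([:theta c:] * P p) + P p * gg * [:c:]"
    by (simp only: D_funpow_add D_p_const D_p_mult pCons D_pow_gg) simp
  also have "\<dots> = [:theta (pCons a c):] * P p"
    by (simp add: theta_def pderiv_pCons add.commute flip: smult_add_left)
  finally show ?case .
qed simp

text \<open>T g is the determinant \<delta>(g) \<delta>^p(x) - \<delta>(x) \<delta>^p(g) before
  \<open>chi\<close> is applied.\<close>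

definition T :: "'k poly poly" where
  "T = (D ^^ p) xx * xx - [:L:] * P p"

text \<open>The terms with L \<delta>^p(x) cancel because \<delta>(P_p) = \<delta>^p(x). The terms
  with \<open>theta L\<close> cancel because \<delta> of \<delta>^p(x) is \<delta>^p(L).\<close>

lemma D_T: "D T = 0"
proof -
  have D_diff: "D (f - h) = D f - D h" for f h
    using D_add[of "f - h" h] by (simp add: algebra_simps)
  have DL: "D [:L:] = [:theta L:] * xx" by (simp add: D_coeff_const)
  have "D ((D ^^ p) xx) = (D ^^ p) [:L:]" by (simp add: funpow_swap1 D_xx)
  then have 1: "D ((D ^^ p) xx) = [:theta L:] * P p" by (simp only: D_p_coeff_const)
  show ?thesis
    unfolding T_def D_diff D_mult 1 DL D_P D_xx by (simp only: algebra_simps) simp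
qed

text \<open>Both \<open>D\<close> and multiplication by x reverse the parity of the x-degree and
  raise that degree by at most 1.\<close>

lemma coeff_P_eq_0: "(odd (m + n) \<longrightarrow> coeff (P n) m = 0) \<and> (n < m \<longrightarrow> coeff (P n) m = 0)"
proof (induction n arbitrary: m)
  case (Suc n)
  have "coeff (P n) (Suc m) = 0" if "odd (m + Suc n) \<or> Suc n < m"
    using Suc[of "Suc m"] that by auto
  moreover have "coeff (P n) (m - 1) = 0" if "odd (m + Suc n) \<or> Suc n < m" "m > 0"
    using Suc[of "m - 1"] that by (cases m) auto
  ultimately show ?case by (auto simp: coeff_D coeff_pCons split: nat.splits)
qed (auto simp: coeff_1 odd_pos)

lemma coeff_P_top: "coeff (P n) n = 1"
  by (induction n) (simp_all add: coeff_D coeff_P_eq_0 one_pCons)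

lemma coeff_P_0: "coeff (P p) 0 = 0"
  using coeff_P_eq_0[of 0 p] odd_p by simp

text \<open>Only the part x g d/dg of \<open>D\<close> raises the x-degree, so it alone determines
  the top coefficient.\<close>

lemma coeff_D_xx: "m \<ge> n \<Longrightarrow> coeff ((D ^^ Suc n) xx) m = (if m = n then (theta ^^ n) L else 0)"
proof (induction n arbitrary: m)
  case (Suc n)
  show ?case
    unfolding funpow.simps(2)[of "Suc n"] o_apply coeff_D[of "(D ^^ Suc n) xx"]
    using Suc by auto
qed (auto simp: D_xx coeff_pCons split: nat.splits)

lemma coeff_theta_pow: "coeff ((theta ^^ n) c) i = of_nat i ^ n * coeff c i"
  by (induction n) (simp_all add: coeff_theta)

text \<open>Fermat's little theorem: i^(p-1) is 1 in k for 0 < i < p, while the constant term of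
  \<open>L\<close>, which is 1, is killed.\<close>

lemma theta_pow_L: "(theta ^^ (p - 1)) L = L - 1"
proof (rule poly_eqI)
  fix i
  show "coeff ((theta ^^ (p - 1)) L) i = coeff (L - 1) i"
  proof (cases "i = 0 \<or> i \<ge> p")
    case True
    then show ?thesis using L_0 L_deg p_gt_2 by (auto simp: coeff_theta_pow coeff_eq_0)
  next
    case False
    then have "\<not> p dvd i" by (auto dest: dvd_imp_le)
    then have nz: "of_nat i \<noteq> (0 :: 'k)" by (simp add: of_nat_eq_0_iff)
    have pr: "prime CHAR('k)" using prime_p char_p by metis
    have "of_nat i ^ p = (of_nat i :: 'k)"
    proof (induction i)
      case (Suc i)
      have "of_nat (Suc i) ^ p = (of_nat i + 1 :: 'k) ^ p" by (simp only: of_nat_Suc add.commute)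
      also have "\<dots> = of_nat i ^ p + 1 ^ p" by (rule freshmans_dream[OF pr char_p[symmetric]])
      also have "\<dots> = of_nat (Suc i)" by (simp only: Suc power_one of_nat_Suc add.commute)
      finally show ?case .
    qed (use p_gt_2 in simp)
    moreover have "of_nat i ^ p = (of_nat i * of_nat i ^ (p - 1) :: 'k)"
      using p_gt_2 by (intro power_minus_mult[symmetric, THEN trans[OF _ mult.commute]]) simp
    ultimately have "of_nat i * of_nat i ^ (p - 1) = (of_nat i * 1 :: 'k)" by simp
    then have "of_nat i ^ (p - 1) = (1 :: 'k)" using nz mult_left_cancel by blast
    then show ?thesis using False by (simp add: coeff_theta_pow coeff_1)
  qed
qed

text \<open>
  In the equation \<open>D T = 0\<close> the coefficient of \<open>x^(m+1)\<close> gives \<open>theta T\<^sub>m = 0\<close> once \<open>(m+2) T\<^sub>m\<^sub>+\<^sub>2 = 0\<close>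
  is known, so \<open>T\<^sub>m\<close> is a polynomial in \<open>g^p\<close>. The coefficient of \<open>x^(m-1)\<close> is
  \<open>m L T\<^sub>m + theta T\<^sub>m\<^sub>-\<^sub>2\<close>; its terms in \<open>g^p\<close> are those of \<open>m T\<^sub>m\<close>, because \<open>L\<close> has constant
  coefficient 1 and degree below \<open>p\<close>. Hence \<open>T\<^sub>m = 0\<close> for \<open>0 < m < p\<close>.
\<close>

lemma T_eq: "T = - monom 1 p"
proof (rule poly_eqI)
  fix m
  have Dx: "coeff ((D ^^ p) xx) m = (if m = p - 1 then L - 1 else 0)" if "m \<ge> p - 1" for m
    using coeff_D_xx[of "p - 1" m] that p_gt_2 theta_pow_L by (simp del: funpow.simps)
  have cT: "coeff T m = (if m = 0 then 0 else coeff ((D ^^ p) xx) (m - 1)) - L * coeff (P p) m" for m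
    by (simp add: T_def coeff_pCons split: nat.splits)
  have big: "coeff T m = 0" if "m > p" for m
  proof -
    have "m - 1 \<ge> p - 1" "m - 1 \<noteq> p - 1" using that p_gt_2 by auto
    then show ?thesis using that Dx[of "m - 1"] coeff_P_eq_0[of m p] by (simp add: cT)
  qed
  \<comment> \<open>The coefficient is (L - 1) - L: the first part comes from x \<delta>^p(x), the
    second from L P_p, as \<open>P p\<close> is monic in x.\<close>
  have top: "coeff T p = - 1"
    using p_gt_2 Dx[of "p - 1"] by (simp add: cT coeff_P_top)
  have low: "coeff T 0 = 0" by (simp add: cT coeff_P_0)
  have step: "coeff T m = 0" if "0 < m" "m < p" and IH: "Suc (Suc m) < p \<Longrightarrow> coeff T (Suc (Suc m)) = 0" for m
  proof -
    have "of_nat (Suc (Suc m)) * (L * coeff T (Suc (Suc m))) = 0"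
    proof -
      consider "Suc (Suc m) < p" | "Suc (Suc m) = p" | "Suc (Suc m) > p" by linarith
      then show ?thesis
      proof cases
        \<comment> \<open>The coefficient of x^p in T is not 0, but its factor m + 2 = p is.\<close>
        case 2
        then have "of_nat (Suc (Suc m)) = (0 :: 'k poly)"
          using of_nat_eq_0_iff of_nat_poly_eq_0_iff by (metis dvd_refl)
        then show ?thesis by (simp only: mult_zero_left)
      qed (simp_all add: IH big)
    qed
    then have "coeff (D T) (Suc m) = theta (coeff T m)"
      using \<open>0 < m\<close> by (simp only: coeff_D) simp
    then have th: "theta (coeff T m) = 0" by (simp add: D_T)
    have nd: "coeff (coeff T m) i = 0" if "\<not> p dvd i" for i
      using arg_cong[OF th, of "\<lambda>c. coeff c i"] that by (simp add: coeff_theta of_nat_eq_0_iff)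
    have e0: "of_nat m * (L * coeff T m) + (if m - 1 = 0 then 0 else theta (coeff T (m - 1 - 1))) = 0"
      using coeff_D[of T "m - 1"] \<open>0 < m\<close> by (simp only: D_T coeff_0 Suc_diff_1)
    then have e: "of_nat m * coeff (L * coeff T m) i
        + coeff (if m - 1 = 0 then 0 else theta (coeff T (m - 1 - 1))) i = 0" for i
    proof -
      define W where "W = (if m - 1 = 0 then 0 else theta (coeff T (m - 1 - 1)))"
      have "of_nat m * (L * coeff T m) + W = 0" unfolding W_def by (rule e0)
      then have "Polynomial.smult (of_nat m) (L * coeff T m) + W = 0" by (simp add: of_nat_poly)
      then show ?thesis unfolding W_def[symmetric] by (metis coeff_add coeff_smult coeff_0)
    qed
    have "coeff (coeff T m) i = 0" if "p dvd i" for i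
    proof -
      have "coeff (if m - 1 = 0 then 0 else theta (coeff T (m - 1 - 1))) i = 0"
        using that by (simp add: coeff_theta of_nat_eq_0_iff)
      then have "of_nat m * coeff (L * coeff T m) i = 0" using e[of i] by simp
      moreover have "\<not> p dvd m" using \<open>0 < m\<close> \<open>m < p\<close> by (auto dest: dvd_imp_le)
      ultimately have "coeff (L * coeff T m) i = 0" by (simp add: of_nat_eq_0_iff)
      moreover have "coeff (L * coeff T m) i = (\<Sum>j\<le>i. coeff L j * coeff (coeff T m) (i - j))"
        by (rule coeff_mult)
      moreover have "\<dots> = (\<Sum>j\<in>{0}. coeff L j * coeff (coeff T m) (i - j))"
      proof (rule sum.mono_neutral_right, simp, simp, rule ballI)
        fix j assume j: "j \<in> {..i} - {0}"
        show "coeff L j * coeff (coeff T m) (i - j) = 0"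
        proof (cases "j < p")
          case True
          then have "\<not> p dvd j" using j by (auto dest: dvd_imp_le)
          then have "\<not> p dvd i - j" using that j by (auto simp: dvd_diff_right_iff dest: dvd_diffD1)
          then show ?thesis using nd by simp
        qed (use L_deg in \<open>simp add: coeff_eq_0\<close>)
      qed
      ultimately show ?thesis using L_0 by simp
    qed
    then show ?thesis using nd by (intro poly_eqI) (metis coeff_0)
  qed
  have mid: "coeff T m = 0" if "0 < m" "m < p" for m
    using that
  \<comment> \<open>Descending in steps of two: the value at m relies on the one at m + 2.\<close>
  proof (induction "p - m" arbitrary: m rule: less_induct)
    case less
    show ?case
      using less.hyps[of "Suc (Suc m)"] less.prems by (rule_tac step[OF less.prems]) auto
  qed
  show "coeff T m = coeff (- monom 1 p) m"
    using low mid[of m] top big[of m] p_gt_2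
    by (cases "m = 0"; cases "m < p"; cases "m = p") (auto simp: one_pCons)
qed

definition dx :: "nat \<Rightarrow> 'k" where "dx n = chi ((D ^^ n) xx)"
definition dg :: "nat \<Rightarrow> 'k" where "dg n = chi ((D ^^ n) gg)"

lemma dx_1: "dx 1 = poly L 1" and dg_1: "dg 1 = \<alpha>"
  by (simp_all only: dx_def dg_def funpow.simps One_nat_def o_apply id_apply D_xx D_gg chi_simps) simp

text \<open>Apply \<open>chi\<close> to T. As \<open>chi\<close> sends g to 1, this gives the
  determinant, and - x^p becomes the right-hand side.\<close>

lemma det_eq: "dg 1 * dx p - dx 1 * dg p = - (\<alpha> ^ p)"
proof -
  have "chi T = dx p * \<alpha> - poly L 1 * dg p"
    unfolding T_def dx_def dg_def D_pow_gg chi_simps by simp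
  moreover have "chi T = - (\<alpha> ^ p)"
    unfolding T_eq by (simp add: chi_def poly_monom)
  ultimately show ?thesis by (simp only: dx_1 dg_1 mult.commute)
qed

section \<open>Divisibility of the degrees of singular polynomials\<close>

text \<open>For deg f = n the relation at y^(n-1) has the single term n \<chi>(\<delta> r) times the
  leading coefficient.\<close>

lemma sing_coeff_p_dvd:
  assumes f: "sing f" and n: "degree f > 0" and r: "chi (D r) \<noteq> 0"
  shows "p dvd degree f"
proof -
  obtain n where n: "degree f = Suc n" using n by (cases "degree f") auto
  have "{n<..Suc n} = {Suc n}" by auto
  then have "of_nat (Suc n) * chi (D r) * coeff f (Suc n) = 0"
    using sing_coeff[OF f, of "Suc n" n r] n by (simp del: of_nat_Suc)
  moreover have "coeff f (Suc n) \<noteq> 0" using n leading_coeff_0_iff[of f] by auto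
  ultimately have "of_nat (Suc n) = (0 :: 'k)" using r by (simp del: of_nat_Suc)
  then show ?thesis by (simp only: of_nat_eq_0_iff n)
qed

text \<open>
  If \<open>n = deg f\<close> is divisible by \<open>p\<close>, then \<open>g f = f\<close> forces the coefficients of \<open>f\<close> strictly between
  \<open>n - p + 1\<close> and \<open>n\<close> to vanish. The coefficients of \<open>y^(n-p)\<close> in \<open>x f = \<alpha> f\<close> and \<open>g f = f\<close> are then two linear
  equations in two unknowns whose determinant is the one in \<open>det_eq\<close>.
\<close>

lemma sing_p2_dvd:
  assumes f: "sing f" and n: "degree f > 0" and \<alpha>: "\<alpha> \<noteq> 0"
  shows "p\<^sup>2 dvd degree f"
proof (rule ccontr)
  assume np: "\<not> p\<^sup>2 dvd degree f"
  define n where "n = degree f"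
  have cg: "chi (D gg) \<noteq> 0" using \<alpha> by (simp add: D_gg del: mult_pCons_left mult_pCons_right)
  have pn: "p dvd n" using sing_coeff_p_dvd[OF f n cg] by (simp add: n_def)
  have le: "p \<le> n" using pn n n_def by (simp add: dvd_imp_le)
  have ch: "of_nat (n choose i) = (0::'k)" if "0 < i" "i < p" for i
    using dvd_choose_if_dvd[OF prime_p pn that] by (simp add: of_nat_eq_0_iff)
  \<comment> \<open>Downward induction on l with the relation at y^(l-1) for r = g. Above l only the
    term i = n survives, and its binomial coefficient is 0 in k because 0 < n - (l-1) < p.\<close>
  have gap: "coeff f l = 0" if "n - p + 1 < l" "l < n" for l
    using that
  proof (induction "n - l" arbitrary: l rule: less_induct)
    case less
    have "0 = (\<Sum>i\<in>{l - 1<..n}. of_nat (i choose (l - 1)) * chi ((D ^^ (i - (l - 1))) gg) * coeff f i)"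
      using sing_coeff[OF f, of n "l - 1" gg] by (simp add: n_def)
    also have "\<dots> = (\<Sum>i\<in>{l}. of_nat (i choose (l - 1)) * chi ((D ^^ (i - (l - 1))) gg) * coeff f i)"
    proof (rule sum.mono_neutral_right)
      show "\<forall>i\<in>{l - 1<..n} - {l}. of_nat (i choose (l - 1)) * chi ((D ^^ (i - (l - 1))) gg) * coeff f i = 0"
      proof
        fix i assume i: "i \<in> {l - 1<..n} - {l}"
        show "of_nat (i choose (l - 1)) * chi ((D ^^ (i - (l - 1))) gg) * coeff f i = 0"
        proof (cases "i = n")
          case True
          have "n choose (l - 1) = n choose (n - (l - 1))"
            using less.prems by (intro binomial_symmetric) auto
          then have "of_nat (n choose (l - 1)) = (0 :: 'k)"
            using ch[of "n - (l - 1)"] less.prems by auto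
          then show ?thesis using True by simp
        next
          case False
          have "coeff f i = 0" by (rule less.hyps) (use i less.prems False in auto)
          then show ?thesis by simp
        qed
      qed
    qed (use less.prems in auto)
    also have "\<dots> = of_nat l * chi (D gg) * coeff f l"
      using less.prems by (cases l) simp_all
    finally have "of_nat l * chi (D gg) * coeff f l = 0" by simp
    moreover have "\<not> p dvd l"
    proof
      assume "p dvd l"
      then have "p dvd n - l" using pn by (simp add: dvd_diff_nat)
      then have "p \<le> n - l" using less.prems by (intro dvd_imp_le) auto
      then show False using less.prems by auto
    qed
    ultimately show ?case using cg by (simp add: of_nat_eq_0_iff)
  qed
  have key: "of_nat (n - p + 1) * chi (D r) * coeff f (n - p + 1)
      + of_nat (n choose p) * chi ((D ^^ p) r) * coeff f n = 0" for r
  proof -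
    have "0 = (\<Sum>i\<in>{n - p<..n}. of_nat (i choose (n - p)) * chi ((D ^^ (i - (n - p))) r) * coeff f i)"
      using sing_coeff[OF f, of n "n - p" r] by (simp add: n_def)
    also have "\<dots> = (\<Sum>i\<in>{n - p + 1, n}. of_nat (i choose (n - p)) * chi ((D ^^ (i - (n - p))) r) * coeff f i)"
    proof (rule sum.mono_neutral_right)
      show "\<forall>i\<in>{n - p<..n} - {n - p + 1, n}. of_nat (i choose (n - p)) * chi ((D ^^ (i - (n - p))) r) * coeff f i = 0"
        using gap by auto
    qed (use le p_gt_2 in auto)
    also have "\<dots> = of_nat (n - p + 1) * chi (D r) * coeff f (n - p + 1)
        + of_nat (n choose (n - p)) * chi ((D ^^ p) r) * coeff f n"
      using le p_gt_2 by (subst sum.insert) (auto simp: Suc_diff_le)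
    also have "n choose (n - p) = n choose p" using binomial_symmetric[OF le] by simp
    finally show ?thesis by simp
  qed
  \<comment> \<open>The two unknowns of the linear system; the binomial factors are absorbed into
    them.\<close>
  define u v where "u = of_nat (n - p + 1) * coeff f (n - p + 1)" and "v = of_nat (n choose p) * coeff f n"
  have "dx 1 * u + dx p * v = 0" "dg 1 * u + dg p * v = 0"
    using key[of xx] key[of gg] by (simp_all add: dx_def dg_def u_def v_def mult_ac)
  moreover have "v * (dg 1 * dx p - dx 1 * dg p) = dg 1 * (dx 1 * u + dx p * v) - dx 1 * (dg 1 * u + dg p * v)"
    by (simp only: algebra_simps)
  ultimately have "v * (dg 1 * dx p - dx 1 * dg p) = 0" by simp
  \<comment> \<open>Here p^2 not dividing n enters: (n choose p) is then nonzero in k.\<close>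
  moreover have "v \<noteq> 0"
    using not_dvd_choose_prime[OF prime_p pn] np n leading_coeff_0_iff[of f]
    by (auto simp: v_def n_def of_nat_eq_0_iff)
  ultimately show False using det_eq \<alpha> by simp
qed

section \<open>Singular polynomials of degrees p^2 and p\<close>

definition Ypol :: "'k \<Rightarrow> 'k \<Rightarrow> 'k poly" where
  "Ypol c d = yy ^ (p * p) + Polynomial.smult c (yy ^ p) + Polynomial.smult d yy"

text \<open>With c = \<chi>(r), where r is the ratio of \<delta>^p(g) to \<delta>(g), this is the
  image of Y in k[y].\<close>

definition Zpol :: "'k \<Rightarrow> 'k poly" where
  "Zpol c = yy ^ p - Polynomial.smult c yy"

text \<open>These powers of y are singular up to a constant. A linear combination of them is
  therefore singular once the constants cancel for r = x and r = g.\<close>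

lemma act_yy_pow: "act r yy = Polynomial.smult (chi r) yy + [:chi (D r):]"
  "act r (yy ^ p) = Polynomial.smult (chi r) (yy ^ p) + [:chi ((D ^^ p) r):]"
  "act r (yy ^ (p * p)) = Polynomial.smult (chi r) (yy ^ (p * p)) + [:chi ((D ^^ (p * p)) r):]"
  using act_yy[of r 1] act_yy_p[of r 1] act_yy_p2[of r 1] by (simp_all add: mult.commute)

lemma degree_yy_power: "degree (yy ^ n) = n"
  by (simp add: degree_power_eq)

lemma exists_sing_p2:
  assumes "\<alpha> \<noteq> 0"
  obtains f where "sing f" "degree f = p\<^sup>2"
proof -
  define \<Delta> where "\<Delta> = dg 1 * dx p - dx 1 * dg p"
  have \<Delta>: "\<Delta> \<noteq> 0" using assms by (simp only: \<Delta>_def det_eq) simp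
  \<comment> \<open>Cramer's solution of the two equations saying that the constants cancel for x
    and for g.\<close>
  define c where "c = (dx 1 * dg (p * p) - dg 1 * dx (p * p)) / \<Delta>"
  define d where "d = (dg p * dx (p * p) - dx p * dg (p * p)) / \<Delta>"
  have cd: "\<Delta> * c = dx 1 * dg (p * p) - dg 1 * dx (p * p)" "\<Delta> * d = dg p * dx (p * p) - dx p * dg (p * p)"
    using \<Delta> by (simp_all add: c_def d_def)
  have "\<Delta> * (dx (p * p) + c * dx p + d * dx 1) = 0" "\<Delta> * (dg (p * p) + c * dg p + d * dg 1) = 0"
    by (rule cramer_zero[OF cd \<Delta>_def])+
  then have z: "dx (p * p) + c * dx p + d * dx 1 = 0" "dg (p * p) + c * dg p + d * dg 1 = 0"
    using \<Delta> mult_eq_0_iff by blast+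
  have ab: "chi (D xx) = dx 1" "chi (D gg) = dg 1" by (simp_all add: dx_def dg_def)
  have "act r (Ypol c d) = Polynomial.smult (chi r) (Ypol c d)
      + [:chi ((D ^^ (p * p)) r) + c * chi ((D ^^ p) r) + d * chi (D r):]" for r
    unfolding Ypol_def act_add_right act_smult act_yy_pow
    by (simp add: smult_add_right mult.commute)
  then have "sing (Ypol c d)"
    by (intro singI) (simp_all only: ab z chi_simps flip: dx_def dg_def, simp_all)
  moreover have "degree (Ypol c d) = p\<^sup>2"
  proof -
    have "p < p * p" using p_gt_2 by auto
    moreover from this have "1 < p * p" using p_gt_2 by linarith
    ultimately have "degree (Polynomial.smult c (yy ^ p) + Polynomial.smult d yy) < degree (yy ^ (p * p))"
      by (intro degree_add_less) (auto simp: degree_yy_power intro: le_less_trans[OF degree_smult_le])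
    then show ?thesis
      by (simp add: Ypol_def add.assoc degree_add_eq_left degree_yy_power power2_eq_square)
  qed
  ultimately show thesis by (rule that)
qed

lemma degree_Zpol: "degree (Zpol c) = p"
  using p_gt_2 unfolding Zpol_def diff_conv_add_uminus
  by (subst degree_add_eq_left) (auto simp: degree_yy_power intro: le_less_trans[OF degree_smult_le])

text \<open>For \<alpha> = 0 both \<delta>(g) and \<delta>^p(g) are multiples of x, so
  \<open>chi\<close> kills them and g raises no condition. For x, \<delta>^p(x) = \<delta>(x r) has
  value \<chi>(L) \<chi>(r), which the term - \<chi>(r) y compensates.\<close>

lemma sing_Zpol:
  assumes "\<alpha> = 0" "P p = xx * r"
  shows "sing (Zpol (chi r))"
proof -
  have xx: "chi xx = 0" using chi_simps(7) assms(1) by (rule trans)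
  have "dg p = 0" by (simp only: dg_def D_pow_gg assms(2) chi_simps(5) xx mult_zero_left)
  moreover have b1: "dg 1 = 0" using dg_1 assms(1) by (rule trans)
  moreover have ab: "chi (D xx) = dx 1" "chi (D gg) = dg 1" by (simp_all add: dx_def dg_def)
  moreover have Z: "act s (Zpol c) = Polynomial.smult (chi s) (Zpol c)
      + [:chi ((D ^^ p) s) - c * chi (D s):]" for s c
    unfolding Zpol_def act_diff act_smult act_yy_pow
    by (simp add: smult_diff_right mult.commute)
  moreover have "dx p = dx 1 * chi r"
  proof -
    have "(D ^^ p) xx = xx * D r + [:L:] * r"
      using D_P unfolding assms(2) D_mult D_xx by simp
    then show ?thesis by (simp only: dx_def[of p] dx_1 chi_simps(3,5,9) xx mult_zero_left add_0)
  qed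
  ultimately show ?thesis
    by (intro singI) (simp_all only: Z ab chi_simps b1 mult_zero_right flip: dx_def dg_def, simp_all)
qed

lemma obtain_P_ratio: obtains r where "P p = xx * r"
  using coeff_P_0 that by (cases "P p") simp

end

section \<open>Smash products\<close>

locale smash = group G for G (structure) +
  fixes act :: "'a \<Rightarrow> 'b::ring_1 \<Rightarrow> 'b"
  assumes fin: "finite (carrier G)"
    and act_one: "act \<one> u = u"
    and act_mult: "a \<in> carrier G \<Longrightarrow> b \<in> carrier G \<Longrightarrow> act (a \<otimes> b) u = act a (act b u)"
    and act_add: "a \<in> carrier G \<Longrightarrow> act a (u + v) = act a u + act a v"
    and act_times: "a \<in> carrier G \<Longrightarrow> act a (u * v) = act a u * act a v"
    and act_unit: "a \<in> carrier G \<Longrightarrow> act a 1 = 1"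
begin

abbreviation S where "S \<equiv> smash_product G act"

lemma act_0: "a \<in> carrier G \<Longrightarrow> act a 0 = 0"
  using act_add[of a 0 0] by simp

lemma act_sum: "a \<in> carrier G \<Longrightarrow> act a (sum f A) = (\<Sum>i\<in>A. act a (f i))"
  by (induction A rule: infinite_finite_induct) (simp_all add: act_0 act_add)

lemma carrier_S: "carrier S = {f. \<forall>h. h \<notin> carrier G \<longrightarrow> f h = 0}"
  and add_S: "f \<oplus>\<^bsub>S\<^esub> f' = (\<lambda>h. f h + f' h)"
  and zero_S: "\<zero>\<^bsub>S\<^esub> = (\<lambda>_. 0)"
  and one_S: "\<one>\<^bsub>S\<^esub> = (\<lambda>h. if h = \<one> then 1 else 0)"
  and mult_S: "f \<otimes>\<^bsub>S\<^esub> f' = (\<lambda>h. if h \<in> carrier G then \<Sum>a\<in>carrier G. f a * act a (f' (inv a \<otimes> h)) else 0)"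
  by (simp_all add: smash_product_def)

lemma smash_assoc:
  assumes "h \<in> carrier G"
  shows "((f \<otimes>\<^bsub>S\<^esub> f') \<otimes>\<^bsub>S\<^esub> f'') h = (f \<otimes>\<^bsub>S\<^esub> (f' \<otimes>\<^bsub>S\<^esub> f'')) h"
proof -
  define t where "t a b = f a * act a (f' (inv a \<otimes> b)) * act b (f'' (inv b \<otimes> h))" for a b
  have "((f \<otimes>\<^bsub>S\<^esub> f') \<otimes>\<^bsub>S\<^esub> f'') h = (\<Sum>b\<in>carrier G. \<Sum>a\<in>carrier G. t a b)"
    using assms by (simp add: mult_S t_def sum_distrib_right)
  also have "\<dots> = (\<Sum>a\<in>carrier G. \<Sum>b\<in>carrier G. t a b)" by (rule sum.swap)
  also have "\<dots> = (\<Sum>a\<in>carrier G. f a * act a ((f' \<otimes>\<^bsub>S\<^esub> f'') (inv a \<otimes> h)))"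
  proof (rule sum.cong[OF refl])
    fix a assume a: "a \<in> carrier G"
    have "f a * act a ((f' \<otimes>\<^bsub>S\<^esub> f'') (inv a \<otimes> h))
        = (\<Sum>c\<in>carrier G. f a * act a (f' c * act c (f'' (inv c \<otimes> (inv a \<otimes> h)))))"
      using a assms by (simp add: mult_S act_sum sum_distrib_left)
    also have "\<dots> = (\<Sum>c\<in>carrier G. t a (a \<otimes> c))"
    proof (rule sum.cong[OF refl])
      fix c assume c: "c \<in> carrier G"
      have "inv a \<otimes> (a \<otimes> c) = c" "inv (a \<otimes> c) \<otimes> h = inv c \<otimes> (inv a \<otimes> h)"
        using a c assms by (simp_all add: inv_mult_group m_assoc flip: m_assoc[of "inv a" a c])
      then show "f a * act a (f' c * act c (f'' (inv c \<otimes> (inv a \<otimes> h)))) = t a (a \<otimes> c)"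
        using a c by (simp add: t_def act_times act_mult mult.assoc)
    qed
    also have "\<dots> = (\<Sum>b\<in>carrier G. t a b)"
      by (rule sum.reindex_bij_witness[of _ "\<lambda>b. inv a \<otimes> b" "\<lambda>c. a \<otimes> c"])
         (use a in \<open>simp_all flip: m_assoc\<close>)
    finally show "(\<Sum>b\<in>carrier G. t a b) = f a * act a ((f' \<otimes>\<^bsub>S\<^esub> f'') (inv a \<otimes> h))" by simp
  qed
  also have "\<dots> = (f \<otimes>\<^bsub>S\<^esub> (f' \<otimes>\<^bsub>S\<^esub> f'')) h"
    using assms by (simp add: mult_S)
  finally show ?thesis .
qed

lemma ring_S: "ring S"
proof (rule ringI)
  show "abelian_group S"
  proof (rule abelian_groupI)
    fix f assume "f \<in> carrier S"
    then show "\<exists>y\<in>carrier S. y \<oplus>\<^bsub>S\<^esub> f = \<zero>\<^bsub>S\<^esub>"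
      by (intro bexI[of _ "\<lambda>h. - f h"]) (auto simp: carrier_S add_S zero_S)
  qed (auto simp: carrier_S add_S zero_S algebra_simps)
  show "Group.monoid S"
  proof (rule Group.monoidI)
    fix f f' f'' assume "f \<in> carrier S" "f' \<in> carrier S" "f'' \<in> carrier S"
    show "f \<otimes>\<^bsub>S\<^esub> f' \<otimes>\<^bsub>S\<^esub> f'' = f \<otimes>\<^bsub>S\<^esub> (f' \<otimes>\<^bsub>S\<^esub> f'')"
      by (rule ext) (metis smash_assoc mult_S)
  next
    fix f assume f: "f \<in> carrier S"
    have "(\<Sum>a\<in>carrier G. (if a = \<one> then 1 else 0) * act a (f (inv a \<otimes> h))) = f h" if "h \<in> carrier G" for h
    proof -
      have "(\<Sum>a\<in>carrier G. (if a = \<one> then 1 else 0) * act a (f (inv a \<otimes> h)))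
          = (\<Sum>a\<in>carrier G. if a = \<one> then f h else 0)"
        by (rule sum.cong) (use that in \<open>auto simp: act_one\<close>)
      then show ?thesis using fin by simp
    qed
    then show "\<one>\<^bsub>S\<^esub> \<otimes>\<^bsub>S\<^esub> f = f"
      using f by (intro ext) (auto simp: carrier_S mult_S one_S)
    have "(\<Sum>a\<in>carrier G. f a * act a (if inv a \<otimes> h = \<one> then 1 else 0)) = f h" if "h \<in> carrier G" for h
    proof -
      have "(\<Sum>a\<in>carrier G. f a * act a (if inv a \<otimes> h = \<one> then 1 else 0))
          = (\<Sum>a\<in>carrier G. if a = h then f h else 0)"
      proof (rule sum.cong[OF refl])
        fix a assume a: "a \<in> carrier G"
        have "inv a \<otimes> h = \<one> \<longleftrightarrow> a = h" using a that by (metis inv_equality inv_inv inv_closed l_inv)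
        then show "f a * act a (if inv a \<otimes> h = \<one> then 1 else 0) = (if a = h then f h else 0)"
          using a that by (simp add: act_unit act_0)
      qed
      then show ?thesis using fin that by simp
    qed
    then show "f \<otimes>\<^bsub>S\<^esub> \<one>\<^bsub>S\<^esub> = f"
      using f by (intro ext) (auto simp: carrier_S mult_S one_S)
  qed (auto simp: carrier_S mult_S one_S)
qed (auto simp: carrier_S mult_S add_S act_add sum.distrib algebra_simps fun_eq_iff)

sublocale S: ring S by (rule ring_S)

lemma minus_S:
  assumes "f \<in> carrier S" shows "\<ominus>\<^bsub>S\<^esub> f = (\<lambda>h. - f h)"
  using assms by (intro S.minus_equality) (auto simp: carrier_S add_S zero_S)

lemma diff_S:
  assumes "f' \<in> carrier S" shows "f \<ominus>\<^bsub>S\<^esub> f' = (\<lambda>h. f h - f' h)"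
  using assms by (simp add: a_minus_def minus_S add_S)

lemma single_closed: "a \<in> carrier G \<Longrightarrow> smash_single a u \<in> carrier S"
  by (auto simp: smash_single_def carrier_S)

lemma single_mult:
  assumes "a \<in> carrier G" "b \<in> carrier G"
  shows "smash_single a u \<otimes>\<^bsub>S\<^esub> smash_single b v = smash_single (a \<otimes> b) (u * act a v)"
proof
  fix h
  show "(smash_single a u \<otimes>\<^bsub>S\<^esub> smash_single b v) h = smash_single (a \<otimes> b) (u * act a v) h"
  proof (cases "h \<in> carrier G")
    case True
    have "(smash_single a u \<otimes>\<^bsub>S\<^esub> smash_single b v) h
        = (\<Sum>c\<in>carrier G. smash_single a u c * act c (smash_single b v (inv c \<otimes> h)))"
      using True by (simp add: mult_S)
    also have "\<dots> = (\<Sum>c\<in>carrier G. if c = a then u * act a (if inv a \<otimes> h = b then v else 0) else 0)"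
      by (rule sum.cong) (auto simp: smash_single_def)
    also have "\<dots> = u * act a (if inv a \<otimes> h = b then v else 0)" using fin assms by simp
    also have "inv a \<otimes> h = b \<longleftrightarrow> h = a \<otimes> b"
      using assms True by (metis inv_solve_left)
    finally show ?thesis using assms by (simp add: smash_single_def act_0)
  qed (use assms in \<open>auto simp: mult_S smash_single_def\<close>)
qed

lemma single_add: "smash_single a (u + v) = smash_single a u \<oplus>\<^bsub>S\<^esub> smash_single a v"
  by (auto simp: smash_single_def add_S)

lemma smash_induct [consumes 1, case_names zero add single]:
  assumes f: "f \<in> carrier S" and 0: "Q (\<lambda>_. 0)"
    and add: "\<And>f f'. f \<in> carrier S \<Longrightarrow> f' \<in> carrier S \<Longrightarrow> Q f \<Longrightarrow> Q f' \<Longrightarrow> Q (\<lambda>h. f h + f' h)"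
    and single: "\<And>a u. a \<in> carrier G \<Longrightarrow> Q (smash_single a u)"
  shows "Q f"
proof -
  have "Q (\<lambda>h. \<Sum>a\<in>A. smash_single a (f a) h)" if "finite A" "A \<subseteq> carrier G" for A
    using that
  proof (induction A rule: finite_induct)
    case (insert a A)
    have "(\<lambda>h. \<Sum>a\<in>A. smash_single a (f a) h) \<in> carrier S"
      using insert.prems by (auto simp: carrier_S smash_single_def intro!: sum.neutral)
    with insert show ?case by (simp add: add single single_closed)
  qed (simp add: 0)
  from this[OF fin order_refl] have "Q (\<lambda>h. \<Sum>a\<in>carrier G. smash_single a (f a) h)" .
  also have "(\<lambda>h. \<Sum>a\<in>carrier G. smash_single a (f a) h) = f"
    using f fin by (auto simp: smash_single_def carrier_S fun_eq_iff)
  finally show ?thesis .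
qed

end

lemma smash_trivial_comm:
  fixes f f' :: "'a \<Rightarrow> 'b::comm_ring_1"
  assumes "comm_group G"
  shows "f \<otimes>\<^bsub>smash_product G (\<lambda>_. id)\<^esub> f' = f' \<otimes>\<^bsub>smash_product G (\<lambda>_. id)\<^esub> f"
proof -
  interpret comm_group G by fact
  have k: "inv\<^bsub>G\<^esub> (inv\<^bsub>G\<^esub> a \<otimes>\<^bsub>G\<^esub> h) \<otimes>\<^bsub>G\<^esub> h = a" if "a \<in> carrier G" "h \<in> carrier G" for a h
    using that by (metis inv_mult_group inv_inv m_comm inv_closed l_inv m_assoc l_one)
  have "(\<Sum>a\<in>carrier G. f a * f' (inv\<^bsub>G\<^esub> a \<otimes>\<^bsub>G\<^esub> h)) = (\<Sum>a\<in>carrier G. f' a * f (inv\<^bsub>G\<^esub> a \<otimes>\<^bsub>G\<^esub> h))"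
    if "h \<in> carrier G" for h
    by (rule sum.reindex_bij_witness[of _ "\<lambda>a. inv\<^bsub>G\<^esub> a \<otimes>\<^bsub>G\<^esub> h" "\<lambda>a. inv\<^bsub>G\<^esub> a \<otimes>\<^bsub>G\<^esub> h"])
       (use that in \<open>simp_all add: k mult.commute\<close>)
  then show ?thesis by (auto simp: smash_product_def fun_eq_iff)
qed

lemma smash_trivial:
  assumes "group G" "finite (carrier G)"
  shows "smash G (\<lambda>_. id)"
  using assms by (simp add: smash_def smash_axioms_def)

lemma smash_trivial_cring:
  assumes "comm_group G" "finite (carrier G)"
  shows "cring (smash_product G (\<lambda>_. id :: 'b::comm_ring_1 \<Rightarrow> 'b))"
proof -
  interpret comm_group G by fact
  interpret smash G "\<lambda>_. id :: 'b \<Rightarrow> 'b" using assms by (intro smash_trivial is_group)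
  show ?thesis
    by (intro cring.intro ring_S comm_monoid.intro comm_monoid_axioms.intro S.monoid_axioms
        smash_trivial_comm assms)
qed

section \<open>The free algebra\<close>

lemma free_const_simps:
  "free_const 0 = 0" "free_const 1 = 1" "free_const (c + d) = free_const c + free_const d"
  "free_const (c * d) = free_const c * free_const d"
  by (simp_all add: free_const_def single_add mult_single)

lemma single_induct [case_names zero single add]:
  fixes f :: "'a \<Rightarrow>\<^sub>0 'b::comm_monoid_add"
  assumes "Q 0" "\<And>w c. Q (Poly_Mapping.single w c)" "\<And>f h. Q f \<Longrightarrow> Q h \<Longrightarrow> Q (f + h)"
  shows "Q f"
proof -
  have "Q (\<Sum>w\<in>A. Poly_Mapping.single w (Poly_Mapping.lookup f w))" for A
    by (induction A rule: infinite_finite_induct) (auto intro: assms)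
  moreover have "f = (\<Sum>w\<in>Poly_Mapping.keys f. Poly_Mapping.single w (Poly_Mapping.lookup f w))"
    by (rule poly_mapping_eqI) (simp add: lookup_sum lookup_single when_def in_keys_iff)
  ultimately show ?thesis by metis
qed

lemma free_const_commute: "free_const c * f = f * free_const c"
  by (induction f rule: single_induct)
     (simp_all add: free_const_def mult_single mult.commute[of c] distrib_left distrib_right)

lemma free_induct [case_names const LX LY add mult]:
  fixes f :: "'k::field free_alg"
  assumes const: "\<And>c. Q (free_const c)" and x: "Q (free_var LX)" and y: "Q (free_var LY)"
    and add: "\<And>f h. Q f \<Longrightarrow> Q h \<Longrightarrow> Q (f + h)" and mult: "\<And>f h. Q f \<Longrightarrow> Q h \<Longrightarrow> Q (f * h)"
  shows "Q f"
proof -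
  have var: "Q (free_var l)" for l using x y by (cases l) auto
  have word: "Q (Poly_Mapping.single (Word u) 1)" for u
  proof (induction u)
    case Nil
    then show ?case using const[of 1] by (simp add: free_const_def zero_monom2_def)
  next
    case (Cons l u)
    have "Poly_Mapping.single (Word (l # u)) (1 :: 'k) = free_var l * Poly_Mapping.single (Word u) 1"
      by (simp add: free_var_def mult_single)
    then show ?case using Cons var mult by metis
  qed
  have single: "Q (Poly_Mapping.single w c)" for w c
  proof -
    obtain u where "w = Word u" by (cases w)
    then have "Poly_Mapping.single w c = free_const c * Poly_Mapping.single (Word u) 1"
      by (simp add: free_const_def mult_single)
    then show ?thesis using word mult const by metis
  qed
  show ?thesis
    by (induction f rule: single_induct) (use const[of 0] single add in \<open>simp_all add: free_const_simps\<close>)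
qed

lemma subst_word_add: "subst_word s (v + w) = subst_word s v * subst_word s w"
  by (cases v; cases w) simp

lemma free_subst_single: "free_subst s (Poly_Mapping.single w c) = free_const c * subst_word s w"
  by (cases "c = 0") (simp_all add: free_subst_def free_const_simps)

lemma free_subst_add: "free_subst s (f + h) = free_subst s f + free_subst s h"
  unfolding free_subst_def
  by (rule setsum_keys_plus_distrib) (simp_all add: free_const_simps algebra_simps)

lemma free_subst_0: "free_subst s 0 = 0"
  by (simp add: free_subst_def)

lemma free_subst_mult: "free_subst s (f * h) = free_subst s f * free_subst s h"
proof (induction f rule: single_induct)
  case (single v c)
  show ?case
  proof (induction h rule: single_induct)
    case (single w d)
    have "subst_word s v * (free_const d * subst_word s w)
        = free_const d * (subst_word s v * subst_word s w)"
      by (simp only: mult.assoc [symmetric] free_const_commute[of d "subst_word s v"])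
    then show ?case
      by (simp add: mult_single free_subst_single subst_word_add free_const_simps mult.assoc)
  qed (simp_all add: free_subst_0 free_subst_add distrib_left)
qed (simp_all add: free_subst_0 free_subst_add distrib_right)

lemma free_subst_const: "free_subst s (free_const c) = free_const c"
  by (simp add: free_const_def free_subst_single zero_monom2_def)

lemma free_subst_var: "free_subst s (free_var l) = s l"
  by (simp add: free_var_def free_subst_single free_const_simps)

lemma g_act_add: "g_act (f + h) = g_act f + g_act h"
  and g_act_mult: "g_act (f * h) = g_act f * g_act h"
  and g_act_const: "g_act (free_const c) = free_const c"
  and g_act_x: "g_act (free_var LX) = free_var LX"
  and g_act_y: "g_act (free_var LY) = free_var LX + free_var LY"
  by (simp_all add: g_act_def free_subst_add free_subst_mult free_subst_const free_subst_var)

lemma g_act_of_nat: "g_act (of_nat n) = of_nat n"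
proof -
  have "free_const (of_nat n) = of_nat n" for n
    by (induction n) (simp_all add: free_const_simps)
  then show ?thesis by (metis g_act_const)
qed

lemma g_act_pow_add: "(g_act ^^ n) (f + h) = (g_act ^^ n) f + (g_act ^^ n) h"
  and g_act_pow_mult: "(g_act ^^ n) (f * h) = (g_act ^^ n) f * (g_act ^^ n) h"
  and g_act_pow_const: "(g_act ^^ n) (free_const c) = free_const c"
  and g_act_pow_x: "(g_act ^^ n) (free_var LX) = free_var LX"
  by (induction n) (simp_all add: g_act_add g_act_mult g_act_const g_act_x)

lemma g_act_pow_y: "(g_act ^^ n) (free_var LY) = of_nat n * free_var LX + free_var LY"
  by (induction n) (simp_all add: g_act_add g_act_mult g_act_x g_act_y g_act_of_nat algebra_simps)

text \<open>The p-th iterate sends y to y + p x, so the cyclic group of order p does act.\<close>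

lemma g_act_char:
  fixes f :: "'k::field free_alg"
  assumes "CHAR('k) = p"
  shows "(g_act ^^ p) f = f"
proof (induction f rule: free_induct)
  case LY
  have "of_nat p = (0 :: 'k)" using assms by auto
  then have "of_nat p = (0 :: 'k free_alg)"
    by (metis single_of_nat single_zero)
  then show ?case by (simp add: g_act_pow_y)
qed (simp_all add: g_act_pow_add g_act_pow_mult g_act_pow_const g_act_pow_x)

section \<open>The derivation of R\<close>

locale smash_Delta = poly_action_char L \<alpha> p for L :: "'k::field poly" and \<alpha> :: 'k and p :: nat +
  fixes lam :: "int \<Rightarrow> 'k"
  assumes lam_out: "i \<notin> {0..<int p} \<Longrightarrow> lam i = 0"
    and coeff_L: "coeff L j = (if j < p then lam (int j) else 0)"
begin

lemma carrier_G: "carrier (integer_mod_group p) = {0..<int p}"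
  using p_gt_2 by (simp add: carrier_integer_mod_group)

sublocale X: smash "integer_mod_group p" "\<lambda>_. id :: 'k poly \<Rightarrow> 'k poly"
  by (intro smash_trivial) (simp_all add: carrier_G)

sublocale R: cring "xg_ring p :: (int \<Rightarrow> 'k poly) ring"
  unfolding xg_ring_def by (intro smash_trivial_cring) (simp_all add: carrier_G)

abbreviation xg :: "(int \<Rightarrow> 'k poly) ring" where "xg \<equiv> xg_ring p"

lemma carrier_xg: "carrier xg = {f. \<forall>h. h \<notin> {0..<int p} \<longrightarrow> f h = 0}"
  and add_xg: "f \<oplus>\<^bsub>xg\<^esub> f' = (\<lambda>h. f h + f' h)"
  and zero_xg: "\<zero>\<^bsub>xg\<^esub> = (\<lambda>_. 0)"
  and one_xg: "\<one>\<^bsub>xg\<^esub> = smash_single 0 1"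
  and mult_xg: "f \<otimes>\<^bsub>xg\<^esub> f' = (\<lambda>h. if h \<in> {0..<int p} then \<Sum>a\<in>{0..<int p}. f a * f' ((h - a) mod int p) else 0)"
proof -
  have "(-a mod int p + h) mod int p = (h - a) mod int p" for a h
    by (metis diff_conv_add_uminus add.commute mod_add_left_eq)
  then show "f \<otimes>\<^bsub>xg\<^esub> f' = (\<lambda>h. if h \<in> {0..<int p} then \<Sum>a\<in>{0..<int p}. f a * f' ((h - a) mod int p) else 0)"
    by (auto simp: xg_ring_def X.mult_S carrier_G fun_eq_iff intro!: sum.cong)
qed (auto simp: xg_ring_def X.carrier_S X.add_S X.zero_S X.one_S carrier_G smash_single_def)

lemmas single_mult_xg = X.single_mult[folded xg_ring_def, unfolded carrier_G id_apply mult_integer_mod_group]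
  and single_add_xg = X.single_add[folded xg_ring_def]

lemma R_x_closed [simp]: "R_x \<in> carrier xg"
  and R_g_closed [simp]: "R_g \<in> carrier xg"
  and const_closed [simp]: "smash_single 0 q \<in> carrier xg"
  and R_lam_closed [simp]: "R_of_group_alg lam \<in> carrier xg"
  using p_gt_2 by (auto simp: R_x_def R_g_def carrier_xg smash_single_def R_of_group_alg_def lam_out)

lemma of_int_mod: "of_int (i mod int p) = (of_int i :: 'k poly)"
proof -
  have "of_nat p = (0 :: 'k poly)" by (simp add: of_nat_poly_eq_0_iff of_nat_eq_0_iff)
  then have "of_int (int p * (i div int p)) = (0 :: 'k poly)" by simp
  then have "of_int (i mod int p) + of_int (int p * (i div int p)) = (of_int (i mod int p) :: 'k poly)"
    by simp
  then show ?thesis by (metis mod_mult_div_eq of_int_add)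
qed

text \<open>The operator x g d/dg on R. The factor i depends only on i modulo p in characteristic p,
  which makes it compatible with g^p = 1.\<close>

definition E1 :: "(int \<Rightarrow> 'k poly) \<Rightarrow> int \<Rightarrow> 'k poly" where
  "E1 F = (\<lambda>i. of_int i * (yy * F i))"

definition E2 :: "(int \<Rightarrow> 'k poly) \<Rightarrow> int \<Rightarrow> 'k poly" where
  "E2 F = (\<lambda>i. pderiv (F i))"

text \<open>The existence witness for \<open>delta\<close>: \<delta> as x g d/dg + \<lambda> d/dx,
  written down directly on R.\<close>

definition der :: "(int \<Rightarrow> 'k poly) \<Rightarrow> int \<Rightarrow> 'k poly" where
  "der F = E1 F \<oplus>\<^bsub>xg\<^esub> R_of_group_alg lam \<otimes>\<^bsub>xg\<^esub> E2 F"

lemma E_closed [simp]: "F \<in> carrier xg \<Longrightarrow> E1 F \<in> carrier xg" "F \<in> carrier xg \<Longrightarrow> E2 F \<in> carrier xg"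
  by (auto simp: E1_def E2_def carrier_xg)

lemma E1_mult: "E1 (F \<otimes>\<^bsub>xg\<^esub> F') = F \<otimes>\<^bsub>xg\<^esub> E1 F' \<oplus>\<^bsub>xg\<^esub> E1 F \<otimes>\<^bsub>xg\<^esub> F'"
proof
  fix h
  have h: "of_int h = (of_int ((h - a) mod int p) + of_int a :: 'k poly)" for a
    by (simp add: of_int_mod)
  have *: "of_int h * (yy * (u * v)) = u * (of_int ((h - a) mod int p) * (yy * v)) + of_int a * (yy * u) * v"
    for a and u v :: "'k poly"
    unfolding h[of a] by (simp only: distrib_left distrib_right mult_ac)
  show "E1 (F \<otimes>\<^bsub>xg\<^esub> F') h = (F \<otimes>\<^bsub>xg\<^esub> E1 F' \<oplus>\<^bsub>xg\<^esub> E1 F \<otimes>\<^bsub>xg\<^esub> F') h"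
  proof (cases "h \<in> {0..<int p}")
    case True
    have "E1 (F \<otimes>\<^bsub>xg\<^esub> F') h = (\<Sum>a\<in>{0..<int p}. of_int h * (yy * (F a * F' ((h - a) mod int p))))"
      unfolding E1_def mult_xg if_P[OF True] sum_distrib_left ..
    also have "\<dots> = (\<Sum>a\<in>{0..<int p}. F a * E1 F' ((h - a) mod int p) + E1 F a * F' ((h - a) mod int p))"
      unfolding E1_def by (rule sum.cong[OF refl *])
    finally show ?thesis unfolding mult_xg add_xg if_P[OF True] sum.distrib .
  next
    case False
    then show ?thesis unfolding E1_def mult_xg add_xg if_not_P[OF False] by simp
  qed
qed

lemma E2_mult: "E2 (F \<otimes>\<^bsub>xg\<^esub> F') = F \<otimes>\<^bsub>xg\<^esub> E2 F' \<oplus>\<^bsub>xg\<^esub> E2 F \<otimes>\<^bsub>xg\<^esub> F'"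
proof -
  have "pderiv (sum f A) = (\<Sum>i\<in>A. pderiv (f i))" for f :: "int \<Rightarrow> 'k poly" and A
    by (induction A rule: infinite_finite_induct) (simp_all add: pderiv_add)
  then show ?thesis
    by (auto simp: E2_def mult_xg add_xg fun_eq_iff pderiv_mult sum.distrib algebra_simps)
qed

lemma E_add: "E1 (F \<oplus>\<^bsub>xg\<^esub> F') = E1 F \<oplus>\<^bsub>xg\<^esub> E1 F'" "E2 (F \<oplus>\<^bsub>xg\<^esub> F') = E2 F \<oplus>\<^bsub>xg\<^esub> E2 F'"
  by (auto simp: E1_def E2_def add_xg pderiv_add fun_eq_iff algebra_simps)

lemma der_derivation:
  defines "d \<equiv> restrict der (carrier xg)"
  shows "k_derivation p d" "d R_x = R_of_group_alg lam" "d R_g = R_x \<otimes>\<^bsub>xg\<^esub> R_g"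
proof -
  have cl: "der F \<in> carrier xg" if "F \<in> carrier xg" for F
    using that by (simp add: der_def)
  have add: "der (F \<oplus>\<^bsub>xg\<^esub> F') = der F \<oplus>\<^bsub>xg\<^esub> der F'" if "F \<in> carrier xg" "F' \<in> carrier xg" for F F'
    using that by (simp add: der_def E_add R.r_distr R.a_ac)
  have mult: "der (F \<otimes>\<^bsub>xg\<^esub> F') = F \<otimes>\<^bsub>xg\<^esub> der F' \<oplus>\<^bsub>xg\<^esub> der F \<otimes>\<^bsub>xg\<^esub> F'"
    if "F \<in> carrier xg" "F' \<in> carrier xg" for F F'
    using that by (simp add: der_def E1_mult E2_mult R.r_distr R.l_distr R.a_ac R.m_ac)
  have E0: "E1 (smash_single 0 q) = \<zero>\<^bsub>xg\<^esub>" for q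
    by (auto simp: E1_def smash_single_def zero_xg)
  have E2s: "E2 (smash_single i q) = smash_single i (pderiv q)" for i q
    by (auto simp: E2_def smash_single_def)
  have z: "smash_single i 0 = \<zero>\<^bsub>xg\<^esub>" for i
    by (auto simp: smash_single_def zero_xg)
  have c: "der (smash_single 0 [:c:]) = \<zero>\<^bsub>xg\<^esub>" for c
    by (simp add: der_def E0 E2s pderiv_pCons z)
  show "k_derivation p d"
    unfolding k_derivation_def d_def using cl add mult c by auto
  show "d R_x = R_of_group_alg lam"
    using R_lam_closed R_x_closed unfolding d_def
    by (simp add: der_def) (simp add: R_x_def E0 E2s pderiv_pCons flip: one_xg one_pCons)
  have "E1 R_g = R_x \<otimes>\<^bsub>xg\<^esub> R_g"
    using p_gt_2 by (simp add: R_x_def R_g_def single_mult_xg E1_def) (auto simp: smash_single_def)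
  then show "d R_g = R_x \<otimes>\<^bsub>xg\<^esub> R_g"
    using R_g_closed unfolding d_def
    by (simp add: der_def) (simp add: R_g_def E2s pderiv_1 z)
qed

text \<open>\<open>pi0\<close> and \<open>pi1\<close> are the evaluation maps from \<open>k[g]\<close> and \<open>k[g][x]\<close> to \<open>R\<close>.\<close>

definition pi0 :: "'k poly \<Rightarrow> int \<Rightarrow> 'k poly" where
  "pi0 c = fold_coeffs (\<lambda>a F. smash_single 0 [:a:] \<oplus>\<^bsub>xg\<^esub> R_g \<otimes>\<^bsub>xg\<^esub> F) c \<zero>\<^bsub>xg\<^esub>"

definition pi1 :: "'k poly poly \<Rightarrow> int \<Rightarrow> 'k poly" where
  "pi1 f = fold_coeffs (\<lambda>c F. pi0 c \<oplus>\<^bsub>xg\<^esub> R_x \<otimes>\<^bsub>xg\<^esub> F) f \<zero>\<^bsub>xg\<^esub>"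

lemma single_zero_xg: "smash_single i 0 = \<zero>\<^bsub>xg\<^esub>"
  by (auto simp: smash_single_def zero_xg)

lemma pi0_0 [simp]: "pi0 0 = \<zero>\<^bsub>xg\<^esub>"
  by (simp add: pi0_def)

lemma pi0_pCons: "pi0 (pCons a c) = smash_single 0 [:a:] \<oplus>\<^bsub>xg\<^esub> R_g \<otimes>\<^bsub>xg\<^esub> pi0 c"
  by (cases "c = 0"; cases "a = 0") (simp_all add: pi0_def single_zero_xg)

lemma pi1_0 [simp]: "pi1 0 = \<zero>\<^bsub>xg\<^esub>"
  by (simp add: pi1_def)

lemma pi1_pCons: "pi1 (pCons c f) = pi0 c \<oplus>\<^bsub>xg\<^esub> R_x \<otimes>\<^bsub>xg\<^esub> pi1 f"
  by (cases "f = 0"; cases "c = 0") (simp_all add: pi1_def)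

lemma pi0_closed [simp]: "pi0 c \<in> carrier xg"
  by (induction c) (simp_all add: pi0_pCons)

lemma pi1_closed [simp]: "pi1 f \<in> carrier xg"
  by (induction f) (simp_all add: pi1_pCons)

lemma const_add: "smash_single 0 [:a + b:] = smash_single 0 [:a:] \<oplus>\<^bsub>xg\<^esub> smash_single 0 [:b:]"
  using single_add_xg[of 0 "[:a:]" "[:b:]"] by simp

lemma pi0_add: "pi0 (c + c') = pi0 c \<oplus>\<^bsub>xg\<^esub> pi0 c'"
  by (induction c c' rule: poly_induct2) (simp_all add: pi0_pCons const_add R.r_distr R.a_ac)

lemma pi1_add: "pi1 (f + f') = pi1 f \<oplus>\<^bsub>xg\<^esub> pi1 f'"
  by (induction f f' rule: poly_induct2) (simp_all add: pi1_pCons pi0_add R.r_distr R.a_ac)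

lemma const_mult: "smash_single 0 [:a * b:] = smash_single 0 [:a:] \<otimes>\<^bsub>xg\<^esub> smash_single 0 [:b:]"
  using p_gt_2 by (simp add: single_mult_xg mult.commute)

lemma pi0_smult: "pi0 (Polynomial.smult a c) = smash_single 0 [:a:] \<otimes>\<^bsub>xg\<^esub> pi0 c"
  by (induction c) (simp_all add: pi0_pCons const_mult R.r_distr R.m_ac)

lemma pi0_mult: "pi0 (c * c') = pi0 c \<otimes>\<^bsub>xg\<^esub> pi0 c'"
  by (induction c) (simp_all add: pi0_pCons pi0_add pi0_smult single_zero_xg R.l_distr R.r_distr R.m_ac)

lemma pi1_smult: "pi1 (Polynomial.smult c f) = pi0 c \<otimes>\<^bsub>xg\<^esub> pi1 f"
  by (induction f) (simp_all add: pi1_pCons pi0_mult R.r_distr R.m_ac)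

lemma pi0_gg: "pi0 [:0, 1:] = R_g"
proof -
  have "smash_single 0 [:1:] = \<one>\<^bsub>xg\<^esub>" by (simp add: one_xg one_pCons)
  then show ?thesis by (simp add: pi0_pCons single_zero_xg)
qed

lemma R_g_shift: "i \<in> {0..<int p} \<Longrightarrow> (R_g \<otimes>\<^bsub>xg\<^esub> F) i = F ((i - 1) mod int p)"
  using p_gt_2 by (simp add: mult_xg R_g_def smash_single_def if_distrib[of "\<lambda>x. x * _"] cong: if_cong)

lemma R_x_mult: "F \<in> carrier xg \<Longrightarrow> (R_x \<otimes>\<^bsub>xg\<^esub> F) i = yy * F i"
  using p_gt_2
  by (auto simp: mult_xg carrier_xg R_x_def smash_single_def if_distrib[of "\<lambda>x. x * _"] cong: if_cong)

text \<open>Below degree p no exponent is reduced by g^p = 1.\<close>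

lemma pi0_eq:
  assumes "degree c < p" "i \<in> {0..<int p}"
  shows "pi0 c i = [:coeff c (nat i):]"
  using assms
proof (induction c arbitrary: i)
  case (pCons a c)
  have *: "(R_g \<otimes>\<^bsub>xg\<^esub> pi0 c) i = (if i = 0 then 0 else [:coeff c (nat i - 1):])"
  proof (cases "i = 0")
    case True
    \<comment> \<open>The cyclic shift would carry the coefficient of g^(p-1) to position 0; the
      degree bound on \<open>pCons a c\<close> excludes it.\<close>
    have "coeff c (p - 1) = 0"
    proof (cases "c = 0")
      case False
      then have "degree c < p - 1" using pCons.prems(1) by simp
      then show ?thesis by (rule coeff_eq_0)
    qed simp
    moreover have "nat (int p - 1) = p - 1" by (simp add: nat_diff_distrib')
    moreover have "(- 1) mod int p = int p - 1" using p_gt_2 by (simp add: zmod_minus1)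
    moreover have "degree c < p" using pCons.prems(1) by (cases "c = 0") auto
    ultimately show ?thesis
      using pCons.IH[of "int p - 1"] True p_gt_2 by (simp add: R_g_shift)
  next
    case False
    have "degree c < p" using pCons.prems(1) by (cases "c = 0") auto
    then show ?thesis
      using pCons.IH[of "i - 1"] pCons.prems False by (simp add: R_g_shift nat_diff_distrib')
  qed
  show ?case
  proof (cases "i = 0")
    case True
    then show ?thesis using * by (simp add: pi0_pCons add_xg smash_single_def)
  next
    case False
    then obtain m where "nat i = Suc m" using pCons.prems(2) by (cases "nat i") auto
    then show ?thesis using * False by (simp add: pi0_pCons add_xg smash_single_def)
  qed
qed (simp add: zero_xg)

lemma pi0_L: "pi0 L = R_of_group_alg lam"
proof
  fix i
  show "pi0 L i = R_of_group_alg lam i"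
  proof (cases "i \<in> {0..<int p}")
    case True
    then show ?thesis using pi0_eq[OF L_deg True] by (simp add: coeff_L R_of_group_alg_def nat_less_iff)
  next
    case False
    then show ?thesis using pi0_closed[of L] R_lam_closed unfolding carrier_xg by simp
  qed
qed

lemma pi1_surj: "F \<in> carrier xg \<Longrightarrow> \<exists>f. F = pi1 f"
proof (induction F rule: X.smash_induct[folded xg_ring_def, consumes 1, case_names zero add single])
  case zero
  then show ?case by (intro exI[of _ 0]) (simp add: zero_xg)
next
  case (add F F')
  then show ?case by (metis pi1_add add_xg)
next
  case (single i u)
  then have i: "i \<in> {0..<int p}" by (simp add: carrier_G)
  show ?case
  proof (induction u)
    case 0
    then show ?case by (intro exI[of _ 0]) (simp add: single_zero_xg)
  next
    case (pCons a u)
    then obtain f where f: "smash_single i u = pi1 f" by auto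
    have "smash_single i [:a:] = pi0 (monom a (nat i))"
    proof
      fix j
      have "pi0 (monom a (nat i)) j = 0" if "j \<notin> {0..<int p}"
        using that pi0_closed[of "monom a (nat i)"] unfolding carrier_xg by simp
      moreover have "degree (monom a (nat i)) < p"
        using i by (intro le_less_trans[OF degree_monom_le]) (simp add: nat_less_iff)
      ultimately show "smash_single i [:a:] j = pi0 (monom a (nat i)) j"
        using pi0_eq[of "monom a (nat i)" j] i
        by (cases "j \<in> {0..<int p}") (auto simp: smash_single_def eq_nat_nat_iff)
    qed
    moreover have "smash_single i (yy * u) = R_x \<otimes>\<^bsub>xg\<^esub> smash_single i u"
      using i p_gt_2 by (simp add: R_x_def single_mult_xg)
    moreover have "pCons a u = [:a:] + yy * u" by simp
    ultimately have "smash_single i (pCons a u) = pi1 (pCons (monom a (nat i)) f)"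
      by (simp only: single_add_xg f pi1_pCons)
    then show ?case by blast
  qed
qed

text \<open>A derivation is determined by its values on generators. Together with
  \<open>pi1_surj\<close> this gives the uniqueness behind \<open>delta\<close>.\<close>

lemma derivation_pi1:
  assumes d: "k_derivation p d" and x: "d R_x = R_of_group_alg lam" and g: "d R_g = R_x \<otimes>\<^bsub>xg\<^esub> R_g"
  shows "d (pi1 f) = pi1 (D f)"
proof -
  have add: "d (F \<oplus>\<^bsub>xg\<^esub> F') = d F \<oplus>\<^bsub>xg\<^esub> d F'"
    and mult: "d (F \<otimes>\<^bsub>xg\<^esub> F') = F \<otimes>\<^bsub>xg\<^esub> d F' \<oplus>\<^bsub>xg\<^esub> d F \<otimes>\<^bsub>xg\<^esub> F'"
    if "F \<in> carrier xg" "F' \<in> carrier xg" for F F'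
    using d that by (simp_all add: k_derivation_def)
  have const: "d (smash_single 0 [:c:]) = \<zero>\<^bsub>xg\<^esub>" for c using d by (simp add: k_derivation_def)
  then have zero: "d \<zero>\<^bsub>xg\<^esub> = \<zero>\<^bsub>xg\<^esub>" using single_zero_xg[of 0] by (metis pCons_0_0)
  have inner: "d (pi0 c) = R_x \<otimes>\<^bsub>xg\<^esub> pi0 (theta c)" for c
  proof (induction c)
    case (pCons a c)
    have "theta (pCons a c) = pCons 0 (c + theta c)"
      by (simp add: theta_def pderiv_pCons)
    then show ?case using pCons
      by (simp add: pi0_pCons add mult const g pi0_add single_zero_xg R.r_distr R.m_ac R.a_ac)
  qed (simp add: zero)
  show ?thesis
  proof (induction f)
    case (pCons c f)
    have "pCons c f = [:c:] + xx * f" by simp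
    then have "D (pCons c f) = [:0, theta c:] + (pCons 0 (D f) + Polynomial.smult L f)"
      by (simp only: D_add D_mult D_xx D_coeff_const) simp
    then show ?case using pCons
      by (simp only: pi1_add pi1_pCons pi1_smult pi0_L pi0_0 pi1_0)
         (simp add: pi1_pCons add mult x inner R.m_ac R.a_ac)
  qed (simp add: zero)
qed

lemma delta_pi1: "delta p lam (pi1 f) = pi1 (D f)"
proof -
  define Q where "Q d \<longleftrightarrow> k_derivation p d \<and> d R_x = R_of_group_alg lam \<and> d R_g = R_x \<otimes>\<^bsub>xg\<^esub> R_g" for d
  have "\<exists>!d. Q d"
  proof (rule ex_ex1I)
    show "\<exists>d. Q d" using der_derivation unfolding Q_def by blast
    fix d d' assume Q: "Q d" "Q d'"
    show "d = d'"
    proof (rule extensionalityI[of _ "carrier xg"])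
      show "d \<in> extensional (carrier xg)" "d' \<in> extensional (carrier xg)"
        using Q by (auto simp: Q_def k_derivation_def PiE_def)
      show "d F = d' F" if "F \<in> carrier xg" for F
        using Q pi1_surj[OF that] derivation_pi1 unfolding Q_def by metis
    qed
  qed
  then have "Q (delta p lam)" unfolding delta_def Q_def by (rule theI')
  then show ?thesis using derivation_pi1 unfolding Q_def by metis
qed

text \<open>The character \<chi> on R itself: g = 1 adds up the coefficients of the group
  elements.\<close>

definition chi' :: "(int \<Rightarrow> 'k poly) \<Rightarrow> 'k" where
  "chi' F = (\<Sum>i\<in>{0..<int p}. poly (F i) \<alpha>)"

lemma chi'_add: "chi' (F \<oplus>\<^bsub>xg\<^esub> F') = chi' F + chi' F'"
  by (simp add: chi'_def add_xg sum.distrib)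

lemma chi'_x: "F \<in> carrier xg \<Longrightarrow> chi' (R_x \<otimes>\<^bsub>xg\<^esub> F) = \<alpha> * chi' F"
  by (simp add: chi'_def R_x_mult sum_distrib_left)

lemma chi'_g: "chi' (R_g \<otimes>\<^bsub>xg\<^esub> F) = chi' F"
  unfolding chi'_def
proof (rule sum.reindex_bij_witness[of _ "\<lambda>i. (i + 1) mod int p" "\<lambda>i. (i - 1) mod int p"])
  fix i assume i: "i \<in> {0..<int p}"
  show "((i - 1) mod int p + 1) mod int p = i" "((i + 1) mod int p - 1) mod int p = i"
    using i by (simp_all add: mod_simps)
qed (use p_gt_2 in \<open>simp_all add: R_g_shift\<close>)

lemma chi'_const: "chi' (smash_single 0 [:a:]) = a"
  using p_gt_2 by (simp add: chi'_def smash_single_def if_distrib[of "\<lambda>q. poly q \<alpha>"] cong: if_cong)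

lemma chi'_pi1: "chi' (pi1 f) = chi f"
proof -
  have z: "chi' \<zero>\<^bsub>xg\<^esub> = 0" by (simp add: chi'_def zero_xg)
  have "chi' (pi0 c) = poly c 1" for c
    by (induction c) (simp_all add: z pi0_pCons chi'_add chi'_g chi'_const)
  then show ?thesis
    by (induction f) (simp_all add: z pi1_pCons chi'_add chi'_x, simp_all add: chi_def)
qed

text \<open>The ratio is unique because x g can be cancelled: x coefficient by coefficient, and g
  because it permutes the coefficients cyclically.\<close>

lemma delta_ratio_eq:
  assumes "P p = xx * r"
  shows "delta_ratio p lam = pi1 r"
proof -
  have gg: "pi1 gg = R_g" by (simp add: pi1_pCons pi0_gg)
  have "(delta p lam ^^ n) (pi1 f) = pi1 ((D ^^ n) f)" for n f
    by (induction n) (simp_all add: delta_pi1)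
  then have dp: "(delta p lam ^^ p) R_g = pi1 (P p * gg)" by (simp only: D_pow_gg flip: gg)
  have d1: "delta p lam R_g = R_x \<otimes>\<^bsub>xg\<^esub> R_g"
    unfolding gg[symmetric] delta_pi1 D_gg by (simp add: pi1_pCons pi1_smult pi0_gg)
  have "P p * gg = pCons 0 (Polynomial.smult yy r)" unfolding assms by simp
  then have e: "pi1 (P p * gg) = R_x \<otimes>\<^bsub>xg\<^esub> (R_g \<otimes>\<^bsub>xg\<^esub> pi1 r)"
    by (simp only: pi1_pCons pi1_smult pi0_gg) simp
  show ?thesis unfolding delta_ratio_def
  proof (rule the_equality)
    show "pi1 r \<in> carrier xg \<and> pi1 r \<otimes>\<^bsub>xg\<^esub> delta p lam R_g = (delta p lam ^^ p) R_g"
      by (simp only: d1 dp e) (simp add: R.m_ac)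
    fix s assume s: "s \<in> carrier xg \<and> s \<otimes>\<^bsub>xg\<^esub> delta p lam R_g = (delta p lam ^^ p) R_g"
    then have "R_x \<otimes>\<^bsub>xg\<^esub> (R_g \<otimes>\<^bsub>xg\<^esub> s) = R_x \<otimes>\<^bsub>xg\<^esub> (R_g \<otimes>\<^bsub>xg\<^esub> pi1 r)"
      using conjunct2[OF s] unfolding d1 dp e by (simp add: R.m_ac conjunct1[OF s])
    then have "(R_g \<otimes>\<^bsub>xg\<^esub> s) i = (R_g \<otimes>\<^bsub>xg\<^esub> pi1 r) i" for i
    proof -
      have "yy * (R_g \<otimes>\<^bsub>xg\<^esub> s) i = yy * (R_g \<otimes>\<^bsub>xg\<^esub> pi1 r) i"
        using fun_cong[OF \<open>R_x \<otimes>\<^bsub>xg\<^esub> (R_g \<otimes>\<^bsub>xg\<^esub> s) = _\<close>, of i] conjunct1[OF s] by (simp only: R_x_mult R.m_closed R_g_closed pi1_closed)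
      then show ?thesis by simp
    qed
    then have shift: "s ((i - 1) mod int p) = pi1 r ((i - 1) mod int p)" if "i \<in> {0..<int p}" for i
      using that by (metis R_g_shift)
    show "s = pi1 r"
    proof
      fix i
      show "s i = pi1 r i"
      proof (cases "i \<in> {0..<int p}")
        case True
        then have "((i + 1) mod int p - 1) mod int p = i" by (simp add: mod_simps)
        then show ?thesis using shift[of "(i + 1) mod int p"] p_gt_2 by simp
      next
        case False
        then show ?thesis using s pi1_closed[of r] unfolding carrier_xg by simp
      qed
    qed
  qed
qed

end

section \<open>Quotients of left modules\<close>

locale left_module = abelian_group M for M :: "('a, 'b, 'm) module_scheme" (structure) +
  fixes R :: "('a, 'n) ring_scheme"
  assumes smult_closed: "a \<in> carrier R \<Longrightarrow> x \<in> carrier M \<Longrightarrow> a \<odot> x \<in> carrier M"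
    and smult_add: "a \<in> carrier R \<Longrightarrow> x \<in> carrier M \<Longrightarrow> y \<in> carrier M \<Longrightarrow> a \<odot> (x \<oplus> y) = a \<odot> x \<oplus> a \<odot> y"
begin

lemma submoduleI:
  assumes "N \<subseteq> carrier M" "\<zero> \<in> N" "\<And>x. x \<in> N \<Longrightarrow> \<ominus> x \<in> N"
    "\<And>x y. x \<in> N \<Longrightarrow> y \<in> N \<Longrightarrow> x \<oplus> y \<in> N" "\<And>a x. a \<in> carrier R \<Longrightarrow> x \<in> N \<Longrightarrow> a \<odot> x \<in> N"
  shows "Module.submodule N R M"
  using assms by (intro Module.submodule.intro subgroup.intro submodule_axioms.intro) (simp_all add: a_inv_def)

lemma submoduleD:
  assumes "Module.submodule N R M"
  shows "N \<subseteq> carrier M" "\<zero> \<in> N" "\<And>x. x \<in> N \<Longrightarrow> \<ominus> x \<in> N"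
    "\<And>x y. x \<in> N \<Longrightarrow> y \<in> N \<Longrightarrow> x \<oplus> y \<in> N" "\<And>a x. a \<in> carrier R \<Longrightarrow> x \<in> N \<Longrightarrow> a \<odot> x \<in> N"
    "subgroup N (add_monoid M)"
proof -
  show s: "subgroup N (add_monoid M)" using assms by (simp add: Module.submodule_def)
  show "N \<subseteq> carrier M" "\<zero> \<in> N" using subgroup.subset[OF s] subgroup.one_closed[OF s] by simp_all
  show "\<ominus> x \<in> N" if "x \<in> N" for x
    using subgroup.m_inv_closed[OF s that] by (simp add: a_inv_def)
  show "x \<oplus> y \<in> N" if "x \<in> N" "y \<in> N" for x y
    using subgroup.m_closed[OF s that] by simp
  show "a \<odot> x \<in> N" if "a \<in> carrier R" "x \<in> N" for a x
    using assms that by (simp add: Module.submodule_def submodule_axioms_def)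
qed

lemma smult_minus:
  assumes "a \<in> carrier R" "x \<in> carrier M" "y \<in> carrier M"
  shows "a \<odot> (x \<ominus> y) = a \<odot> x \<ominus> a \<odot> y"
proof -
  have "a \<odot> (x \<ominus> y) \<oplus> a \<odot> y = a \<odot> x"
    using assms by (simp add: minus_eq a_assoc l_neg flip: smult_add)
  then show ?thesis using assms
    by (metis (no_types, lifting) smult_closed minus_closed add.inv_solve_right' a_minus_def add.m_closed r_neg1 r_neg a_assoc a_inv_closed r_zero)
qed

end

locale left_submodule = left_module M R for M :: "('a, 'b, 'm) module_scheme" (structure)
    and R :: "('a, 'n) ring_scheme" +
  fixes N
  assumes N: "Module.submodule N R M"
begin

sublocale sub: abelian_subgroup N M
  by (intro abelian_subgroupI3 additive_subgroup.intro submoduleD(6) N abelian_group_axioms)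

lemma coset_eq_iff:
  assumes "x \<in> carrier M" "y \<in> carrier M"
  shows "N +> x = N +> y \<longleftrightarrow> x \<ominus> y \<in> N"
  using assms sub.a_rcos_module[of y x] sub.a_rcos_self[of x]
    a_repr_independence[OF _ _ submoduleD(6)[OF N], of x y] by (auto simp: minus_eq)

abbreviation Q where "Q \<equiv> quotient_module M N"

lemma carrier_Q: "carrier Q = (\<lambda>x. N +> x) ` carrier M"
  by (auto simp: quotient_module_def A_RCOSETS_def')

lemma zero_Q: "\<zero>\<^bsub>Q\<^esub> = N +> \<zero>"
  using submoduleD(1)[OF N] by (simp add: quotient_module_def)

lemma add_Q:
  "x \<in> carrier M \<Longrightarrow> y \<in> carrier M \<Longrightarrow> (N +> x) \<oplus>\<^bsub>Q\<^esub> (N +> y) = N +> (x \<oplus> y)"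
  by (simp add: quotient_module_def sub.a_rcos_sum)

text \<open>The union that defines the scalar product in the quotient runs over equal
  cosets.\<close>

lemma smult_Q:
  assumes a: "a \<in> carrier R" and x: "x \<in> carrier M"
  shows "a \<odot>\<^bsub>Q\<^esub> (N +> x) = N +> (a \<odot> x)"
proof -
  have *: "N +> (a \<odot> z) = N +> (a \<odot> x)" if "z \<in> N +> x" for z
  proof -
    have z: "z \<in> carrier M" using that x a_r_coset_subset_G submoduleD(1)[OF N] by blast
    have "z \<ominus> x \<in> N" using that x z sub.a_rcos_module[of x z] by (simp add: minus_eq)
    then have "a \<odot> (z \<ominus> x) \<in> N" using submoduleD(5)[OF N a] by simp
    then show ?thesis using a x z by (simp add: coset_eq_iff smult_closed smult_minus)
  qed
  have "a \<odot>\<^bsub>Q\<^esub> (N +> x) = (\<Union>z\<in>N +> x. N +> (a \<odot> z))"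
    by (simp add: quotient_module_def)
  also have "\<dots> = (\<Union>z\<in>N +> x. N +> (a \<odot> x))" by (rule SUP_cong[OF refl *])
  also have "\<dots> = N +> (a \<odot> x)" using sub.a_rcos_self[OF x] by (simp only: UN_constant) auto
  finally show ?thesis .
qed

lemma left_module_Q: "left_module Q R"
proof -
  have "abelian_group Q"
  proof (rule abelian_groupI)
    show "\<exists>Y\<in>carrier Q. Y \<oplus>\<^bsub>Q\<^esub> X = \<zero>\<^bsub>Q\<^esub>" if X: "X \<in> carrier Q" for X
    proof -
      obtain x where x: "x \<in> carrier M" "X = N +> x" using X by (auto simp: carrier_Q)
      then have "(N +> \<ominus> x) \<oplus>\<^bsub>Q\<^esub> X = \<zero>\<^bsub>Q\<^esub>" by (simp add: add_Q zero_Q l_neg)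
      then show ?thesis using x by (auto simp: carrier_Q)
    qed
  qed (auto simp: carrier_Q add_Q zero_Q a_ac)
  then show ?thesis
    by (intro left_module.intro left_module_axioms.intro)
       (auto simp: carrier_Q add_Q smult_Q smult_add smult_closed)
qed

text \<open>Correspondence theorem: a submodule above N has a submodule of the quotient as image,
  and it can be recovered from that image.\<close>

lemma maximal_if_simple_Q:
  assumes "simple_module R Q"
  shows "maximal_submodule R M N"
proof -
  interpret Q: left_module Q R by (rule left_module_Q)
  have "N \<noteq> carrier M"
  proof
    assume "N = carrier M"
    then have "N +> x = N +> \<zero>" if "x \<in> carrier M" for x using that by (subst coset_eq_iff) simp_all
    then have "carrier Q = {\<zero>\<^bsub>Q\<^esub>}" unfolding carrier_Q zero_Q using zero_closed by blast
    then show False using assms by (simp add: simple_module_def)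
  qed
  moreover have "N' = N \<or> N' = carrier M" if N': "Module.submodule N' R M" "N \<subseteq> N'" for N'
  proof -
    note D = submoduleD[OF N'(1)]
    have c: "x \<in> carrier M" if "x \<in> N'" for x using that D(1) by auto
    have "Module.submodule ((\<lambda>x. N +> x) ` N') R Q"
    proof (rule Q.submoduleI)
      fix X assume "X \<in> (\<lambda>x. N +> x) ` N'"
      then obtain x where x: "x \<in> N'" "X = N +> x" by auto
      have "\<ominus>\<^bsub>Q\<^esub> X = N +> \<ominus> x"
        using x c by (intro Q.minus_equality) (auto simp: add_Q zero_Q carrier_Q l_neg)
      then show "\<ominus>\<^bsub>Q\<^esub> X \<in> (\<lambda>x. N +> x) ` N'" using x D(3) by auto
    qed (use D c in \<open>auto simp: carrier_Q zero_Q add_Q smult_Q\<close>)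
    then consider "(\<lambda>x. N +> x) ` N' = {\<zero>\<^bsub>Q\<^esub>}" | "(\<lambda>x. N +> x) ` N' = carrier Q"
      using assms by (auto simp: simple_module_def)
    then show ?thesis
    proof cases
      case 1
      have "x \<in> N" if "x \<in> N'" for x
      proof -
        have "N +> x = N +> \<zero>" using 1 that by (auto simp: zero_Q)
        then show ?thesis using coset_eq_iff[of x \<zero>] c[OF that] minus_equality[of \<zero> \<zero>]
          by (simp add: minus_eq)
      qed
      then show ?thesis using N'(2) by auto
    next
      case 2
      have "x \<in> N'" if x: "x \<in> carrier M" for x
      proof -
        have "N +> x \<in> (\<lambda>x. N +> x) ` N'" using x 2 by (auto simp: carrier_Q)
        then obtain z where z: "z \<in> N'" "N +> x = N +> z" by auto
        then have "x \<ominus> z \<in> N'" using coset_eq_iff[of x z] x c N'(2) by auto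
        then have "(x \<ominus> z) \<oplus> z \<in> N'" using z D(4) by auto
        then show ?thesis using x c[OF z(1)] by (simp add: minus_eq a_assoc l_neg)
      qed
      then show ?thesis using D(1) by auto
    qed
  qed
  ultimately show ?thesis using N by (auto simp: maximal_submodule_def)
qed

end

text \<open>V is k[y]/(f), presented by a surjection \<theta> with kernel (f) so that cosets in
  \<Delta> fit. The classes of 1, y, ..., y^(n-1) with n = deg f form a basis.\<close>

lemma dim_poly_quotient:
  fixes f :: "'k::field poly" and V :: "('k, 'v, 'm) module_scheme"
  assumes f: "f \<noteq> 0"
    and carrier: "carrier V = range \<theta>" and zero: "\<zero>\<^bsub>V\<^esub> = \<theta> 0"
    and add: "\<And>q r. \<theta> q \<oplus>\<^bsub>V\<^esub> \<theta> r = \<theta> (q + r)"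
    and smult: "\<And>c q. c \<odot>\<^bsub>V\<^esub> \<theta> q = \<theta> (Polynomial.smult c q)"
    and eq: "\<And>q r. \<theta> q = \<theta> r \<longleftrightarrow> f dvd q - r"
  shows "vectorspace.fin_dim class_ring V \<and> vectorspace.dim class_ring V = degree f"
proof -
  have ab: "abelian_group V"
  proof (rule abelian_groupI)
    show "\<exists>Y\<in>carrier V. Y \<oplus>\<^bsub>V\<^esub> X = \<zero>\<^bsub>V\<^esub>" if X: "X \<in> carrier V" for X
    proof -
      obtain q where "X = \<theta> q" using X carrier by auto
      then show ?thesis by (intro bexI[of _ "\<theta> (- q)"]) (auto simp: add zero carrier)
    qed
  qed (auto simp: carrier add zero algebra_simps)
  have mod: "Module.module (class_ring :: 'k ring) V"
    by (intro moduleI ab class_cring.is_cring class_cring.cring_axioms)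
       (auto simp: carrier add smult smult_add_left smult_add_right)
  interpret V: vectorspace "class_ring :: 'k ring" V
    by (intro vectorspace.intro mod class_field.field_axioms)
  have fs: "finsum V (\<lambda>j. \<theta> (g j)) A = \<theta> (sum g A)" if "finite A" for g :: "nat \<Rightarrow> 'k poly" and A
    using that
    by (induction A rule: finite_induct) (simp_all add: zero V.finsum_insert carrier add Pi_def)
  define n where "n = degree f"
  define e where "e j = \<theta> (monom 1 j)" for j
  \<comment> \<open>The basis is a set of vectors, so distinctness is needed both for its
    cardinality and to index coefficients by vectors.\<close>
  have inj: "inj_on e {..<n}"
  proof (rule inj_onI, rule ccontr)
    fix i j assume ij: "i \<in> {..<n}" "j \<in> {..<n}" "e i = e j" "i \<noteq> j"
    then have d: "f dvd monom 1 i - monom 1 j" by (simp add: e_def eq)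
    have "coeff (monom 1 i - monom 1 j) i = (1 :: 'k)" using ij(4) by simp
    then have "monom 1 i - monom 1 j \<noteq> (0 :: 'k poly)" by (metis coeff_0 zero_neq_one)
    then have "n \<le> degree (monom 1 i - monom 1 j :: 'k poly)" using dvd_imp_degree_le[OF d] by (simp add: n_def)
    moreover have "degree (monom 1 i - monom 1 j :: 'k poly) < n"
      using ij(1,2) by (intro degree_diff_less) (auto intro: le_less_trans[OF degree_monom_le])
    ultimately show False by simp
  qed
  have lc: "V.lincomb a (e ` {..<n}) = \<theta> (\<Sum>j<n. monom (a (e j)) j)" for a
  proof -
    have "V.lincomb a (e ` {..<n}) = finsum V (\<lambda>j. a (e j) \<odot>\<^bsub>V\<^esub> e j) {..<n}"
      unfolding V.lincomb_def by (rule V.finsum_reindex[OF _ inj]) (auto simp: e_def smult carrier)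
    also have "\<dots> = finsum V (\<lambda>j. \<theta> (monom (a (e j)) j)) {..<n}"
      by (simp add: e_def smult smult_monom)
    finally show ?thesis by (simp add: fs)
  qed
  have sub: "e ` {..<n} \<subseteq> carrier V" by (auto simp: e_def carrier)
  have deg: "degree (\<Sum>j<n. monom (a j) j) < n" if "n > 0" for a :: "nat \<Rightarrow> 'k"
    using that by (intro degree_sum_less) (auto intro: le_less_trans[OF degree_monom_le])
  have indpt: "V.lin_indpt (e ` {..<n})"
  proof (rule V.finite_lin_indpt2[OF _ sub])
    fix a assume "V.lincomb a (e ` {..<n}) = \<zero>\<^bsub>V\<^esub>"
    then have d: "f dvd (\<Sum>j<n. monom (a (e j)) j)" by (simp add: lc zero eq)
    show "\<forall>v\<in>e ` {..<n}. a v = \<zero>\<^bsub>class_ring\<^esub>"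
    proof
      fix v assume "v \<in> e ` {..<n}"
      then obtain i where i: "i < n" "v = e i" by auto
      have "(\<Sum>j<n. monom (a (e j)) j) = 0"
        using dvd_imp_degree_le[OF d] deg[of "\<lambda>j. a (e j)"] i(1) by (force simp: n_def)
      then have "coeff (\<Sum>j<n. monom (a (e j)) j) i = 0" by simp
      then show "a v = \<zero>\<^bsub>class_ring\<^esub>" using i by (simp add: coeff_sum)
    qed
  qed simp
  have gen: "V.gen_set (e ` {..<n})"
  proof -
    have "X \<in> V.span (e ` {..<n})" if X: "X \<in> carrier V" for X
    proof -
      obtain q where q: "X = \<theta> q" using X carrier by auto
      define r where "r = q mod f"
      have X: "X = \<theta> r" by (simp add: q eq r_def minus_mod_eq_mult_div)
      have rs: "r = (\<Sum>j<n. monom (coeff r j) j)"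
      proof (cases "r = 0")
        case False
        then have "degree r < n" using degree_mod_less[OF f, of q] by (simp add: r_def n_def)
        then show ?thesis
          using poly_as_sum_of_monoms'[of r "n - 1"] by (cases n) (simp_all add: lessThan_Suc_atMost)
      qed simp
      define a where "a v = coeff r (the_inv_into {..<n} e v)" for v
      have "a (e j) = coeff r j" if "j < n" for j
        using that by (simp add: a_def the_inv_into_f_f[OF inj])
      then have "V.lincomb a (e ` {..<n}) = X"
        using rs by (simp add: lc X)
      then show ?thesis unfolding V.finite_span[OF finite_imageI[OF finite_lessThan] sub] by auto
    qed
    then show ?thesis using V.span_is_subset2[OF sub] by auto
  qed
  have "V.basis (e ` {..<n})" using indpt gen sub by (simp add: V.basis_def)
  then have "V.dim = n" using V.dim_basis[of "e ` {..<n}"] inj by (simp add: card_image)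
  moreover have "V.fin_dim" unfolding V.fin_dim_def using sub gen by (intro exI[of _ "e ` {..<n}"]) simp
  ultimately show ?thesis by (simp add: n_def)
qed

section \<open>The action of the smash product\<close>

context smash_Delta begin

lemma nat_add_mod:
  assumes "i \<in> {0..<int p}" "j \<in> {0..<int p}"
  shows "nat ((i + j) mod int p) = (nat i + nat j) mod p"
  using assms by (simp add: nat_mod_distrib nat_add_distrib)

sublocale F: smash "integer_mod_group p" "\<lambda>i. g_act ^^ nat i :: 'k free_alg \<Rightarrow> 'k free_alg"
proof (intro smash.intro smash_axioms.intro)
  fix i j and u :: "'k free_alg"
  assume "i \<in> carrier (integer_mod_group p)" "j \<in> carrier (integer_mod_group p)"
  then have "nat (i \<otimes>\<^bsub>integer_mod_group p\<^esub> j) = (nat i + nat j) mod p"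
    by (simp add: carrier_G nat_add_mod)
  then show "(g_act ^^ nat (i \<otimes>\<^bsub>integer_mod_group p\<^esub> j)) u = (g_act ^^ nat i) ((g_act ^^ nat j) u)"
    using funpow_mod_eq[OF g_act_char[OF char_p], of "nat i + nat j" u] by (simp add: funpow_add)
next
  show "(g_act ^^ nat i) (1 :: 'k free_alg) = 1" for i
    using g_act_pow_const[of "nat i" "1 :: 'k"] by (simp add: free_const_simps)
qed (simp_all add: carrier_G g_act_pow_add g_act_pow_mult)

abbreviation fs :: "(int \<Rightarrow> 'k free_alg) ring" where "fs \<equiv> free_smash p"

sublocale A: ring "free_smash p :: (int \<Rightarrow> 'k free_alg) ring"
  unfolding free_smash_def by (rule F.ring_S)

lemmas carrier_fs = F.carrier_S[folded free_smash_def, unfolded carrier_G]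
  and add_fs = F.add_S[folded free_smash_def]
  and zero_fs = F.zero_S[folded free_smash_def]
  and diff_fs = F.diff_S[folded free_smash_def]
  and single_mult_fs = F.single_mult[folded free_smash_def, unfolded carrier_G mult_integer_mod_group]
  and single_add_fs = F.single_add[folded free_smash_def]
  and fs_induct = F.smash_induct[folded free_smash_def, unfolded carrier_G, consumes 1, case_names zero add single]

lemma one_fs: "\<one>\<^bsub>fs\<^esub> = smash_single 0 1"
  by (auto simp: free_smash_def F.one_S smash_single_def)

lemma single_closed_fs [simp]: "0 \<le> i \<Longrightarrow> i < int p \<Longrightarrow> smash_single i u \<in> carrier fs"
  by (auto simp: carrier_fs smash_single_def)

lemma gens_closed [simp]: "S_x \<in> carrier fs" "S_y \<in> carrier fs" "S_g \<in> carrier fs" "S_const c \<in> carrier fs"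
  using p_gt_2 by (simp_all add: S_x_def S_y_def S_g_def S_const_def)

lemma S_of_R_closed [simp]: "F \<in> carrier xg \<Longrightarrow> S_of_R F \<in> carrier fs"
  by (simp add: S_of_R_def carrier_fs carrier_xg free_const_simps)

section \<open>Representation of the free smash product on k[y]\<close>

primrec wact :: "letter list \<Rightarrow> 'k poly \<Rightarrow> 'k poly" where
  "wact [] q = q"
| "wact (l # u) q = (case l of LX \<Rightarrow> act xx (wact u q) | LY \<Rightarrow> yy * wact u q)"

definition rho :: "'k free_alg \<Rightarrow> 'k poly \<Rightarrow> 'k poly" where
  "rho f q = (\<Sum>w\<in>Poly_Mapping.keys f. Polynomial.smult (Poly_Mapping.lookup f w) (case w of Word u \<Rightarrow> wact u q))"

lemma wact_add: "wact u (q + r) = wact u q + wact u r"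
  by (induction u) (simp_all add: act_add_right distrib_left split: letter.split)

lemma wact_smult: "wact u (Polynomial.smult c q) = Polynomial.smult c (wact u q)"
  by (induction u) (simp_all add: act_smult split: letter.split)

lemma wact_append: "wact (u @ v) q = wact u (wact v q)"
  by (induction u) (simp_all split: letter.split)

lemma rho_single: "rho (Poly_Mapping.single (Word u) c) q = Polynomial.smult c (wact u q)"
  by (cases "c = 0") (simp_all add: rho_def)

lemma rho_0 [simp]: "rho 0 q = 0"
  by (simp add: rho_def)

lemma rho_add_left: "rho (f + h) q = rho f q + rho h q"
  unfolding rho_def by (rule setsum_keys_plus_distrib) (simp_all add: smult_add_left)

lemma rho_add_right: "rho f (q + r) = rho f q + rho f r"
proof (induction f rule: single_induct)
  case (single w d)
  then show ?case by (cases w) (simp add: rho_single wact_add smult_add_right)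
qed (simp_all add: rho_add_left)

lemma rho_smult: "rho f (Polynomial.smult c q) = Polynomial.smult c (rho f q)"
proof (induction f rule: single_induct)
  case (single w d)
  then show ?case by (cases w) (simp add: rho_single wact_smult mult.commute)
qed (simp_all add: rho_add_left smult_add_right)

lemma rho_0_right [simp]: "rho f 0 = 0"
  using rho_smult[of f 0 0] by simp

lemma rho_mult: "rho (f * h) q = rho f (rho h q)"
proof (induction f rule: single_induct)
  case (single v c)
  show ?case
  proof (induction h rule: single_induct)
    case (single w d)
    then show ?case
      by (cases v; cases w) (simp add: mult_single rho_single wact_append wact_smult)
  qed (simp_all add: rho_add_left rho_add_right distrib_left)
qed (simp_all add: rho_add_left distrib_right)

lemma rho_const: "rho (free_const c) q = Polynomial.smult c q"
  by (simp add: free_const_def zero_monom2_def rho_single)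

lemma rho_1 [simp]: "rho 1 q = q"
  using rho_const[of 1 q] by (simp add: free_const_simps)

lemma rho_x: "rho (free_var LX) q = act xx q" and rho_y: "rho (free_var LY) q = yy * q"
  by (simp_all add: free_var_def rho_single)

text \<open>The smash relation for operators. On the generator y it is g y = y g + x g, which
  reflects \<delta>(g) = x g.\<close>

lemma act_g_rho: "act gg (rho f q) = rho (g_act f) (act gg q)"
proof (induction f arbitrary: q rule: free_induct)
  case (const c)
  then show ?case by (simp only: g_act_const rho_const act_smult)
next
  case LX
  then show ?case by (simp only: g_act_x rho_x flip: act_mult) (simp only: mult.commute)
next
  case LY
  have "act gg (yy * q) = yy * act gg q + act (xx * gg) q" by (simp only: act_yy D_gg)
  then show ?case by (simp only: g_act_y rho_add_left rho_x rho_y act_mult add.commute)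
next
  case (add f h)
  then show ?case by (simp only: g_act_add rho_add_left act_add_right)
next
  case (mult f h)
  then show ?case by (simp only: g_act_mult rho_mult)
qed

lemma act_g_pow_rho: "(act gg ^^ n) (rho f q) = rho ((g_act ^^ n) f) ((act gg ^^ n) q)"
  by (induction n) (simp_all add: act_g_rho)

lemma act_D_const: "D r = 0 \<Longrightarrow> act r q = Polynomial.smult (chi r) q"
  by (induction q) (simp_all add: act_pCons)

text \<open>As \<delta>(g^p) = p x g^p = 0, the element g^p acts by the scalar \<chi>(g^p) =
  1.\<close>

lemma act_g_p: "(act gg ^^ p) q = q"
proof -
  have "D (gg ^ n) = of_nat n * (xx * gg ^ n)" for n
  proof (induction n)
    case (Suc n)
    have "D (gg ^ Suc n) = gg * (of_nat n * (xx * gg ^ n)) + xx * gg * gg ^ n"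
      by (simp only: power_Suc D_mult Suc D_gg)
    also have "\<dots> = of_nat (Suc n) * (xx * gg ^ Suc n)"
      by (simp only: of_nat_Suc power_Suc distrib_right distrib_left mult_1 mult_ac add_ac)
    finally show ?case .
  qed simp
  moreover have "of_nat p = (0 :: 'k poly poly)"
    by (simp add: of_nat_poly_eq_0_iff of_nat_eq_0_iff)
  ultimately have "D (gg ^ p) = 0" by simp
  then have "act (gg ^ p) q = Polynomial.smult (chi (gg ^ p)) q" by (rule act_D_const)
  moreover have "chi (gg ^ n) = 1" for n
    by (induction n) (simp_all only: power_Suc power_0 chi_simps, simp_all)
  ultimately show ?thesis by (simp only: act_power smult_1_left)
qed

definition rhoS :: "(int \<Rightarrow> 'k free_alg) \<Rightarrow> 'k poly \<Rightarrow> 'k poly" where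
  "rhoS s q = (\<Sum>i\<in>{0..<int p}. rho (s i) ((act gg ^^ nat i) q))"

lemma act_pow_add: "(act r ^^ n) (q + q') = (act r ^^ n) q + (act r ^^ n) q'"
  by (induction n) (simp_all add: act_add_right)

lemma act_pow_smult: "(act r ^^ n) (Polynomial.smult c q) = Polynomial.smult c ((act r ^^ n) q)"
  by (induction n) (simp_all add: act_smult)

lemma rhoS_add_left: "rhoS (\<lambda>h. s h + t h) q = rhoS s q + rhoS t q"
  by (simp add: rhoS_def rho_add_left sum.distrib)

lemma rhoS_minus_left: "rhoS (\<lambda>h. s h - t h) q = rhoS s q - rhoS t q"
  using rhoS_add_left[of "\<lambda>h. s h - t h" t q] by simp

lemma rhoS_zero: "rhoS (\<lambda>_. 0) q = 0"
  by (simp add: rhoS_def)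

lemma rhoS_add_right: "rhoS s (q + r) = rhoS s q + rhoS s r"
  by (simp add: rhoS_def act_pow_add rho_add_right sum.distrib)

lemma rhoS_smult: "rhoS s (Polynomial.smult c q) = Polynomial.smult c (rhoS s q)"
proof -
  have "Polynomial.smult c (sum f A) = (\<Sum>i\<in>A. Polynomial.smult c (f i))" for f :: "int \<Rightarrow> 'k poly" and A
    by (induction A rule: infinite_finite_induct) (simp_all add: smult_add_right)
  then show ?thesis by (simp add: rhoS_def act_pow_smult rho_smult)
qed

lemma rhoS_single:
  assumes "i \<in> {0..<int p}"
  shows "rhoS (smash_single i u) q = rho u ((act gg ^^ nat i) q)"
proof -
  have "rhoS (smash_single i u) q = (\<Sum>j\<in>{0..<int p}. if j = i then rho u ((act gg ^^ nat i) q) else 0)"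
    unfolding rhoS_def by (rule sum.cong) (auto simp: smash_single_def)
  then show ?thesis using assms by simp
qed

lemma rhoS_mult:
  assumes "s \<in> carrier fs" "t \<in> carrier fs"
  shows "rhoS (s \<otimes>\<^bsub>fs\<^esub> t) q = rhoS s (rhoS t q)"
  using assms(1)
proof (induction s rule: fs_induct)
  case zero
  have "\<zero>\<^bsub>fs\<^esub> \<otimes>\<^bsub>fs\<^esub> t = \<zero>\<^bsub>fs\<^esub>" using assms(2) by simp
  then show ?case by (simp add: zero_fs rhoS_zero)
next
  case (add s s')
  then have "(s \<oplus>\<^bsub>fs\<^esub> s') \<otimes>\<^bsub>fs\<^esub> t = s \<otimes>\<^bsub>fs\<^esub> t \<oplus>\<^bsub>fs\<^esub> s' \<otimes>\<^bsub>fs\<^esub> t"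
    using assms(2) by (intro A.l_distr)
  then show ?case using add by (simp add: add_fs rhoS_add_left)
next
  case (single i u)
  note i = single
  show ?case using assms(2)
  proof (induction t rule: fs_induct)
    case zero
    have "smash_single i u \<otimes>\<^bsub>fs\<^esub> \<zero>\<^bsub>fs\<^esub> = \<zero>\<^bsub>fs\<^esub>" using i by (intro A.r_null) simp
    moreover have "rhoS (smash_single i u) 0 = 0" using rhoS_smult[of _ 0 0] by simp
    ultimately show ?case by (simp add: zero_fs rhoS_zero)
  next
    case (add t t')
    then have "smash_single i u \<otimes>\<^bsub>fs\<^esub> (t \<oplus>\<^bsub>fs\<^esub> t') = smash_single i u \<otimes>\<^bsub>fs\<^esub> t \<oplus>\<^bsub>fs\<^esub> smash_single i u \<otimes>\<^bsub>fs\<^esub> t'"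
      using i by (intro A.r_distr) auto
    then show ?case using add by (simp add: add_fs rhoS_add_left rhoS_add_right)
  next
    case (single j v)
    have "(act gg ^^ nat ((i + j) mod int p)) q = (act gg ^^ nat i) ((act gg ^^ nat j) q)"
      using funpow_mod_eq[OF act_g_p, of "nat i + nat j" q] i single by (simp add: nat_add_mod funpow_add)
    moreover have "(i + j) mod int p \<in> {0..<int p}" using p_gt_2 by simp
    ultimately show ?case
      using i single by (simp add: single_mult_fs rhoS_single rho_mult act_g_pow_rho)
  qed
qed

lemma rhoS_gens: "rhoS S_x q = act xx q" "rhoS S_y q = yy * q" "rhoS S_g q = act gg q"
  "rhoS (S_const c) q = Polynomial.smult c q"
  using p_gt_2
  by (simp_all only: S_x_def S_y_def S_g_def S_const_def, subst rhoS_single, (simp; fail),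
      simp only: nat_0 funpow_0 rho_x, subst rhoS_single, (simp; fail),
      simp only: nat_0 funpow_0 rho_y, subst rhoS_single, (simp; fail),
      simp, subst rhoS_single, (simp; fail),
      simp only: nat_0 funpow_0 rho_const)

lemma rhoS_one: "rhoS \<one>\<^bsub>fs\<^esub> q = q"
  using p_gt_2 by (simp add: one_fs rhoS_single)

lemma rhoS_diff: "t \<in> carrier fs \<Longrightarrow> rhoS (s \<ominus>\<^bsub>fs\<^esub> t) q = rhoS s q - rhoS t q"
  by (simp add: diff_fs rhoS_minus_left)

lemma S_lam: "S_of_R (R_of_group_alg lam) = (\<lambda>i. free_const (lam i))"
  by (simp add: S_of_R_def R_of_group_alg_def)

lemma rhoS_lam: "rhoS (S_of_R (R_of_group_alg lam)) q = act [:L:] q"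
proof -
  have "[:c:] = (\<Sum>j\<le>degree c. [:[:coeff c j:]:] * gg ^ j)" for c :: "'k poly"
  proof (induction c)
    case (pCons a c)
    show ?case
    proof (cases "c = 0")
      case False
      have "[:pCons a c:] = [:[:a:]:] + gg * [:c:]" by simp
      also have "gg * [:c:] = (\<Sum>j\<le>degree c. [:[:coeff c j:]:] * gg ^ Suc j)"
        by (subst pCons.IH) (simp only: sum_distrib_left power_Suc mult_ac)
      also have "[:[:a:]:] + \<dots> = (\<Sum>j\<le>Suc (degree c). [:[:coeff (pCons a c) j:]:] * gg ^ j)"
        by (simp only: sum.atMost_Suc_shift coeff_pCons_0 coeff_pCons_Suc power_0 mult_1_right)
      finally show ?thesis using False by simp
    qed simp
  qed simp
  then have "[:L:] = (\<Sum>j\<le>degree L. [:[:coeff L j:]:] * gg ^ j)" .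
  also have "\<dots> = (\<Sum>j<p. [:[:coeff L j:]:] * gg ^ j)"
    using L_deg by (intro sum.mono_neutral_left) (auto simp: coeff_eq_0)
  finally have e: "[:L:] = (\<Sum>j<p. [:[:coeff L j:]:] * gg ^ j)" .
  have "act [:L:] q = (\<Sum>j<p. Polynomial.smult (lam (int j)) ((act gg ^^ j) q))"
    unfolding e act_sum_left act_mult act_power act_const_left
    by (rule sum.cong) (simp_all add: coeff_L)
  also have "\<dots> = (\<Sum>i\<in>{0..<int p}. Polynomial.smult (lam i) ((act gg ^^ nat i) q))"
    by (rule sum.reindex_bij_witness[of _ nat int]) (auto simp: nat_less_iff)
  finally show ?thesis by (simp add: rhoS_def S_lam rho_const)
qed

lemma rhoS_S_of_R_1: "F \<in> carrier xg \<Longrightarrow> rhoS (S_of_R F) 1 = [:chi' F:]"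
proof -
  have "act gg 1 = [:chi gg:]" by (rule act_1_right)
  also have "\<dots> = 1" unfolding chi_simps(8) by (simp add: one_pCons)
  finally have g1: "(act gg ^^ n) 1 = 1" for n
    by (induction n) (simp_all only: funpow.simps o_apply id_apply)
  have x1: "rho (free_var LX ^ j) 1 = [:\<alpha> ^ j:]" for j
  proof (induction j)
    case (Suc j)
    have "rho (free_var LX ^ Suc j) 1 = act xx [:\<alpha> ^ j:]"
      by (simp only: power_Suc rho_mult rho_x Suc)
    then show ?case by (simp only: act_const chi_simps power_Suc)
  qed (simp add: one_pCons)
  have sum: "rho (sum f A) q = (\<Sum>i\<in>A. rho (f i) q)" for f A q
    by (induction A rule: infinite_finite_induct) (simp_all add: rho_add_left)
  have hom: "(\<Sum>i\<in>A. [:f i:]) = [:sum f A:]" for f :: "'z \<Rightarrow> 'k" and A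
    by (induction A rule: infinite_finite_induct) simp_all
  have "rho (S_of_R F i) 1 = [:poly (F i) \<alpha>:]" for i
    by (simp add: S_of_R_def sum rho_mult x1 rho_const poly_altdef hom)
  then show ?thesis by (simp add: rhoS_def g1 chi'_def hom)
qed


section \<open>The algebra H and the module \<Delta>\<close>

abbreviation "S_lam \<equiv> S_of_R (R_of_group_alg lam) :: int \<Rightarrow> 'k free_alg"

definition relator :: "int \<Rightarrow> 'k free_alg" where
  "relator = (S_x \<otimes>\<^bsub>fs\<^esub> S_y \<ominus>\<^bsub>fs\<^esub> S_y \<otimes>\<^bsub>fs\<^esub> S_x) \<ominus>\<^bsub>fs\<^esub> S_lam"

lemma relator_closed [simp]: "relator \<in> carrier fs"
  by (simp add: relator_def)

lemma H_ideal_eq: "H_ideal p lam = Idl\<^bsub>fs\<^esub> {relator}"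
  by (simp add: H_ideal_def relator_def)

sublocale I: ideal "H_ideal p lam" "free_smash p :: (int \<Rightarrow> 'k free_alg) ring"
  unfolding H_ideal_eq by (rule A.genideal_ideal) simp

abbreviation "H \<equiv> H_alg p lam"
abbreviation "cl s \<equiv> H_class p lam s"

sublocale H: ring "H_alg p lam"
  unfolding H_alg_def by (rule I.quotient_is_ring)

lemma carrier_H: "carrier H = cl ` carrier fs"
  by (auto simp: H_alg_def FactRing_def A_RCOSETS_def' H_class_def)

lemma cl_closed [simp]: "s \<in> carrier fs \<Longrightarrow> cl s \<in> carrier H"
  by (simp add: carrier_H)

lemma cl_mult: "s \<in> carrier fs \<Longrightarrow> t \<in> carrier fs \<Longrightarrow> cl s \<otimes>\<^bsub>H\<^esub> cl t = cl (s \<otimes>\<^bsub>fs\<^esub> t)"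
  by (simp add: H_alg_def FactRing_def H_class_def I.rcoset_mult_add)

lemma cl_add: "s \<in> carrier fs \<Longrightarrow> t \<in> carrier fs \<Longrightarrow> cl s \<oplus>\<^bsub>H\<^esub> cl t = cl (s \<oplus>\<^bsub>fs\<^esub> t)"
  by (simp add: H_alg_def FactRing_def H_class_def I.a_rcos_sum)

lemma cl_eq_iff: "s \<in> carrier fs \<Longrightarrow> t \<in> carrier fs \<Longrightarrow> cl s = cl t \<longleftrightarrow> s \<ominus>\<^bsub>fs\<^esub> t \<in> H_ideal p lam"
  unfolding H_class_def using A.quotient_eq_iff_same_a_r_cos[OF I.ideal_axioms] by simp

lemma cl_zero: "\<zero>\<^bsub>H\<^esub> = cl \<zero>\<^bsub>fs\<^esub>"
  using cl_add[of "\<zero>\<^bsub>fs\<^esub>" "\<zero>\<^bsub>fs\<^esub>"] H.add.r_cancel_one[of "cl \<zero>\<^bsub>fs\<^esub>" "cl \<zero>\<^bsub>fs\<^esub>"] by simp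

lemma cl_minus: "s \<in> carrier fs \<Longrightarrow> \<ominus>\<^bsub>H\<^esub> cl s = cl (\<ominus>\<^bsub>fs\<^esub> s)"
  by (rule H.minus_equality) (simp_all add: cl_add A.l_neg cl_zero)

lemma cl_diff: "s \<in> carrier fs \<Longrightarrow> t \<in> carrier fs \<Longrightarrow> cl s \<ominus>\<^bsub>H\<^esub> cl t = cl (s \<ominus>\<^bsub>fs\<^esub> t)"
  by (simp add: a_minus_def cl_minus cl_add)

text \<open>The annihilator of k[y] is a two-sided ideal, and it contains the relator because x y -
  y x acts as \<delta>(x) = \<lambda>.\<close>

lemma rhoS_H_ideal:
  assumes "s \<in> H_ideal p lam"
  shows "rhoS s q = 0"
proof -
  define K where "K = {s \<in> carrier fs. \<forall>q. rhoS s q = 0}"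
  have r0: "rhoS s 0 = 0" for s using rhoS_smult[of s 0 0] by simp
  have "ideal K fs"
  proof (rule idealI)
    show "subgroup K (add_monoid fs)"
    proof (rule subgroup.intro)
      fix s assume "s \<in> K"
      then have s: "s \<in> carrier fs" "rhoS s q = 0" for q by (simp_all add: K_def)
      have "inv\<^bsub>add_monoid fs\<^esub> s = (\<lambda>h. - s h)"
        using F.minus_S[folded free_smash_def, OF s(1)] by (simp only: a_inv_def)
      moreover have "rhoS (\<lambda>h. - s h) q = 0" for q
        using rhoS_minus_left[of "\<lambda>_. 0" s q] s(2) by (simp add: rhoS_zero)
      moreover have "(\<lambda>h. - s h) \<in> carrier fs" using s(1) by (simp add: carrier_fs)
      ultimately show "inv\<^bsub>add_monoid fs\<^esub> s \<in> K" by (simp add: K_def)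
    qed (auto simp: K_def add_fs rhoS_add_left zero_fs rhoS_zero carrier_fs)
  qed (auto simp: K_def rhoS_mult r0 A.ring_axioms)
  moreover have "rhoS relator q = 0" for q
    using act_yy[of xx q] by (simp add: relator_def rhoS_diff rhoS_mult rhoS_gens rhoS_lam D_xx del: mult_pCons_left)
  then have "{relator} \<subseteq> K" by (simp add: K_def)
  ultimately have "H_ideal p lam \<subseteq> K" unfolding H_ideal_eq by (rule A.genideal_minimal)
  then show ?thesis using assms by (auto simp: K_def)
qed

lemma rhoS_cl_cong: "s \<in> carrier fs \<Longrightarrow> t \<in> carrier fs \<Longrightarrow> cl s = cl t \<Longrightarrow> rhoS s q = rhoS t q"
  using rhoS_H_ideal[of "s \<ominus>\<^bsub>fs\<^esub> t" q] by (simp add: cl_eq_iff rhoS_diff)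

abbreviation "x0 \<equiv> S_x \<ominus>\<^bsub>fs\<^esub> S_const \<alpha> :: int \<Rightarrow> 'k free_alg"
abbreviation "g0 \<equiv> S_g \<ominus>\<^bsub>fs\<^esub> \<one>\<^bsub>fs\<^esub> :: int \<Rightarrow> 'k free_alg"

lemma Delta_ideal_eq:
  "Delta_ideal p lam \<alpha> = {cl (s \<otimes>\<^bsub>fs\<^esub> x0 \<oplus>\<^bsub>fs\<^esub> t \<otimes>\<^bsub>fs\<^esub> g0) | s t. s \<in> carrier fs \<and> t \<in> carrier fs}"
  (is "_ = ?R")
proof -
  have "Delta_ideal p lam \<alpha> = {(cl s \<otimes>\<^bsub>H\<^esub> cl x0) \<oplus>\<^bsub>H\<^esub> (cl t \<otimes>\<^bsub>H\<^esub> cl g0) | s t. s \<in> carrier fs \<and> t \<in> carrier fs}"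
    unfolding Delta_ideal_def carrier_H by blast
  also have "\<dots> = ?R" by (auto simp: cl_mult cl_add) (metis A.m_closed A.minus_closed gens_closed A.one_closed cl_mult cl_add)+
  finally show ?thesis .
qed

lemma lr_simps: "carrier (left_regular H) = carrier H" "add (left_regular H) = add H"
  "\<zero>\<^bsub>left_regular H\<^esub> = \<zero>\<^bsub>H\<^esub>" "smult (left_regular H) = mult H"
  by (simp_all add: left_regular_def)

lemma abelian_lr: "abelian_group (left_regular H)"
  using H.abelian_group_axioms
  by (intro abelian_groupI) (auto simp: lr_simps H.a_ac intro!: bexI[of _ "\<ominus>\<^bsub>H\<^esub> _"] H.l_neg)

sublocale M: left_module "left_regular H" H
  by (intro left_module.intro left_module_axioms.intro abelian_lr) (simp_all add: lr_simps H.r_distr)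

lemma lr_minus: "x \<in> carrier H \<Longrightarrow> \<ominus>\<^bsub>left_regular H\<^esub> x = \<ominus>\<^bsub>H\<^esub> x"
  by (rule M.minus_equality) (simp_all add: lr_simps H.l_neg)

sublocale D: left_submodule "left_regular H" H "Delta_ideal p lam \<alpha>"
proof (intro left_submodule.intro left_submodule_axioms.intro M.left_module_axioms M.submoduleI)
  show "Delta_ideal p lam \<alpha> \<subseteq> carrier (left_regular H)" by (auto simp: Delta_ideal_eq lr_simps)
  show "\<zero>\<^bsub>left_regular H\<^esub> \<in> Delta_ideal p lam \<alpha>"
    unfolding Delta_ideal_eq lr_simps cl_zero
    by (intro CollectI exI[of _ "\<zero>\<^bsub>fs\<^esub>"]) simp
next
  fix a assume "a \<in> Delta_ideal p lam \<alpha>"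
  then obtain s t where a: "a = cl (s \<otimes>\<^bsub>fs\<^esub> x0 \<oplus>\<^bsub>fs\<^esub> t \<otimes>\<^bsub>fs\<^esub> g0)" and st: "s \<in> carrier fs" "t \<in> carrier fs"
    by (auto simp: Delta_ideal_eq)
  have "\<ominus>\<^bsub>fs\<^esub> (s \<otimes>\<^bsub>fs\<^esub> x0 \<oplus>\<^bsub>fs\<^esub> t \<otimes>\<^bsub>fs\<^esub> g0) = (\<ominus>\<^bsub>fs\<^esub> s) \<otimes>\<^bsub>fs\<^esub> x0 \<oplus>\<^bsub>fs\<^esub> (\<ominus>\<^bsub>fs\<^esub> t) \<otimes>\<^bsub>fs\<^esub> g0"
    using st by (simp add: A.minus_add A.l_minus)
  then show "\<ominus>\<^bsub>left_regular H\<^esub> a \<in> Delta_ideal p lam \<alpha>"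
    unfolding Delta_ideal_eq using a st
    by (intro CollectI exI[of _ "\<ominus>\<^bsub>fs\<^esub> s"] exI[of _ "\<ominus>\<^bsub>fs\<^esub> t"]) (simp add: lr_minus cl_minus)
next
  fix a b assume "a \<in> Delta_ideal p lam \<alpha>" "b \<in> Delta_ideal p lam \<alpha>"
  then obtain s t s' t' where a: "a = cl (s \<otimes>\<^bsub>fs\<^esub> x0 \<oplus>\<^bsub>fs\<^esub> t \<otimes>\<^bsub>fs\<^esub> g0)" "b = cl (s' \<otimes>\<^bsub>fs\<^esub> x0 \<oplus>\<^bsub>fs\<^esub> t' \<otimes>\<^bsub>fs\<^esub> g0)"
    and st: "s \<in> carrier fs" "t \<in> carrier fs" "s' \<in> carrier fs" "t' \<in> carrier fs"
    by (auto simp: Delta_ideal_eq)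
  have "(s \<otimes>\<^bsub>fs\<^esub> x0 \<oplus>\<^bsub>fs\<^esub> t \<otimes>\<^bsub>fs\<^esub> g0) \<oplus>\<^bsub>fs\<^esub> (s' \<otimes>\<^bsub>fs\<^esub> x0 \<oplus>\<^bsub>fs\<^esub> t' \<otimes>\<^bsub>fs\<^esub> g0)
      = (s \<oplus>\<^bsub>fs\<^esub> s') \<otimes>\<^bsub>fs\<^esub> x0 \<oplus>\<^bsub>fs\<^esub> (t \<oplus>\<^bsub>fs\<^esub> t') \<otimes>\<^bsub>fs\<^esub> g0"
    using st by (simp add: A.l_distr A.a_ac)
  then show "a \<oplus>\<^bsub>left_regular H\<^esub> b \<in> Delta_ideal p lam \<alpha>"
    unfolding Delta_ideal_eq using a st
    by (intro CollectI exI[of _ "s \<oplus>\<^bsub>fs\<^esub> s'"] exI[of _ "t \<oplus>\<^bsub>fs\<^esub> t'"]) (simp add: lr_simps cl_add)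
next
  fix c a assume "c \<in> carrier H" "a \<in> Delta_ideal p lam \<alpha>"
  then obtain u s t where a: "c = cl u" "a = cl (s \<otimes>\<^bsub>fs\<^esub> x0 \<oplus>\<^bsub>fs\<^esub> t \<otimes>\<^bsub>fs\<^esub> g0)"
    and st: "u \<in> carrier fs" "s \<in> carrier fs" "t \<in> carrier fs"
    by (auto simp: Delta_ideal_eq carrier_H)
  have "u \<otimes>\<^bsub>fs\<^esub> (s \<otimes>\<^bsub>fs\<^esub> x0 \<oplus>\<^bsub>fs\<^esub> t \<otimes>\<^bsub>fs\<^esub> g0) = (u \<otimes>\<^bsub>fs\<^esub> s) \<otimes>\<^bsub>fs\<^esub> x0 \<oplus>\<^bsub>fs\<^esub> (u \<otimes>\<^bsub>fs\<^esub> t) \<otimes>\<^bsub>fs\<^esub> g0"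
    using st by (simp add: A.r_distr A.m_assoc)
  then show "c \<odot>\<^bsub>left_regular H\<^esub> a \<in> Delta_ideal p lam \<alpha>"
    unfolding Delta_ideal_eq using a st
    by (intro CollectI exI[of _ "u \<otimes>\<^bsub>fs\<^esub> s"] exI[of _ "u \<otimes>\<^bsub>fs\<^esub> t"]) (simp add: lr_simps cl_mult)
qed

abbreviation "Dm \<equiv> Delta_module p lam \<alpha>"

sublocale Dm: left_module "Delta_module p lam \<alpha>" H
  unfolding Delta_module_def by (rule D.left_module_Q)

definition img :: "(int \<Rightarrow> 'k free_alg) \<Rightarrow> (int \<Rightarrow> 'k free_alg) set set" where
  "img s = Delta_image p lam \<alpha> s"

lemma img_eq: "img s = Delta_ideal p lam \<alpha> +>\<^bsub>left_regular H\<^esub> cl s"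
  by (simp add: img_def Delta_image_def)

lemma carrier_Dm: "carrier Dm = img ` carrier fs"
  by (auto simp: Delta_module_def D.carrier_Q img_eq lr_simps carrier_H)

lemma img_closed [simp]: "s \<in> carrier fs \<Longrightarrow> img s \<in> carrier Dm"
  by (simp add: carrier_Dm)

lemma img_add: "s \<in> carrier fs \<Longrightarrow> t \<in> carrier fs \<Longrightarrow> img s \<oplus>\<^bsub>Dm\<^esub> img t = img (s \<oplus>\<^bsub>fs\<^esub> t)"
  by (simp add: Delta_module_def img_eq D.add_Q lr_simps cl_add)

lemma img_smult: "s \<in> carrier fs \<Longrightarrow> t \<in> carrier fs \<Longrightarrow> cl t \<odot>\<^bsub>Dm\<^esub> img s = img (t \<otimes>\<^bsub>fs\<^esub> s)"
  by (simp add: Delta_module_def img_eq D.smult_Q lr_simps cl_mult)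

lemma img_zero: "\<zero>\<^bsub>Dm\<^esub> = img \<zero>\<^bsub>fs\<^esub>"
  by (simp add: Delta_module_def D.zero_Q img_eq lr_simps cl_zero)

lemma img_eq_iff:
  "s \<in> carrier fs \<Longrightarrow> t \<in> carrier fs \<Longrightarrow> img s = img t \<longleftrightarrow> cl (s \<ominus>\<^bsub>fs\<^esub> t) \<in> Delta_ideal p lam \<alpha>"
  using D.coset_eq_iff[of "cl s" "cl t"]
  by (simp add: img_eq lr_simps lr_minus a_minus_def[of "left_regular H"] cl_diff[unfolded a_minus_def[of H]])

text \<open>Both x - \<alpha> and g - 1 kill the polynomial 1, so evaluation at 1 factors through
  \<Delta>.\<close>

lemma rhoS_img_cong:
  assumes "s \<in> carrier fs" "t \<in> carrier fs" "img s = img t"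
  shows "rhoS s 1 = rhoS t 1"
proof -
  obtain u v where uv: "cl (s \<ominus>\<^bsub>fs\<^esub> t) = cl (u \<otimes>\<^bsub>fs\<^esub> x0 \<oplus>\<^bsub>fs\<^esub> v \<otimes>\<^bsub>fs\<^esub> g0)" "u \<in> carrier fs" "v \<in> carrier fs"
    using assms by (auto simp: img_eq_iff Delta_ideal_eq)
  have r0: "rhoS s 0 = 0" for s using rhoS_smult[of s 0 0] by simp
  have x1: "rhoS x0 1 = 0"
    by (simp only: rhoS_diff gens_closed rhoS_gens act_1_right chi_simps(7)) (simp add: one_pCons)
  have g1: "rhoS g0 1 = 0"
    by (simp only: rhoS_diff A.one_closed rhoS_gens rhoS_one act_1_right chi_simps(8)) (simp add: one_pCons)
  have "rhoS (s \<ominus>\<^bsub>fs\<^esub> t) 1 = rhoS (u \<otimes>\<^bsub>fs\<^esub> x0 \<oplus>\<^bsub>fs\<^esub> v \<otimes>\<^bsub>fs\<^esub> g0) 1"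
    using uv assms by (intro rhoS_cl_cong) simp_all
  also have "\<dots> = 0"
    unfolding add_fs rhoS_add_left using uv by (simp add: rhoS_mult x1 g1 r0)
  finally show ?thesis using assms(2) by (simp add: rhoS_diff)
qed

section \<open>The isomorphism of k[y] with \<Delta>\<close>

definition embf :: "'k poly \<Rightarrow> 'k free_alg" where
  "embf q = fold_coeffs (\<lambda>c h. free_const c + free_var LY * h) q 0"

definition emb :: "'k poly \<Rightarrow> int \<Rightarrow> 'k free_alg" where
  "emb q = smash_single 0 (embf q)"

text \<open>The isomorphism from k[y]; its inverse sends the image of s to
  \<open>rhoS s 1\<close>.\<close>

definition psi :: "'k poly \<Rightarrow> (int \<Rightarrow> 'k free_alg) set set" where
  "psi q = img (emb q)"

lemma embf_0 [simp]: "embf 0 = 0"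
  by (simp add: embf_def)

lemma embf_pCons: "embf (pCons c q) = free_const c + free_var LY * embf q"
  by (cases "c = 0"; cases "q = 0") (simp_all add: embf_def free_const_simps)

lemma embf_add: "embf (q + r) = embf q + embf r"
  by (induction q r rule: poly_induct2) (simp_all add: embf_pCons free_const_simps distrib_left)

lemma embf_smult: "embf (Polynomial.smult c q) = free_const c * embf q"
proof (induction q)
  case (pCons a q)
  have "free_var LY * (free_const c * embf q) = free_const c * (free_var LY * embf q)"
    by (simp only: free_const_commute[of c "free_var LY"] flip: mult.assoc)
  with pCons show ?case by (simp add: embf_pCons free_const_simps distrib_left)
qed simp

lemma rho_embf: "rho (embf q) r = q * r"
  by (induction q) (simp_all add: embf_pCons rho_add_left rho_mult rho_const rho_y)

lemma p_pos [simp]: "0 < p" using p_gt_2 by simp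

lemma emb_closed [simp]: "emb q \<in> carrier fs"
  by (simp add: emb_def)

lemma rhoS_emb: "rhoS (emb q) 1 = q"
  by (simp add: emb_def rhoS_single rho_embf)

lemma emb_add: "emb (q + r) = emb q \<oplus>\<^bsub>fs\<^esub> emb r"
  by (simp add: emb_def embf_add single_add_fs)

lemma emb_smult: "S_const c \<otimes>\<^bsub>fs\<^esub> emb q = emb (Polynomial.smult c q)"
  by (simp add: emb_def S_const_def single_mult_fs embf_smult)

lemma emb_y: "S_y \<otimes>\<^bsub>fs\<^esub> emb q = emb (yy * q)"
  by (simp add: emb_def S_y_def single_mult_fs embf_pCons free_const_simps)

lemma emb_1: "emb 1 = \<one>\<^bsub>fs\<^esub>"
  using embf_pCons[of 1 0] by (simp add: emb_def one_fs one_pCons free_const_simps)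

lemma psi_add: "psi (q + r) = psi q \<oplus>\<^bsub>Dm\<^esub> psi r"
  by (simp add: psi_def emb_add img_add)

lemma psi_inj: "psi q = psi r \<Longrightarrow> q = r"
  using rhoS_img_cong[of "emb q" "emb r"] by (simp add: psi_def rhoS_emb)

lemma psi_closed [simp]: "psi q \<in> carrier Dm"
  by (simp add: psi_def)

text \<open>
  \<open>good B s\<close> says that \<open>s\<close> maps \<open>psi B\<close> to itself as \<open>rhoS s\<close> predicts. For \<open>x\<close> and \<open>g\<close> this is shown
  by induction on the degree: the step for \<open>x\<close> meets \<open>\<lambda>\<close>, hence all powers of \<open>g\<close>, in lower degree.
\<close>

definition good :: "'k poly set \<Rightarrow> (int \<Rightarrow> 'k free_alg) \<Rightarrow> bool" where
  "good B s \<longleftrightarrow> s \<in> carrier fs \<and> (\<forall>q\<in>B. img (s \<otimes>\<^bsub>fs\<^esub> emb q) = psi (rhoS s q) \<and> rhoS s q \<in> B)"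

lemma good_mult:
  assumes "good B s" "good B t"
  shows "good B (s \<otimes>\<^bsub>fs\<^esub> t)"
proof -
  have c: "s \<in> carrier fs" "t \<in> carrier fs" using assms by (simp_all add: good_def)
  have "img (s \<otimes>\<^bsub>fs\<^esub> t \<otimes>\<^bsub>fs\<^esub> emb q) = psi (rhoS s (rhoS t q))" if q: "q \<in> B" for q
  proof -
    have "img (s \<otimes>\<^bsub>fs\<^esub> t \<otimes>\<^bsub>fs\<^esub> emb q) = cl s \<odot>\<^bsub>Dm\<^esub> img (t \<otimes>\<^bsub>fs\<^esub> emb q)"
      using c by (simp add: img_smult A.m_assoc)
    also have "\<dots> = img (s \<otimes>\<^bsub>fs\<^esub> emb (rhoS t q))"
      using assms(2) q c by (simp add: good_def) (simp add: psi_def img_smult)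
    finally show ?thesis using assms q by (simp add: good_def)
  qed
  then show ?thesis using assms c by (simp add: good_def rhoS_mult)
qed

lemma good_add:
  assumes "good B s" "good B t" and B: "\<And>q r. q \<in> B \<Longrightarrow> r \<in> B \<Longrightarrow> q + r \<in> B"
  shows "good B (\<lambda>h. s h + t h)"
proof -
  have c: "s \<in> carrier fs" "t \<in> carrier fs" using assms by (simp_all add: good_def)
  have "img ((s \<oplus>\<^bsub>fs\<^esub> t) \<otimes>\<^bsub>fs\<^esub> emb q) = psi (rhoS s q + rhoS t q)" if "q \<in> B" for q
  proof -
    have "img ((s \<oplus>\<^bsub>fs\<^esub> t) \<otimes>\<^bsub>fs\<^esub> emb q) = img (s \<otimes>\<^bsub>fs\<^esub> emb q) \<oplus>\<^bsub>Dm\<^esub> img (t \<otimes>\<^bsub>fs\<^esub> emb q)"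
      using c by (simp add: A.l_distr img_add)
    then show ?thesis using assms(1,2) that by (simp add: good_def psi_add)
  qed
  moreover have "(\<lambda>h. s h + t h) = s \<oplus>\<^bsub>fs\<^esub> t" by (simp add: add_fs)
  moreover have "s \<oplus>\<^bsub>fs\<^esub> t \<in> carrier fs" using c by simp
  moreover have "rhoS (s \<oplus>\<^bsub>fs\<^esub> t) q = rhoS s q + rhoS t q" for q
    by (simp add: add_fs rhoS_add_left)
  ultimately show ?thesis using assms by (simp add: good_def)
qed

lemma good_const:
  assumes "\<And>c q. q \<in> B \<Longrightarrow> Polynomial.smult c q \<in> B"
  shows "good B (S_const c)"
  using assms by (simp add: good_def emb_smult rhoS_gens psi_def)

lemma good_single:
  assumes g: "good B S_g" and u: "good B (smash_single 0 u)" and i: "i \<in> {0..<int p}"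
  shows "good B (smash_single i u)"
proof -
  have n: "good B (smash_single (int n) 1)" if "n < p" for n
    using that
  proof (induction n)
    case 0
    then show ?case by (simp add: good_def psi_def rhoS_one flip: one_fs)
  next
    case (Suc n)
    then have "S_g \<otimes>\<^bsub>fs\<^esub> smash_single (int n) 1 = smash_single (int (Suc n)) 1"
      using p_gt_2 by (simp add: S_g_def single_mult_fs g_act_def free_subst_const[of _ 1, unfolded free_const_simps] add.commute)
    with Suc g show ?case by (metis good_mult Suc_lessD)
  qed
  have "smash_single 0 u \<otimes>\<^bsub>fs\<^esub> smash_single i 1 = smash_single i u"
    using i p_gt_2 by (simp add: single_mult_fs)
  moreover have "good B (smash_single i 1)" using n[of "nat i"] i by (simp add: nat_less_iff)
  ultimately show ?thesis using good_mult[OF u] by metis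
qed

lemma good_lam:
  assumes g: "good B S_g" and B: "\<And>q r. q \<in> B \<Longrightarrow> r \<in> B \<Longrightarrow> q + r \<in> B"
    "\<And>c q. q \<in> B \<Longrightarrow> Polynomial.smult c q \<in> B"
  shows "good B S_lam"
proof -
  have "good B (\<lambda>i. if i \<in> C then free_const (lam i) else 0)" if "finite C" "C \<subseteq> {0..<int p}" for C
    using that
  proof (induction C rule: finite_induct)
    case empty
    have "0 \<in> B" if "q \<in> B" for q using B(2)[OF that, of 0] by simp
    then show ?case
      by (auto simp: good_def zero_fs[symmetric] psi_def emb_def embf_0)
         (simp_all add: zero_fs rhoS_zero smash_single_def)
  next
    case (insert i C)
    have "good B (S_const (lam i))" by (rule good_const) (rule B(2))
    then have c: "good B (smash_single 0 (free_const (lam i)))" by (simp add: S_const_def)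
    have "i \<in> {0..<int p}" using insert.prems by simp
    then have ci: "good B (smash_single i (free_const (lam i)))" by (rule good_single[OF g c])
    have IH: "good B (\<lambda>h. if h \<in> C then free_const (lam h) else 0)"
      using insert.IH insert.prems by simp
    have "good B (\<lambda>h. smash_single i (free_const (lam i)) h + (if h \<in> C then free_const (lam h) else 0))"
      by (rule good_add[OF ci IH B(1)])
    also have "(\<lambda>h. smash_single i (free_const (lam i)) h + (if h \<in> C then free_const (lam h) else 0))
        = (\<lambda>h. if h \<in> insert i C then free_const (lam h) else 0)"
      using insert.hyps by (auto simp: smash_single_def fun_eq_iff)
    finally show ?case .
  qed
  from this[of "{0..<int p}"]
  have "good B (\<lambda>i. if i \<in> {0..<int p} then free_const (lam i) else 0)" by simp
  moreover have "(\<lambda>i. if i \<in> {0..<int p} then free_const (lam i) else 0) = S_lam"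
    unfolding S_lam using lam_out by (intro ext) (metis free_const_simps(1))
  ultimately show ?thesis by simp
qed

lemma img_gens: "img S_x = img (S_const \<alpha>)" "img S_g = img \<one>\<^bsub>fs\<^esub>"
proof -
  have "cl x0 \<in> Delta_ideal p lam \<alpha>" 
    unfolding Delta_ideal_eq by (intro CollectI exI[of _ "\<one>\<^bsub>fs\<^esub>"] exI[of _ "\<zero>\<^bsub>fs\<^esub>"]) simp
  then show "img S_x = img (S_const \<alpha>)" by (simp add: img_eq_iff)
  have "cl g0 \<in> Delta_ideal p lam \<alpha>" 
    unfolding Delta_ideal_eq by (intro CollectI exI[of _ "\<zero>\<^bsub>fs\<^esub>"] exI[of _ "\<one>\<^bsub>fs\<^esub>"]) simp
  then show "img S_g = img \<one>\<^bsub>fs\<^esub>" by (simp add: img_eq_iff)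
qed

lemma g_y: "S_g \<otimes>\<^bsub>fs\<^esub> S_y = S_x \<otimes>\<^bsub>fs\<^esub> S_g \<oplus>\<^bsub>fs\<^esub> S_y \<otimes>\<^bsub>fs\<^esub> S_g"
  using p_gt_2 by (simp add: S_x_def S_y_def S_g_def single_mult_fs g_act_y single_add_fs)

lemma cl_x_y: "cl (S_x \<otimes>\<^bsub>fs\<^esub> S_y) = cl (S_y \<otimes>\<^bsub>fs\<^esub> S_x \<oplus>\<^bsub>fs\<^esub> S_lam)"
proof -
  have "S_x \<otimes>\<^bsub>fs\<^esub> S_y \<ominus>\<^bsub>fs\<^esub> (S_y \<otimes>\<^bsub>fs\<^esub> S_x \<oplus>\<^bsub>fs\<^esub> S_lam) = relator"
    by (simp add: relator_def a_minus_def A.minus_add A.a_assoc)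
  then show ?thesis by (simp add: cl_eq_iff H_ideal_eq A.genideal_self')
qed

lemma good_x_g: "good {q. degree q \<le> n} S_x \<and> good {q. degree q \<le> n} S_g"
proof -
  \<comment> \<open>Degree 0: the element s passes the constant c, and its image in \<Delta> is a
    scalar; r serves only to name that scalar.\<close>
  have base: "img (s \<otimes>\<^bsub>fs\<^esub> emb [:c:]) = psi [:chi r * c:]"
    if s: "s \<in> carrier fs" "img s = img (S_const (chi r))" "s \<otimes>\<^bsub>fs\<^esub> S_const c = S_const c \<otimes>\<^bsub>fs\<^esub> s" for s c r
  proof -
    have e: "emb [:d:] = S_const d" for d
      by (simp add: emb_def S_const_def embf_pCons)
    have "img (s \<otimes>\<^bsub>fs\<^esub> emb [:c:]) = cl (S_const c) \<odot>\<^bsub>Dm\<^esub> img s"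
      using s(1,3) by (simp add: e img_smult)
    also have "\<dots> = img (S_const c \<otimes>\<^bsub>fs\<^esub> S_const (chi r))"
      unfolding s(2) by (rule img_smult) simp_all
    also have "S_const c \<otimes>\<^bsub>fs\<^esub> S_const (chi r) = emb [:chi r * c:]"
      using p_gt_2 by (simp add: e S_const_def single_mult_fs mult.commute flip: free_const_simps)
    finally show ?thesis by (simp add: psi_def)
  qed
  have xb: "img (S_x \<otimes>\<^bsub>fs\<^esub> emb [:c:]) = psi (act xx [:c:])" for c
  proof -
    have "img (S_x \<otimes>\<^bsub>fs\<^esub> emb [:c:]) = psi [:chi xx * c:]"
      using p_gt_2 by (intro base)
        (simp_all add: img_gens, simp_all add: S_x_def S_const_def single_mult_fs free_const_commute)
    then show ?thesis by (simp only: act_const)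
  qed
  have gb: "img (S_g \<otimes>\<^bsub>fs\<^esub> emb [:c:]) = psi (act gg [:c:])" for c
  proof -
    have o: "S_const (chi gg) = \<one>\<^bsub>fs\<^esub>"
      by (simp only: chi_simps(8) S_const_def one_fs free_const_simps)
    have "img (S_g \<otimes>\<^bsub>fs\<^esub> emb [:c:]) = psi [:chi gg * c:]"
      using p_gt_2 unfolding o[symmetric] by (intro base)
        (simp_all only: o img_gens, simp_all add: S_g_def S_const_def single_mult_fs g_act_const)
    then show ?thesis by (simp only: act_const)
  qed
  have split: "emb (pCons c q) = emb [:c:] \<oplus>\<^bsub>fs\<^esub> S_y \<otimes>\<^bsub>fs\<^esub> emb q" for c q
    by (simp add: emb_y flip: emb_add)
  have fin: "good {q. degree q \<le> n} S_x \<and> good {q. degree q \<le> n} S_g"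
    if "\<And>q. degree q \<le> n \<Longrightarrow> img (S_x \<otimes>\<^bsub>fs\<^esub> emb q) = psi (act xx q)"
      "\<And>q. degree q \<le> n \<Longrightarrow> img (S_g \<otimes>\<^bsub>fs\<^esub> emb q) = psi (act gg q)" for n
    unfolding good_def rhoS_gens using that le_trans[OF degree_act_le] by simp
  show ?thesis
  proof (induction n)
    case 0
    show ?case
    proof (rule fin)
      fix q :: "'k poly" assume "degree q \<le> 0"
      then obtain c where "q = [:c:]" using degree_eq_zeroE by blast
      then show "img (S_x \<otimes>\<^bsub>fs\<^esub> emb q) = psi (act xx q)" "img (S_g \<otimes>\<^bsub>fs\<^esub> emb q) = psi (act gg q)"
        using xb gb by blast+
    qed
  next
    case (Suc n)
    let ?B = "{q. degree q \<le> n} :: 'k poly set"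
    have B: "q + r \<in> ?B" "Polynomial.smult c q \<in> ?B" if "q \<in> ?B" "r \<in> ?B" for q r c
      using that by (auto intro: degree_add_le le_trans[OF degree_smult_le])
    have IHx: "good ?B S_x" and IHg: "good ?B S_g" using Suc by auto
    \<comment> \<open>The powers of g in \<lambda> do not raise the degree, so the induction
      hypothesis for g covers \<lambda>.\<close>
    have gl: "good ?B S_lam" using IHg B by (intro good_lam) blast+
    have xs: "img (S_x \<otimes>\<^bsub>fs\<^esub> emb (pCons c q)) = psi (act xx (pCons c q))"
      and gs: "img (S_g \<otimes>\<^bsub>fs\<^esub> emb (pCons c q)) = psi (act gg (pCons c q))" if q: "q \<in> ?B" for c q
    proof -
      have y: "cl S_y \<odot>\<^bsub>Dm\<^esub> psi r = psi (yy * r)" for r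
        by (simp add: psi_def img_smult emb_y)
      have x: "cl S_x \<odot>\<^bsub>Dm\<^esub> psi r = psi (act xx r)" if "r \<in> ?B" for r
        using IHx that by (simp add: good_def psi_def img_smult rhoS_gens)
      have gq: "img (S_g \<otimes>\<^bsub>fs\<^esub> emb q) = psi (act gg q)" and gB: "act gg q \<in> ?B"
        using IHg q by (simp_all add: good_def rhoS_gens)
      have xq: "img (S_x \<otimes>\<^bsub>fs\<^esub> emb q) = psi (act xx q)"
        using IHx q by (simp_all add: good_def rhoS_gens)
      have lq: "img (S_lam \<otimes>\<^bsub>fs\<^esub> emb q) = psi (act [:L:] q)"
        using gl q by (simp add: good_def rhoS_lam)
      have "img (S_x \<otimes>\<^bsub>fs\<^esub> S_y \<otimes>\<^bsub>fs\<^esub> emb q) = cl (S_x \<otimes>\<^bsub>fs\<^esub> S_y) \<odot>\<^bsub>Dm\<^esub> psi q"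
        by (simp add: psi_def img_smult)
      also have "\<dots> = img ((S_y \<otimes>\<^bsub>fs\<^esub> S_x \<oplus>\<^bsub>fs\<^esub> S_lam) \<otimes>\<^bsub>fs\<^esub> emb q)"
        by (simp add: cl_x_y psi_def img_smult)
      also have "\<dots> = cl S_y \<odot>\<^bsub>Dm\<^esub> img (S_x \<otimes>\<^bsub>fs\<^esub> emb q) \<oplus>\<^bsub>Dm\<^esub> img (S_lam \<otimes>\<^bsub>fs\<^esub> emb q)"
        by (simp add: A.l_distr img_smult A.m_assoc flip: img_add)
      also have "\<dots> = psi (yy * act xx q + act (D xx) q)"
        by (simp only: xq lq y psi_add D_xx)
      finally have "img (S_x \<otimes>\<^bsub>fs\<^esub> (S_y \<otimes>\<^bsub>fs\<^esub> emb q)) = psi (act xx (yy * q))"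
        by (simp only: act_yy A.m_assoc gens_closed emb_closed)
      note yq = this
      have "img (S_x \<otimes>\<^bsub>fs\<^esub> emb (pCons c q))
          = img (S_x \<otimes>\<^bsub>fs\<^esub> emb [:c:] \<oplus>\<^bsub>fs\<^esub> S_x \<otimes>\<^bsub>fs\<^esub> (S_y \<otimes>\<^bsub>fs\<^esub> emb q))"
        unfolding split[of c q] by (simp add: A.r_distr)
      also have "\<dots> = img (S_x \<otimes>\<^bsub>fs\<^esub> emb [:c:]) \<oplus>\<^bsub>Dm\<^esub> img (S_x \<otimes>\<^bsub>fs\<^esub> (S_y \<otimes>\<^bsub>fs\<^esub> emb q))"
        by (rule img_add[symmetric]) simp_all
      also have "\<dots> = psi (act xx (pCons c q))"
        unfolding xb yq psi_add[symmetric] act_add_right[symmetric] by simp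
      finally show "img (S_x \<otimes>\<^bsub>fs\<^esub> emb (pCons c q)) = psi (act xx (pCons c q))" .
      \<comment> \<open>Moving g past y produces x applied to g q. The degree of g q is still at
        most n, so the induction hypothesis for x applies.\<close>
      have "img (S_g \<otimes>\<^bsub>fs\<^esub> (S_y \<otimes>\<^bsub>fs\<^esub> emb q)) = img (S_g \<otimes>\<^bsub>fs\<^esub> S_y \<otimes>\<^bsub>fs\<^esub> emb q)"
        by (simp add: A.m_assoc)
      also have "\<dots> = cl S_x \<odot>\<^bsub>Dm\<^esub> img (S_g \<otimes>\<^bsub>fs\<^esub> emb q) \<oplus>\<^bsub>Dm\<^esub> cl S_y \<odot>\<^bsub>Dm\<^esub> img (S_g \<otimes>\<^bsub>fs\<^esub> emb q)"
        by (simp add: g_y A.l_distr img_smult A.m_assoc flip: img_add)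
      also have "\<dots> = psi (yy * act gg q + act (D gg) q)"
        by (simp only: gq y x[OF gB] D_gg act_mult add.commute flip: psi_add)
      finally have "img (S_g \<otimes>\<^bsub>fs\<^esub> (S_y \<otimes>\<^bsub>fs\<^esub> emb q)) = psi (act gg (yy * q))"
        by (simp only: act_yy)
      note yq = this
      have "img (S_g \<otimes>\<^bsub>fs\<^esub> emb (pCons c q))
          = img (S_g \<otimes>\<^bsub>fs\<^esub> emb [:c:] \<oplus>\<^bsub>fs\<^esub> S_g \<otimes>\<^bsub>fs\<^esub> (S_y \<otimes>\<^bsub>fs\<^esub> emb q))"
        unfolding split[of c q] by (simp add: A.r_distr)
      also have "\<dots> = img (S_g \<otimes>\<^bsub>fs\<^esub> emb [:c:]) \<oplus>\<^bsub>Dm\<^esub> img (S_g \<otimes>\<^bsub>fs\<^esub> (S_y \<otimes>\<^bsub>fs\<^esub> emb q))"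
        by (rule img_add[symmetric]) simp_all
      also have "\<dots> = psi (act gg (pCons c q))"
        unfolding gb yq psi_add[symmetric] act_add_right[symmetric] by simp
      finally show "img (S_g \<otimes>\<^bsub>fs\<^esub> emb (pCons c q)) = psi (act gg (pCons c q))" .
    qed
    have *: "img (S_x \<otimes>\<^bsub>fs\<^esub> emb q) = psi (act xx q) \<and> img (S_g \<otimes>\<^bsub>fs\<^esub> emb q) = psi (act gg q)"
      if "degree q \<le> Suc n" for q
    proof -
      obtain c r where "q = pCons c r" by (cases q)
      then have "r \<in> ?B" using that by (cases "r = 0") auto
      then show ?thesis using xs gs \<open>q = pCons c r\<close> by blast
    qed
    show ?case by (rule fin) (use * in blast)+
  qed
qed

lemma good_all: "s \<in> carrier fs \<Longrightarrow> good UNIV s"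
proof (induction s rule: fs_induct)
  case zero
  then show ?case using good_const[of UNIV 0] by (simp add: S_const_def free_const_simps smash_single_def)
next
  case (add s t)
  then show ?case by (intro good_add) auto
next
  case (single i u)
  have "img (S_x \<otimes>\<^bsub>fs\<^esub> emb q) = psi (rhoS S_x q)" "img (S_g \<otimes>\<^bsub>fs\<^esub> emb q) = psi (rhoS S_g q)" for q
    using good_x_g[of "degree q"] by (simp_all add: good_def)
  then have xg: "good UNIV S_x" "good UNIV S_g" by (simp_all add: good_def)
  have u: "good UNIV (smash_single 0 u)"
  proof (induction u rule: free_induct)
    case (const c)
    then show ?case using good_const[of UNIV c] by (simp add: S_const_def)
  next
    case LX
    then show ?case using xg by (simp add: S_x_def)
  next
    case LY
    have "good UNIV S_y" by (simp add: good_def emb_y rhoS_gens psi_def)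
    then show ?case by (simp add: S_y_def)
  next
    case (add f h)
    then have "good UNIV (\<lambda>i::int. smash_single 0 f i + smash_single 0 h i)" by (rule good_add) auto
    moreover have "(\<lambda>i::int. smash_single 0 f i + smash_single 0 h i) = smash_single 0 (f + h)"
      by (auto simp: smash_single_def)
    ultimately show ?case by simp
  next
    case (mult f h)
    then have "good UNIV (smash_single 0 f \<otimes>\<^bsub>fs\<^esub> smash_single 0 h)" by (rule good_mult)
    then show ?case by (simp add: single_mult_fs)
  qed
  show ?case by (rule good_single[OF xg(2) u single])
qed

lemma smult_psi: "s \<in> carrier fs \<Longrightarrow> cl s \<odot>\<^bsub>Dm\<^esub> psi q = psi (rhoS s q)"
  using good_all[of s] by (simp add: good_def psi_def img_smult)

lemma img_eq_psi: "s \<in> carrier fs \<Longrightarrow> img s = psi (rhoS s 1)"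
proof -
  assume s: "s \<in> carrier fs"
  have "img (s \<otimes>\<^bsub>fs\<^esub> emb 1) = psi (rhoS s 1)" using good_all[OF s] by (simp add: good_def del: emb_closed)
  then show ?thesis using s by (simp add: emb_1)
qed

lemma carrier_Dm_psi: "carrier Dm = range psi"
proof -
  have "img s \<in> range psi" if "s \<in> carrier fs" for s using img_eq_psi[OF that] by blast
  then show ?thesis unfolding carrier_Dm by (auto simp: psi_def)
qed

lemma psi_0: "psi 0 = \<zero>\<^bsub>Dm\<^esub>"
  by (simp add: psi_def img_zero emb_def smash_single_def zero_fs)

section \<open>Submodules and simple quotients\<close>

lemma psi_minus: "\<ominus>\<^bsub>Dm\<^esub> psi q = psi (- q)"
  by (rule Dm.minus_equality) (simp_all flip: psi_add add: psi_0)

lemma psi_diff: "psi q \<ominus>\<^bsub>Dm\<^esub> psi r = psi (q - r)"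
  by (simp add: a_minus_def psi_minus flip: psi_add)

lemma psi_eq_iff [simp]: "psi q = psi r \<longleftrightarrow> q = r"
  using psi_inj by blast

lemma submodule_psiI:
  assumes "0 \<in> I" "\<And>q r. q \<in> I \<Longrightarrow> r \<in> I \<Longrightarrow> q + r \<in> I" "\<And>q. q \<in> I \<Longrightarrow> - q \<in> I"
    "\<And>s q. s \<in> carrier fs \<Longrightarrow> q \<in> I \<Longrightarrow> rhoS s q \<in> I"
  shows "Module.submodule (psi ` I) H Dm"
proof (rule Dm.submoduleI)
  show "\<zero>\<^bsub>Dm\<^esub> \<in> psi ` I" using assms(1) by (simp flip: psi_0)
  fix a x assume "a \<in> carrier H" "x \<in> psi ` I"
  then show "a \<odot>\<^bsub>Dm\<^esub> x \<in> psi ` I" using assms(4) by (auto simp: carrier_H smult_psi)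
qed (use assms in \<open>auto simp: psi_minus simp flip: psi_add\<close>)

lemma sing_dvd_rhoS:
  assumes f: "sing f" and "f dvd q"
  shows "f dvd rhoS s q"
proof -
  have act: "f dvd act r q" if fq: "f dvd q" for r q
  proof -
    obtain h where "q = f * h" using fq by (rule dvdE)
    then have "act r q = act r h * f" using sing_mult[OF f, of r h] by (simp only: mult.commute)
    then show ?thesis by simp
  qed
  have pow: "f dvd (act r ^^ n) q" if "f dvd q" for r n q
    using that by (induction n) (simp_all add: act)
  have "f dvd rho u q" if "f dvd q" for u q
    using that
  proof (induction u arbitrary: q rule: free_induct)
    case (const c)
    then show ?case by (simp add: rho_const dvd_smult)
  next
    case LX
    then show ?case by (simp only: rho_x act)
  next
    case LY
    then show ?case by (simp only: rho_y dvd_mult)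
  qed (simp_all add: rho_add_left rho_mult)
  then show ?thesis using pow[OF assms(2)] by (simp add: rhoS_def dvd_sum)
qed

lemma submodule_sing: "sing f \<Longrightarrow> Module.submodule (psi ` {q. f dvd q}) H Dm"
  by (rule submodule_psiI) (simp_all add: sing_dvd_rhoS)

text \<open>Stability under constants and y makes the preimage in k[y] an ideal; stability under x
  and g makes its generator singular. The zero submodule corresponds to f = 0.\<close>

lemma submodule_cases:
  assumes N: "Module.submodule N H Dm"
  obtains f where "sing f" "N = psi ` {q. f dvd q}"
proof -
  note sub = Dm.submoduleD[OF N]
  define I where "I = {q. psi q \<in> N}"
  have rh: "rhoS s q \<in> I" if "s \<in> carrier fs" "q \<in> I" for s q
    using sub(5)[of "cl s" "psi q"] that by (simp add: I_def smult_psi)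
  have add: "q + r \<in> I" if "q \<in> I" "r \<in> I" for q r
    using sub(4) that by (simp add: I_def psi_add)
  have zero: "0 \<in> I" using sub(2) by (simp add: I_def psi_0)
  have mult: "h * q \<in> I" if "q \<in> I" for h q
  proof (induction h)
    case (pCons c h)
    have "Polynomial.smult c q \<in> I" "yy * (h * q) \<in> I"
      using rh[of "S_const c" q] rh[of S_y "h * q"] that pCons.IH by (simp_all only: rhoS_gens gens_closed)
    from add[OF this] show ?case by simp
  qed (simp add: zero)
  obtain f where f: "I = {q. f dvd q}" using ideal_principal[of I] zero add mult by blast
  then have "f \<in> I" by simp
  then have "act xx f \<in> I" "act gg f \<in> I"
    using rh[of S_x f] rh[of S_g f] by (simp_all only: rhoS_gens gens_closed)
  then have "sing f" unfolding f mem_Collect_eq by (rule sing_generator)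
  moreover have "N = psi ` I" using sub(1) by (auto simp: I_def carrier_Dm_psi)
  ultimately show thesis using that f by metis
qed

lemma psi_image_subset: "psi ` {q. f dvd q} \<subseteq> psi ` {q. h dvd q} \<longleftrightarrow> h dvd f"
proof -
  have "psi ` {q. f dvd q} \<subseteq> psi ` {q. h dvd q} \<longleftrightarrow> {q. f dvd q} \<subseteq> {q. h dvd q}"
    by (rule inj_image_subset_iff) (simp add: inj_def)
  also have "\<dots> \<longleftrightarrow> h dvd f"
    using dvd_trans[of h f] by (metis Collect_mono_iff dvd_refl)
  finally show ?thesis .
qed

lemma generated_psi:
  assumes "sing f"
  shows "generated_submodule H Dm {psi f} = psi ` {q. f dvd q}"
proof
  show "generated_submodule H Dm {psi f} \<subseteq> psi ` {q. f dvd q}"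
    unfolding generated_submodule_def using submodule_sing[OF assms] by (intro Inter_lower) auto
  show "psi ` {q. f dvd q} \<subseteq> generated_submodule H Dm {psi f}"
    unfolding generated_submodule_def
  proof (rule Inter_greatest)
    fix N assume "N \<in> {N. Module.submodule N H Dm \<and> {psi f} \<subseteq> N}"
    then have N: "Module.submodule N H Dm" "psi f \<in> N" by auto
    obtain h where h: "N = psi ` {q. h dvd q}" by (rule submodule_cases[OF N(1)])
    then have "h dvd f" using N(2) by auto
    then show "psi ` {q. f dvd q} \<subseteq> N" unfolding h psi_image_subset .
  qed
qed

lemma carrier_eq_iff: "psi ` {q. f dvd q} = carrier Dm \<longleftrightarrow> f dvd 1"
proof -
  have "psi ` {q. f dvd q} = psi ` UNIV \<longleftrightarrow> {q. f dvd q} = UNIV"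
    by (rule inj_image_eq_iff) (simp add: inj_def)
  also have "\<dots> \<longleftrightarrow> f dvd 1"
    using dvd_trans[of f 1, OF _ one_dvd] by blast
  finally show ?thesis unfolding carrier_Dm_psi .
qed

context
  fixes Y :: "'k poly" and d :: nat
  assumes Y: "sing Y" "degree Y = d" "0 < d"
    and least: "\<And>f. sing f \<Longrightarrow> 0 < degree f \<Longrightarrow> d \<le> degree f"
begin

text \<open>A submodule above (Y - \<beta>) is (h) for a singular divisor h, whose degree is 0 or d
  by minimality.\<close>

lemma maximal_submodule_psi:
  "maximal_submodule H Dm (generated_submodule H Dm {psi (Y - [:\<beta>:])})"
proof -
  define f where "f = Y - [:\<beta>:]"
  have f: "sing f" using Y(1) by (simp add: f_def sing_diff_const)
  have deg: "degree f = d"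
    using Y unfolding f_def diff_conv_add_uminus by (subst degree_add_eq_left) simp_all
  then have f0: "f \<noteq> 0" using Y(3) by auto
  have "psi ` {q. f dvd q} \<noteq> carrier Dm"
    unfolding carrier_eq_iff using deg Y(3) f0 by (simp add: is_unit_iff_degree)
  moreover have "N = psi ` {q. f dvd q} \<or> N = carrier Dm"
    if N: "Module.submodule N H Dm" "psi ` {q. f dvd q} \<subseteq> N" for N
  proof -
    obtain h where h: "sing h" "N = psi ` {q. h dvd q}" by (rule submodule_cases[OF N(1)])
    then have hf: "h dvd f" using N(2) psi_image_subset by simp
    then obtain u where u: "f = h * u" by auto
    have nz: "h \<noteq> 0" "u \<noteq> 0" using u f0 by auto
    show ?thesis
    proof (cases "degree h = 0")
      case True
      then have "h dvd 1" using nz by (simp add: is_unit_iff_degree)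
      then show ?thesis using h(2) carrier_eq_iff by blast
    next
      case False
      then have "d \<le> degree h" using least h(1) by simp
      then have "degree u = 0" using deg u nz by (simp add: degree_mult_eq)
      then have "u dvd 1" using nz by (simp add: is_unit_iff_degree)
      then have "f dvd h" using u by (simp add: mult_unit_dvd_iff)
      then have "{q. f dvd q} = {q. h dvd q}" using hf dvd_trans by blast
      then show ?thesis using h(2) by simp
    qed
  qed
  ultimately have "maximal_submodule H Dm (psi ` {q. f dvd q})"
    using submodule_sing[OF f] by (simp add: maximal_submodule_def)
  then show ?thesis unfolding generated_psi[OF f, unfolded f_def] f_def .
qed

lemma simple_quotients_dim:
  assumes root: "\<And>f :: 'k poly. 0 < degree f \<Longrightarrow> \<exists>z. poly f z = 0"
  shows "simple_quotients_have_dim p lam Dm d"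
  unfolding simple_quotients_have_dim_def
proof (intro allI impI)
  fix N assume N: "Module.submodule N H Dm \<and> simple_module H (quotient_module Dm N)"
  interpret N: left_submodule Dm H N
    using N by (intro left_submodule.intro left_submodule_axioms.intro Dm.left_module_axioms) simp
  have max: "maximal_submodule H Dm N" using N.maximal_if_simple_Q N by simp
  obtain f where f: "sing f" "N = psi ` {q. f dvd q}" by (rule submodule_cases[OF conjunct1[OF N]])
  have "\<not> f dvd 1" using max unfolding maximal_submodule_def f(2) carrier_eq_iff by blast
  \<comment> \<open>The case f = 0 is still open here, and any z serves for it. It is excluded once
    f divides the nonzero g.\<close>
  obtain z where z: "poly f z = 0"
  proof (cases "f = 0")
    case False
    then have "0 < degree f" using \<open>\<not> f dvd 1\<close> by (auto simp: is_unit_iff_degree)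
    then show thesis using root that by blast
  qed (use that in simp)
  define g where "g = Y - [:poly Y z:]"
  have g: "sing g" using Y(1) by (simp add: g_def sing_diff_const)
  have degg: "degree g = d"
    using Y unfolding g_def diff_conv_add_uminus by (subst degree_add_eq_left) simp_all
  then have g0: "g \<noteq> 0" using Y(3) by auto
  \<comment> \<open>The ideal (f, g). It is proper since f and g both vanish at z, so maximality of
    N forces it to equal (f).\<close>
  define I where "I = {q + r | q r. f dvd q \<and> g dvd r}"
  have "Module.submodule (psi ` I) H Dm"
  proof (rule submodule_psiI)
    show "0 \<in> I" unfolding I_def by (intro CollectI exI[of _ 0]) simp
  next
    fix a b assume "a \<in> I" "b \<in> I"
    then obtain q r q' r' where "a = q + r" "b = q' + r'" "f dvd q" "g dvd r" "f dvd q'" "g dvd r'"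
      by (auto simp: I_def)
    then show "a + b \<in> I"
      unfolding I_def by (intro CollectI exI[of _ "q + q'"] exI[of _ "r + r'"]) simp
  next
    fix a assume "a \<in> I"
    then obtain q r where "a = q + r" "f dvd q" "g dvd r" by (auto simp: I_def)
    then show "- a \<in> I" unfolding I_def by (intro CollectI exI[of _ "- q"] exI[of _ "- r"]) simp
  next
    fix s a assume "a \<in> I"
    then obtain q r where "a = q + r" "f dvd q" "g dvd r" by (auto simp: I_def)
    then show "rhoS s a \<in> I"
      unfolding I_def using sing_dvd_rhoS[OF f(1)] sing_dvd_rhoS[OF g]
      by (intro CollectI exI[of _ "rhoS s q"] exI[of _ "rhoS s r"]) (simp add: rhoS_add_right)
  qed
  moreover have "{q. f dvd q} \<subseteq> I"
  proof
    fix q assume "q \<in> {q. f dvd q}"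
    then show "q \<in> I" unfolding I_def by (intro CollectI exI[of _ q] exI[of _ 0]) simp
  qed
  then have "N \<subseteq> psi ` I" unfolding f(2) by blast
  ultimately consider "psi ` I = N" | "psi ` I = carrier Dm"
    using max unfolding maximal_submodule_def by blast
  then have "f dvd g"
  proof cases
    case 1
    have "g \<in> I" unfolding I_def by (intro CollectI exI[of _ 0] exI[of _ g]) simp
    then have "psi g \<in> psi ` {q. f dvd q}" using 1 f(2) by blast
    then show ?thesis by auto
  next
    case 2
    then have "psi 1 \<in> psi ` I" by simp
    then obtain q r where qr: "1 = q + r" "f dvd q" "g dvd r" by (auto simp: I_def)
    have "poly q z = 0" using qr(2) z by (auto elim!: dvdE)
    moreover have "poly r z = 0" using qr(3) by (auto elim!: dvdE simp: g_def)
    ultimately have "poly 1 z = 0"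
      using arg_cong[OF qr(1), of "\<lambda>h. poly h z"] by (simp only: poly_add add_0)
    then show ?thesis by simp
  qed
  then have f0: "f \<noteq> 0" and "degree f \<le> d" using g0 degg dvd_imp_degree_le by auto
  then have "degree f > 0" using \<open>\<not> f dvd 1\<close> by (auto simp: is_unit_iff_degree)
  then have "degree f = d" using least[OF f(1)] \<open>degree f \<le> d\<close> by simp
  moreover have "vectorspace.fin_dim class_ring (restrict_scalars (\<lambda>c. cl (S_const c)) (quotient_module Dm N))
      \<and> vectorspace.dim class_ring (restrict_scalars (\<lambda>c. cl (S_const c)) (quotient_module Dm N)) = degree f"
  proof (rule dim_poly_quotient[OF f0])
    show "carrier (restrict_scalars (\<lambda>c. cl (S_const c)) (quotient_module Dm N)) = range (\<lambda>q. N +>\<^bsub>Dm\<^esub> psi q)"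
      by (auto simp: restrict_scalars_def N.carrier_Q carrier_Dm_psi)
    show "(N +>\<^bsub>Dm\<^esub> psi q = N +>\<^bsub>Dm\<^esub> psi r) = (f dvd q - r)" for q r
      by (subst N.coset_eq_iff) (auto simp: psi_diff f(2))
  qed (simp_all add: restrict_scalars_def N.zero_Q N.add_Q N.smult_Q smult_psi rhoS_gens psi_0 psi_add)
  ultimately show "H_module_has_dim p lam (quotient_module Dm N) d"
    by (simp add: H_module_has_dim_def)
qed

end

section \<open>Images of the generating elements and the augmentation of \<lambda>\<close>

lemma rhoS_S_y_pow: "rhoS (S_y [^]\<^bsub>fs\<^esub> n) q = yy ^ n * q"
proof (induction n arbitrary: q)
  case (Suc n)
  have "rhoS (S_y [^]\<^bsub>fs\<^esub> Suc n) q = rhoS (S_y [^]\<^bsub>fs\<^esub> n) (rhoS S_y q)"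
    by (simp add: rhoS_mult)
  also have "\<dots> = yy ^ n * (yy * q)" by (simp only: rhoS_gens Suc)
  finally show ?case by (simp only: power_Suc2 mult.assoc)
qed (simp add: rhoS_one)

lemma Delta_image_y: "Delta_image p lam \<alpha> (S_y \<ominus>\<^bsub>fs\<^esub> S_const \<beta>) = psi (yy - [:\<beta>:])"
proof -
  have "rhoS (S_y \<ominus>\<^bsub>fs\<^esub> S_const \<beta>) 1 = yy - [:\<beta>:]"
    by (simp only: rhoS_diff gens_closed rhoS_gens) (simp add: one_pCons)
  then show ?thesis using img_eq_psi[of "S_y \<ominus>\<^bsub>fs\<^esub> S_const \<beta>"] by (simp add: img_def)
qed

text \<open>The ratio stands to the right of y, so it meets the polynomial 1 first and becomes the
  scalar \<chi>(r).\<close>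

lemma Delta_image_Y:
  assumes r: "P p = xx * r"
  shows "Delta_image p lam \<alpha> (S_Y p lam \<ominus>\<^bsub>fs\<^esub> S_const \<beta>) = psi (Zpol (chi r) - [:\<beta>:])"
proof -
  have cl: "S_Y p lam \<in> carrier fs" by (simp add: S_Y_def delta_ratio_eq[OF r])
  have "rhoS (S_y \<otimes>\<^bsub>fs\<^esub> S_of_R (pi1 r)) 1 = Polynomial.smult (chi r) yy"
    by (simp add: rhoS_mult rhoS_gens rhoS_S_of_R_1 chi'_pi1)
  moreover have "rhoS (S_y [^]\<^bsub>fs\<^esub> p) 1 = yy ^ p" by (simp only: rhoS_S_y_pow mult_1_right)
  ultimately have "rhoS (S_Y p lam) 1 = Zpol (chi r)"
    unfolding S_Y_def delta_ratio_eq[OF r] Zpol_def by (simp only: rhoS_diff A.m_closed gens_closed S_of_R_closed pi1_closed)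
  then have "rhoS (S_Y p lam \<ominus>\<^bsub>fs\<^esub> S_const \<beta>) 1 = Zpol (chi r) - [:\<beta>:]"
    by (simp only: rhoS_diff gens_closed rhoS_gens) (simp add: one_pCons)
  then show ?thesis
    using img_eq_psi[of "S_Y p lam \<ominus>\<^bsub>fs\<^esub> S_const \<beta>"] cl by (simp add: img_def)
qed

lemma R_of_group_alg_mult:
  "R_of_group_alg (u \<otimes>\<^bsub>group_alg p\<^esub> v) = R_of_group_alg u \<otimes>\<^bsub>xg\<^esub> R_of_group_alg v"
proof -
  have "(\<Sum>i\<in>A. [:f i:]) = [:sum f A:]" for f :: "int \<Rightarrow> 'k" and A
    by (induction A rule: infinite_finite_induct) simp_all
  note hom = this[symmetric]
  have "(-a mod int p + h) mod int p = (h - a) mod int p" for a h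
    by (metis diff_conv_add_uminus add.commute mod_add_left_eq)
  then show ?thesis
    by (auto simp: R_of_group_alg_def group_alg_def smash_product_def mult_xg carrier_G hom mult.commute fun_eq_iff
        intro!: sum.cong)
qed

text \<open>The augmentation is multiplicative. The inverse is lifted to k[g][x], where this is the
  multiplicativity of \<open>chi\<close>.\<close>

lemma unit_augmentation:
  assumes "lam \<in> Units (group_alg p)"
  shows "poly L 1 \<noteq> 0"
proof -
  obtain v where v: "v \<in> carrier (group_alg p)" "lam \<otimes>\<^bsub>group_alg p\<^esub> v = \<one>\<^bsub>group_alg p\<^esub>"
    using assms by (auto simp: Units_def)
  have "R_of_group_alg v \<in> carrier xg"
    using v(1) by (simp add: group_alg_def smash_product_def R_of_group_alg_def carrier_xg carrier_G)
  then obtain f where f: "R_of_group_alg v = pi1 f" using pi1_surj by blast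
  have "R_of_group_alg (\<one>\<^bsub>group_alg p\<^esub>) = smash_single 0 [:1:]"
    by (auto simp: R_of_group_alg_def group_alg_def smash_product_def smash_single_def)
  moreover have "pi1 (Polynomial.smult L f) = R_of_group_alg (lam \<otimes>\<^bsub>group_alg p\<^esub> v)"
    by (simp only: pi1_smult pi0_L R_of_group_alg_mult f)
  ultimately have "pi1 (Polynomial.smult L f) = smash_single 0 [:1:]" by (simp only: v(2))
  then have "chi (Polynomial.smult L f) = 1"
    using chi'_pi1[of "Polynomial.smult L f"] chi'_const[of 1] by simp
  then show ?thesis by (auto simp: chi_def)
qed

lemma pi0_monom: "pi0 (monom 1 n) = smash_single (int n mod int p) 1"
proof (induction n)
  case 0
  then show ?case by (simp add: pi0_pCons single_zero_xg monom_0 one_pCons)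
next
  case (Suc n)
  have "R_g \<otimes>\<^bsub>xg\<^esub> smash_single (int n mod int p) 1 = smash_single (int (Suc n) mod int p) 1"
    using p_gt_2 by (simp add: R_g_def single_mult_xg mod_simps add.commute)
  moreover have "pi0 (monom 1 (Suc n)) = R_g \<otimes>\<^bsub>xg\<^esub> pi0 (monom 1 n)"
    by (simp add: monom_Suc pi0_pCons single_zero_xg)
  ultimately show ?case by (simp only: Suc)
qed

lemma pi0_1: "pi0 1 = smash_single 0 1"
  using pi0_monom[of 0] by (simp add: monom_eq_1)

text \<open>
  Since \<open>(1 - g)^p = 0\<close>, some multiple \<open>w = (1 - g)^n v\<close> of a nonzero \<open>v\<close> with \<open>\<lambda> v = 0\<close> is nonzero and
  fixed by \<open>g\<close>, and \<open>\<lambda>\<close> multiplies \<open>w\<close> by its augmentation.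
\<close>

lemma zero_divisor_augmentation:
  assumes "zero_divisor (group_alg p) lam"
  shows "poly L 1 = 0"
proof -
  obtain v where v: "v \<in> carrier (group_alg p)" "v \<noteq> \<zero>\<^bsub>group_alg p\<^esub>" "lam \<otimes>\<^bsub>group_alg p\<^esub> v = \<zero>\<^bsub>group_alg p\<^esub>"
  proof -
    have "u \<otimes>\<^bsub>group_alg p\<^esub> w = w \<otimes>\<^bsub>group_alg p\<^esub> u" for u w
      unfolding group_alg_def by (rule smash_trivial_comm) simp
    then show thesis using assms that unfolding zero_divisor_def by metis
  qed
  define V where "V = R_of_group_alg v"
  have V: "V \<in> carrier xg"
    using v(1) by (simp add: V_def group_alg_def smash_product_def R_of_group_alg_def carrier_xg carrier_G)
  have V0: "V \<noteq> \<zero>\<^bsub>xg\<^esub>"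
    using v(2) by (auto simp: V_def group_alg_def smash_product_def R_of_group_alg_def zero_xg fun_eq_iff)
  have "R_of_group_alg \<zero>\<^bsub>group_alg p\<^esub> = \<zero>\<^bsub>xg\<^esub>"
    by (simp add: R_of_group_alg_def group_alg_def smash_product_def zero_xg)
  then have LV: "pi0 L \<otimes>\<^bsub>xg\<^esub> V = \<zero>\<^bsub>xg\<^esub>"
    using R_of_group_alg_mult[of lam v] v(3) by (simp add: V_def pi0_L)
  define u where "u = (1 - yy :: 'k poly)"
  define c where "c n = pi0 (u ^ n) \<otimes>\<^bsub>xg\<^esub> V" for n
  have c_Suc: "c (Suc n) = pi0 u \<otimes>\<^bsub>xg\<^esub> c n" for n
    using V by (simp add: c_def pi0_mult R.m_assoc)
  \<comment> \<open>By Frobenius (1 - g)^p = 1 - g^p, and g^p = 1 in R.\<close>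
  have "c p = \<zero>\<^bsub>xg\<^esub>"
  proof -
    have ch: "CHAR('k poly) = p"
      by (rule CHAR_eqI) (simp_all add: of_nat_poly_eq_0_iff of_nat_eq_0_iff)
    then have "prime CHAR('k poly)" using prime_p by simp
    then have "u ^ p = 1 ^ p + (- yy) ^ p"
      unfolding u_def diff_conv_add_uminus by (rule freshmans_dream) (rule ch[symmetric])
    also have "\<dots> = 1 - yy ^ p"
      by (simp only: power_one power_minus_odd[OF odd_p] diff_conv_add_uminus)
    finally have "u ^ p + monom 1 p = 1" by (simp add: monom_altdef)
    then have "pi0 (u ^ p) \<oplus>\<^bsub>xg\<^esub> pi0 (monom 1 p) = pi0 1" by (simp flip: pi0_add)
    then have "pi0 (u ^ p) \<oplus>\<^bsub>xg\<^esub> smash_single 0 1 = smash_single 0 1"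
      by (simp add: pi0_monom pi0_1)
    then have "pi0 (u ^ p) = \<zero>\<^bsub>xg\<^esub>" by (metis R.add.r_cancel_one' pi0_closed const_closed R.a_comm)
    then show ?thesis using V by (simp add: c_def)
  qed
  moreover have "c 0 \<noteq> \<zero>\<^bsub>xg\<^esub>"
  proof -
    have "pi0 (1 :: 'k poly) = \<one>\<^bsub>xg\<^esub>" by (simp add: pi0_1 one_xg)
    then show ?thesis using V V0 by (simp add: c_def)
  qed
  ultimately have "\<exists>n. c n \<noteq> \<zero>\<^bsub>xg\<^esub> \<and> c (Suc n) = \<zero>\<^bsub>xg\<^esub>"
    using nat_induct[of "\<lambda>n. c n \<noteq> \<zero>\<^bsub>xg\<^esub>" p] by blast
  then obtain n where n: "c n \<noteq> \<zero>\<^bsub>xg\<^esub>" "c (Suc n) = \<zero>\<^bsub>xg\<^esub>"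
    by blast
  define w where "w = c n"
  have w: "w \<in> carrier xg" using V by (simp add: w_def c_def)
  have "pi0 L \<otimes>\<^bsub>xg\<^esub> w = \<zero>\<^bsub>xg\<^esub>"
    using R.m_lcomm[of "pi0 L" "pi0 (u ^ n)" V] V by (simp add: w_def c_def LV)
  \<comment> \<open>(1 - g) w = 0 by the choice of n, so all coefficients of w coincide.\<close>
  have "w = R_g \<otimes>\<^bsub>xg\<^esub> w"
  proof -
    have "pi0 u \<oplus>\<^bsub>xg\<^esub> R_g = \<one>\<^bsub>xg\<^esub>"
      by (simp add: u_def one_xg flip: pi0_gg pi0_add pi0_1)
    then have "(pi0 u \<oplus>\<^bsub>xg\<^esub> R_g) \<otimes>\<^bsub>xg\<^esub> w = w" using w by simp
    moreover have "pi0 u \<otimes>\<^bsub>xg\<^esub> w = \<zero>\<^bsub>xg\<^esub>" using n(2) by (simp add: c_Suc w_def)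
    ultimately show ?thesis using w by (simp add: R.l_distr)
  qed
  then have shift: "w i = w ((i - 1) mod int p)" if "i \<in> {0..<int p}" for i
    using R_g_shift[OF that, of w] by simp
  have const: "w (int j) = w 0" if "j < p" for j
    using that
  proof (induction j)
    case (Suc j)
    then show ?case using shift[of "int (Suc j)"] by simp
  qed simp
  have const': "w i = w 0" if "i \<in> {0..<int p}" for i
    using const[of "nat i"] that by (simp add: nat_less_iff)
  have "w 0 \<noteq> 0"
  proof
    assume z: "w 0 = 0"
    have "w = (\<lambda>_. 0)"
    proof
      fix i
      show "w i = 0"
      proof (cases "i \<in> {0..<int p}")
        case True
        then show ?thesis using const' z by simp
      next
        case False
        then show ?thesis using w unfolding carrier_xg by blast
      qed
    qed
    then have "w = \<zero>\<^bsub>xg\<^esub>" by (simp only: zero_xg)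
    then show False using n(1) by (simp add: w_def)
  qed
  \<comment> \<open>The coefficient of \<lambda> w at the group identity is the augmentation of
    \<lambda> times the common coefficient of w.\<close>
  moreover have "(\<Sum>i\<in>{0..<int p}. [:lam i:]) * w 0 = 0"
  proof -
    have "0 = (R_of_group_alg lam \<otimes>\<^bsub>xg\<^esub> w) 0"
      using \<open>pi0 L \<otimes>\<^bsub>xg\<^esub> w = \<zero>\<^bsub>xg\<^esub>\<close> by (simp add: pi0_L zero_xg)
    also have "\<dots> = (\<Sum>i\<in>{0..<int p}. [:lam i:] * w 0)"
      using p_gt_2 unfolding mult_xg R_of_group_alg_def by (simp, intro sum.cong refl) (subst const', simp_all)
    finally show ?thesis by (simp only: sum_distrib_right)
  qed
  ultimately have "(\<Sum>i\<in>{0..<int p}. [:lam i:]) = 0" by simp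
  moreover have "poly (\<Sum>i\<in>{0..<int p}. [:lam i:]) \<alpha> = chi' (pi0 L)"
    by (simp add: pi0_L chi'_def R_of_group_alg_def poly_sum)
  moreover have "chi' (pi0 L) = poly L 1"
    using chi'_pi1[of "[:L:]"] by (simp add: pi1_pCons)
  ultimately show ?thesis by simp
qed

lemma sing_yy: "\<alpha> = 0 \<Longrightarrow> poly L 1 = 0 \<Longrightarrow> sing yy"
proof (rule singI)
  assume z: "\<alpha> = 0" "poly L 1 = 0"
  have ab: "chi (D xx) = dx 1" "chi (D gg) = dg 1" by (simp_all add: dx_def dg_def)
  have c: "chi (D xx) = 0" "chi (D gg) = 0"
    unfolding ab by (rule trans[OF dx_1 z(2)], rule trans[OF dg_1 z(1)])
  show "act xx yy = Polynomial.smult \<alpha> yy"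
    by (simp only: act_yy_pow(1) c chi_simps) simp
  show "act gg yy = yy"
    by (simp only: act_yy_pow(1) c chi_simps) simp
qed

end

theorem proposition5p28:
  fixes p :: nat and lam :: "int \<Rightarrow> 'k :: alg_closed_field"
  assumes "prime p" and "odd p" and "CHAR('k) = p"
    and "lam \<in> carrier (group_alg p)" and "lam 0 = 1"
  shows
    "(\<forall>\<alpha>. \<alpha> \<noteq> 0 \<longrightarrow> simple_quotients_have_dim p lam (Delta_module p lam \<alpha>) (p\<^sup>2)) \<and>
     (zero_divisor (group_alg p) lam \<longrightarrow>
        (\<forall>\<beta>. maximal_submodule (H_alg p lam) (Delta_module p lam 0)
           (generated_submodule (H_alg p lam) (Delta_module p lam 0)
              {Delta_image p lam 0 (S_y \<ominus>\<^bsub>free_smash p\<^esub> S_const \<beta>)})) \<and>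
        simple_quotients_have_dim p lam (Delta_module p lam 0) 1) \<and>
     (lam \<in> Units (group_alg p) \<longrightarrow>
        (\<forall>\<beta>. maximal_submodule (H_alg p lam) (Delta_module p lam 0)
           (generated_submodule (H_alg p lam) (Delta_module p lam 0)
              {Delta_image p lam 0 (S_Y p lam \<ominus>\<^bsub>free_smash p\<^esub> S_const \<beta>)})) \<and>
        simple_quotients_have_dim p lam (Delta_module p lam 0) p)"
proof -
  define L where "L = (\<Sum>j<p. monom (lam (int j)) j)"
  have p0: "p > 0" using \<open>prime p\<close> prime_gt_0_nat by blast
  have coeff: "coeff L j = (if j < p then lam (int j) else 0)" for j
    by (simp add: L_def coeff_sum)
  have "degree L < p"
    unfolding L_def using p0 by (intro degree_sum_less) (auto intro: le_less_trans[OF degree_monom_le])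
  moreover have "lam i = 0" if "i \<notin> {0..<int p}" for i
    using assms(4) that p0 by (auto simp: group_alg_def smash_product_def carrier_integer_mod_group)
  ultimately have sm: "smash_Delta L p lam"
    using assms coeff p0 by (intro smash_Delta.intro poly_action_char.intro smash_Delta_axioms.intro) auto
  have root: "\<exists>z. poly f z = 0" if "0 < degree f" for f :: "'k poly"
    using that by (rule alg_closed_imp_poly_has_root)
  have "simple_quotients_have_dim p lam (Delta_module p lam \<alpha>) (p\<^sup>2)" if a0: "\<alpha> \<noteq> 0" for \<alpha>
  proof -
    interpret smash_Delta L \<alpha> p lam by (rule sm)
    obtain f where f: "sing f" "degree f = p\<^sup>2" using exists_sing_p2[OF a0] by blast
    show ?thesis
      using sing_p2_dvd a0 p0 by (intro simple_quotients_dim[OF f _ _ root]) (auto intro: dvd_imp_le)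
  qed
  moreover
  interpret smash_Delta L 0 p lam by (rule sm)
  have "(\<forall>\<beta>. maximal_submodule H Dm (generated_submodule H Dm
      {Delta_image p lam 0 (S_y \<ominus>\<^bsub>free_smash p\<^esub> S_const \<beta>)})) \<and> simple_quotients_have_dim p lam Dm 1"
    if "zero_divisor (group_alg p) lam"
  proof -
    have s: "sing yy" using zero_divisor_augmentation[OF that] by (simp add: sing_yy)
    have least: "1 \<le> degree f" if "0 < degree f" for f :: "'k poly" using that by simp
    show ?thesis
      unfolding Delta_image_y
      using maximal_submodule_psi[OF s] simple_quotients_dim[OF s _ _ _ root] least by simp
  qed
  moreover have "(\<forall>\<beta>. maximal_submodule H Dm (generated_submodule H Dm
      {Delta_image p lam 0 (S_Y p lam \<ominus>\<^bsub>free_smash p\<^esub> S_const \<beta>)})) \<and> simple_quotients_have_dim p lam Dm p"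
    if "lam \<in> Units (group_alg p)"
  proof -
    obtain r where r: "P p = xx * r" using obtain_P_ratio by blast
    have s: "sing (Zpol (chi r))" using sing_Zpol[OF refl r] .
    \<comment> \<open>This value is the augmentation of \<lambda>, nonzero for a unit, so p divides
      all positive degrees of singular polynomials.\<close>
    have "chi (D xx) \<noteq> 0" using unit_augmentation[OF that] unfolding D_xx chi_simps .
    then have least: "p \<le> degree f" if "sing f" "0 < degree f" for f
      using sing_coeff_p_dvd[OF that] that(2) by (intro dvd_imp_le)
    show ?thesis
      unfolding Delta_image_Y[OF r]
      using maximal_submodule_psi[OF s degree_Zpol p0 least] simple_quotients_dim[OF s degree_Zpol p0 least root]
      by simp
  qed
  ultimately show ?thesis by blast
qed

end
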